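(* Let $\beta>0$, let $\Lambda\subset\mathbb Z^d$ be finite, and let $y\in\mathbb R^{\mathbb Z^d}$. Then for every $\zeta\in\Upsilon_\beta(y)$, i.e. every $\zeta\in\Omega_\beta$ with $\beta^{-1}\int_0^\beta\zeta_j(\tau)\,d\tau=y_j$ for all $j\in\mathbb Z^d$, one has $\nu^{\rm qc}_{\beta,\Lambda}(\cdot\,|\,\zeta)=\nu^{\rm qc}_{\beta,\Lambda}(\cdot\,|\,y)$ (where on the right $y$ denotes the configuration of constant loops $\tau\mapsto y_j$), and $$\nu^{(m)}_{\beta,\Lambda}(\cdot\,|\,\zeta)\;\Rightarrow\;\nu^{\rm qc}_{\beta,\Lambda}(\cdot\,|\,\zeta)=\nu^{\rm qc}_{\beta,\Lambda}(\cdot\,|\,y)\qquad\text{as } m\to+\infty,$$ where $\Rightarrow$ denotes weak convergence of probability measures on $\Omega_{\beta,\Lambda}$, i.e. $\int G\,d\nu^{(m)}_{\beta,\Lambda}(\cdot|\zeta)\to\int G\,d\nu^{\rm qc}_{\beta,\Lambda}(\cdot|\zeta)$ for every bounded continuous $G:\Omega_{\beta,\Lambda}\to\mathbb R$.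
   Context: Standing assumptions. $d\ge 1$; $J=(J_{jk})_{j,k\in\mathbb Z^d}$ is a real symmetric matrix such that for some $r>0$, $J_{jk}=0$ whenever the Euclidean distance $|j-k|$ exceeds $r$, and $c:=\sup_j\sum_k|J_{jk}|<\infty$. The functions $U_k:\mathbb R\to\mathbb R$, $k\in\mathbb Z^d$, are continuous and there are constants $b\in\mathbb R$ and $\tilde c>\max\{c-1,0\}$ with $U_k(x)\ge\frac12\tilde c x^2+b$ for all $k\in\mathbb Z^d$, $x\in\mathbb R$. Loop spaces. For $\beta>0$, $C_\beta=\{\omega\in C([0,\beta],\mathbb R):\omega(0)=\omega(\beta)\}$ with the sup norm. For $\Lambda\subset\mathbb Z^d$, $\Omega_{\beta,\Lambda}=\{\omega_\Lambda=(\omega_k)_{k\in\Lambda}:\omega_k\in C_\beta\}$ with the product topology and the $\sigma$-algebra $\mathcal B_{\beta,\Lambda}$ generated by cylinder sets; $\Omega_\beta=\Omega_{\beta,\mathbb Z^d}$. $\Lambda^c=\mathbb Z^d\setminus\Lambda$. Energy. For finite $\Lambda$, $\omega_\Lambda\in\Omega_{\beta,\Lambda}$, $\zeta\in\Omega_\beta$, $$E_{\beta,\Lambda}(\omega_\Lambda|\zeta)=\sum_{j\in\Lambda}\int_0^\beta U_j(\omega_j(\tau))d\tau+\tfrac12\sum_{j,k\in\Lambda}J_{jk}\int_0^\beta\omega_j(\tau)\omega_k(\tau)d\tau+\sum_{j\in\Lambda,k\in\Lambda^c}J_{jk}\int_0^\beta\omega_j(\tau)\zeta_k(\tau)d\tau.$$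 Quantum reference measure. For $m>0$, $\gamma^{(m)}_\beta$ is the centered Gaussian measure on $L^2([0,\beta])$ with covariance operator $S_\beta(m)=(-m\Delta_\beta+1)^{-1}$, where $\Delta_\beta$ is the Laplacian on $[0,\beta]$ with periodic boundary conditions; equivalently $S_\beta(m)$ has eigenvalues $(mq^2+1)^{-1}$, $q\in\frac{2\pi}{\beta}\mathbb Z$, on the orthonormal basis $e_0=\beta^{-1/2}$, $e_q=\sqrt{2/\beta}\cos q\tau$ ($q>0$), $e_q=\sqrt{2/\beta}\sin q\tau$ ($q<0$). It satisfies $\gamma_\beta^{(m)}(C_\beta)=1$ and is regarded as a measure on $C_\beta$. For finite $\Lambda$, $\gamma^{(m)}_{\beta,\Lambda}=\prod_{j\in\Lambda}\gamma^{(m)}_\beta$ on $\Omega_{\beta,\Lambda}$. Quasiclassical reference measure. $\chi_{\beta,\Lambda}(dx_\Lambda)=\prod_{j\in\Lambda}\sqrt{\beta/2\pi}\,e^{-\beta x_j^2/2}dx_j$ on $\mathbb R^\Lambda$, and $\gamma^{\rm qc}_{\beta,\Lambda}$ is the image of $\chi_{\beta,\Lambda}$ under the map $\mathbb R^\Lambda\to\Omega_{\beta,\Lambda}$ sending $x_\Lambda$ to the configuration of constant loops $\omega_j(\tau)\equiv x_j$. Conditional Gibbs measures. $\nu^{(m)}_{\beta,\Lambda}(d\omega_\Lambda|\zeta)=\frac{1}{Z}\exp\{-E_{\beta,\Lambda}(\omega_\Lambda|\zeta)\}\gamma^{(m)}_{\beta,\Lambda}(d\omega_\Lambda)$ and $\nu^{\rm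 qc}_{\beta,\Lambda}(d\omega_\Lambda|\zeta)=\frac{1}{Z^{\rm qc}}\exp\{-E_{\beta,\Lambda}(\omega_\Lambda|\zeta)\}\gamma^{\rm qc}_{\beta,\Lambda}(d\omega_\Lambda)$, where $Z,Z^{\rm qc}$ (depending on $\beta,\Lambda,\zeta$, and on $m$ for $Z$) are the normalizing constants making these probability measures. *)

theory Defs
  imports "HOL-Probability.Probability"
begin

text \<open>
  A loop is an extensional function on \<open>{0..\<beta>}\<close> (equal to \<open>undefined\<close> outside), so that
  functions agreeing on \<open>{0..\<beta>}\<close> are identified; the metric of \<^const>\<open>cfunspace\<close> is the
  sup metric.  The lattice is the type \<open>int ^ 'd\<close>, the dimension being \<open>CARD('d)\<close>.
\<close>

definition loop_metric :: "real \<Rightarrow> (real \<Rightarrow> real) metric" where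
  "loop_metric \<beta> = submetric (cfunspace (top_of_set {0..\<beta>}) euclidean_metric) {\<omega>. \<omega> 0 = \<omega> \<beta>}"

definition loop_topology :: "real \<Rightarrow> (real \<Rightarrow> real) topology" where
  "loop_topology \<beta> = mtopology_of (loop_metric \<beta>)"

definition loops :: "real \<Rightarrow> (real \<Rightarrow> real) set" where
  "loops \<beta> = topspace (loop_topology \<beta>)"

lemma loops_eq:
  "loops \<beta> = {\<omega> \<in> extensional {0..\<beta>}. continuous_on {0..\<beta>} \<omega> \<and> \<omega> 0 = \<omega> \<beta>}"
proof -
  have "bounded (\<omega> ` {0..\<beta>})" if "continuous_on {0..\<beta>} \<omega>" for \<omega> :: "real \<Rightarrow> real"
    using that compact_continuous_image compact_imp_bounded by blast
  then show ?thesis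
    by (auto simp: loops_def loop_topology_def loop_metric_def)
qed

definition loop_sigma :: "real \<Rightarrow> (real \<Rightarrow> real) measure" where
  "loop_sigma \<beta> = sigma (loops \<beta>) {A. openin (loop_topology \<beta>) A}"

definition configs :: "real \<Rightarrow> 'k set \<Rightarrow> ('k \<Rightarrow> real \<Rightarrow> real) set" where
  "configs \<beta> \<Lambda> = PiE \<Lambda> (\<lambda>_. loops \<beta>)"

definition config_topology :: "real \<Rightarrow> 'k set \<Rightarrow> ('k \<Rightarrow> real \<Rightarrow> real) topology" where
  "config_topology \<beta> \<Lambda> = product_topology (\<lambda>_. loop_topology \<beta>) \<Lambda>"

text \<open>The \<open>\<sigma>\<close>-algebra generated by the cylinder sets with Borel bases in finitely many loops.\<close>

definition config_sigma :: "real \<Rightarrow> 'k set \<Rightarrow> ('k \<Rightarrow> real \<Rightarrow> real) measure" where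
  "config_sigma \<beta> \<Lambda> = PiM \<Lambda> (\<lambda>_. loop_sigma \<beta>)"

definition const_loop :: "real \<Rightarrow> real \<Rightarrow> real \<Rightarrow> real" where
  "const_loop \<beta> x = (\<lambda>\<tau>\<in>{0..\<beta>}. x)"

definition mean_configs :: "real \<Rightarrow> ('k \<Rightarrow> real) \<Rightarrow> ('k \<Rightarrow> real \<Rightarrow> real) set" where
  "mean_configs \<beta> y = {\<zeta> \<in> configs \<beta> UNIV. \<forall>j. (1 / \<beta>) * (LBINT \<tau>:{0..\<beta>}. \<zeta> j \<tau>) = y j}"

definition energy ::
  "real \<Rightarrow> ('k \<Rightarrow> 'k \<Rightarrow> real) \<Rightarrow> ('k \<Rightarrow> real \<Rightarrow> real) \<Rightarrow> 'k set
    \<Rightarrow> ('k \<Rightarrow> real \<Rightarrow> real) \<Rightarrow> ('k \<Rightarrow> real \<Rightarrow> real) \<Rightarrow> real" where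
  "energy \<beta> J U \<Lambda> \<omega> \<zeta> =
     (\<Sum>j\<in>\<Lambda>. LBINT \<tau>:{0..\<beta>}. U j (\<omega> j \<tau>))
     + (1 / 2) * (\<Sum>j\<in>\<Lambda>. \<Sum>k\<in>\<Lambda>. J j k * (LBINT \<tau>:{0..\<beta>}. \<omega> j \<tau> * \<omega> k \<tau>))
     + (\<Sum>j\<in>\<Lambda>. \<Sum>\<^sub>\<infinity>k\<in>-\<Lambda>. J j k * (LBINT \<tau>:{0..\<beta>}. \<omega> j \<tau> * \<zeta> k \<tau>))"

definition L2_inner :: "real \<Rightarrow> (real \<Rightarrow> real) \<Rightarrow> (real \<Rightarrow> real) \<Rightarrow> real" where
  "L2_inner \<beta> f g = (LBINT \<tau>:{0..\<beta>}. f \<tau> * g \<tau>)"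

definition L2_functions :: "real \<Rightarrow> (real \<Rightarrow> real) set" where
  "L2_functions \<beta> =
     {f \<in> borel_measurable borel. set_integrable lborel {0..\<beta>} (\<lambda>\<tau>. (f \<tau>)\<^sup>2)}"

text \<open>The frequency \<open>q \<in> (2\<pi>/\<beta>) \<int>\<close> is written \<open>q = 2\<pi>n/\<beta>\<close> with an integer index \<open>n\<close>.\<close>

definition freq :: "real \<Rightarrow> int \<Rightarrow> real" where
  "freq \<beta> n = 2 * pi * of_int n / \<beta>"

definition fourier_basis :: "real \<Rightarrow> int \<Rightarrow> real \<Rightarrow> real" where
  "fourier_basis \<beta> n \<tau> =
     (if n = 0 then 1 / sqrt \<beta>
      else if n > 0 then sqrt (2 / \<beta>) * cos (freq \<beta> n * \<tau>)
      else sqrt (2 / \<beta>) * sin (freq \<beta> n * \<tau>))"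

text \<open>
  \<open>(-m\<Delta> + 1)\<^sup>-\<^sup>1\<close> with periodic boundary conditions, through its spectral decomposition.
  For \<open>m > 0\<close> and square-integrable \<open>\<phi>\<close> the series converges absolutely for every \<open>\<tau>\<close>.
\<close>

definition cov_operator :: "real \<Rightarrow> real \<Rightarrow> (real \<Rightarrow> real) \<Rightarrow> real \<Rightarrow> real" where
  "cov_operator \<beta> m \<phi> \<tau> =
     (\<Sum>\<^sub>\<infinity>n::int. 1 / (m * (freq \<beta> n)\<^sup>2 + 1) * L2_inner \<beta> \<phi> (fourier_basis \<beta> n)
                     * fourier_basis \<beta> n \<tau>)"

text \<open>
  The centered Gaussian measure on \<open>L\<^sup>2([0,\<beta>])\<close> with the above covariance operator, regarded as a
  measure on the loops, on which it is concentrated: it is characterized by its characteristic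
  functional \<open>\<phi> \<mapsto> exp (- \<langle>\<phi>, S\<phi>\<rangle> / 2)\<close> on \<open>L\<^sup>2([0,\<beta>])\<close>.
\<close>

definition quantum_reference :: "real \<Rightarrow> real \<Rightarrow> (real \<Rightarrow> real) measure \<Rightarrow> bool" where
  "quantum_reference \<beta> m \<gamma> \<longleftrightarrow>
     prob_space \<gamma> \<and> sets \<gamma> = sets (loop_sigma \<beta>) \<and>
     (\<forall>\<phi>\<in>L2_functions \<beta>.
        (CLINT \<omega>|\<gamma>. iexp (L2_inner \<beta> \<phi> \<omega>))
          = complex_of_real (exp (- L2_inner \<beta> \<phi> (cov_operator \<beta> m \<phi>) / 2)))"

definition qc_density_measure :: "real \<Rightarrow> 'k set \<Rightarrow> ('k \<Rightarrow> real) measure" where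
  "qc_density_measure \<beta> \<Lambda> =
     PiM \<Lambda> (\<lambda>_. density lborel (\<lambda>x. ennreal (sqrt (\<beta> / (2 * pi)) * exp (- \<beta> * x\<^sup>2 / 2))))"

definition qc_reference :: "real \<Rightarrow> 'k set \<Rightarrow> ('k \<Rightarrow> real \<Rightarrow> real) measure" where
  "qc_reference \<beta> \<Lambda> =
     distr (qc_density_measure \<beta> \<Lambda>) (config_sigma \<beta> \<Lambda>) (\<lambda>x. \<lambda>j\<in>\<Lambda>. const_loop \<beta> (x j))"

definition gibbs ::
  "('k \<Rightarrow> real \<Rightarrow> real) measure \<Rightarrow> real \<Rightarrow> ('k \<Rightarrow> 'k \<Rightarrow> real) \<Rightarrow> ('k \<Rightarrow> real \<Rightarrow> real)
    \<Rightarrow> 'k set \<Rightarrow> ('k \<Rightarrow> real \<Rightarrow> real) \<Rightarrow> ('k \<Rightarrow> real \<Rightarrow> real) measure" where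
  "gibbs \<rho> \<beta> J U \<Lambda> \<zeta> =
     (let Z = (LINT \<omega>|\<rho>. exp (- energy \<beta> J U \<Lambda> \<omega> \<zeta>))
      in density \<rho> (\<lambda>\<omega>. ennreal (1 / Z * exp (- energy \<beta> J U \<Lambda> \<omega> \<zeta>))))"

definition quantum_gibbs where
  "quantum_gibbs \<gamma> \<beta> J U \<Lambda> \<zeta> = gibbs (PiM \<Lambda> (\<lambda>_. \<gamma>)) \<beta> J U \<Lambda> \<zeta>"

definition qc_gibbs where
  "qc_gibbs \<beta> J U \<Lambda> \<zeta> = gibbs (qc_reference \<beta> \<Lambda>) \<beta> J U \<Lambda> \<zeta>"

definition converges_weakly ::
  "'a topology \<Rightarrow> ('i \<Rightarrow> 'a measure) \<Rightarrow> 'a measure \<Rightarrow> 'i filter \<Rightarrow> bool" where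
  "converges_weakly T \<mu> \<nu> F \<longleftrightarrow>
     (\<forall>G :: 'a \<Rightarrow> real. continuous_map T euclideanreal G \<and> bounded (G ` topspace T)
        \<longrightarrow> ((\<lambda>i. LINT \<omega>|\<mu> i. G \<omega>) \<longlongrightarrow> (LINT \<omega>|\<nu>. G \<omega>)) F)"

end

theory Submission
  imports Defs
begin

text \<open>
  Let \<open>P \<omega>\<close> be the constant loop at the mean of \<open>\<omega>\<close>.  The mean is the zero Fourier mode, on which
  the covariance operator is the identity for every \<open>m\<close>; hence under \<open>\<gamma>\<^sub>m\<close> the law of \<open>P\<close> is the
  quasiclassical reference measure, independently of \<open>m\<close>, and
  \<open>\<integral> F d\<gamma>\<^sub>m - \<integral> F d\<gamma>\<^sup>q\<^sup>c\<close> is the \<open>\<gamma>\<^sub>m\<close>-mean of \<open>F \<omega> - F (P \<omega>)\<close>.  So no tightness argument is needed.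
  Two estimates suffice.  Gaussian increments have variance of order \<open>1/m\<close>, so by dyadic chaining
  \<open>\<omega> - P \<omega>\<close> tends to \<open>0\<close> uniformly, in probability.  And, since the largest eigenvalue of
  the covariance is \<open>1\<close>, the moments \<open>E exp (\<alpha> \<parallel>\<omega>\<parallel>\<^sup>2 / 2)\<close> are bounded uniformly in \<open>m \<ge> m\<^sub>0\<close>
  for each \<open>\<alpha> < 1\<close>, which gives uniform integrability of the Boltzmann factor because \<open>c - c' < 1\<close>.
\<close>

section \<open>The topology and the Borel sets of the loop spaces\<close>

text \<open>The characteristic functional is given on square-integrable test functions, and only
  one-dimensional laws of pairings are extracted from it. What lies beyond their direct reach shapes
  the proof. Evaluation at a time is not such a pairing: it is a limit of averages over shrinking
  windows, and moment bounds pass to the limit by Fatou. Auxiliary Gaussian variables stand in for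
  the joint law of several Fourier modes, and a convexity inequality for the independence of low and
  high modes. As F is merely continuous, closeness of \<omega> to P \<omega> does not at once make F
  \<omega> close to F (P \<omega>). The points near which F jumps are measured under the law of P
  \<omega>; this law being fixed, a single choice of scale serves every large mass. The integrands
  are continuous for the product topology, whereas the measures live on a product of Borel
  sigma-algebras; separability of the loop space reconciles the two. The limit is proved for every
  continuous F dominated by a suitable exponential, and is used for the Boltzmann factor and for its
  product with G; a Gibbs expectation is the ratio of the two integrals.\<close>

locale loop_space =
  fixes \<beta> :: real
  assumes \<beta>_pos: "\<beta> > 0"
begin

lemma mspace_loop_metric: "mspace (loop_metric \<beta>) = loops \<beta>"
  by (simp add: loops_def loop_topology_def)

lemma loop_continuous: "\<omega> \<in> loops \<beta> \<Longrightarrow> continuous_on {0..\<beta>} \<omega>"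
  by (simp add: loops_eq)

lemma loop_mdist_le:
  assumes "f \<in> loops \<beta>" "g \<in> loops \<beta>"
  shows "mdist (loop_metric \<beta>) f g \<le> a \<longleftrightarrow> (\<forall>t\<in>{0..\<beta>}. \<bar>f t - g t\<bar> \<le> a)"
proof -
  have "f \<in> mspace (cfunspace (top_of_set {0..\<beta>}) euclidean_metric)"
    "g \<in> mspace (cfunspace (top_of_set {0..\<beta>}) euclidean_metric)"
    using assms by (simp_all add: mspace_loop_metric[symmetric] loop_metric_def)
  then show ?thesis
    using \<beta>_pos cfunspace_mdist_le[of f "top_of_set {0..\<beta>}" euclidean_metric g a]
    by (auto simp: loop_metric_def dist_real_def)
qed

lemma const_loop_in_loops [simp]: "const_loop \<beta> x \<in> loops \<beta>"
proof -
  have "continuous_on {0..\<beta>} (const_loop \<beta> x)"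
    by (rule continuous_on_eq[OF continuous_on_const[of _ x]]) (simp add: const_loop_def)
  then show ?thesis
    using \<beta>_pos by (auto simp: loops_eq const_loop_def)
qed

lemma const_loop_apply [simp]: "t \<in> {0..\<beta>} \<Longrightarrow> const_loop \<beta> x t = x"
  by (simp add: const_loop_def)

lemma openin_loop_topology:
  "openin (loop_topology \<beta>) A \<longleftrightarrow>
    A \<subseteq> loops \<beta> \<and> (\<forall>\<omega>\<in>A. \<exists>r>0. \<forall>\<omega>'\<in>loops \<beta>. mdist (loop_metric \<beta>) \<omega> \<omega>' < r \<longrightarrow> \<omega>' \<in> A)"
proof -
  interpret Metric_space "mspace (loop_metric \<beta>)" "mdist (loop_metric \<beta>)"
    by (rule Metric_space_mspace_mdist)
  show ?thesis
    unfolding loop_topology_def mtopology_of_def openin_mtopology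
    by (simp add: mspace_loop_metric subset_iff Ball_def)
      (metis in_mball mspace_loop_metric)
qed

lemma openin_config_topology_ball:
  assumes "finite \<Lambda>" "openin (config_topology \<beta> \<Lambda>) W" "\<omega> \<in> W"
  shows "\<exists>r>0. \<forall>\<omega>'\<in>configs \<beta> \<Lambda>. (\<forall>j\<in>\<Lambda>. mdist (loop_metric \<beta>) (\<omega> j) (\<omega>' j) < r) \<longrightarrow> \<omega>' \<in> W"
proof -
  obtain V where V: "\<forall>i\<in>\<Lambda>. openin (loop_topology \<beta>) (V i)" "\<omega> \<in> PiE \<Lambda> V" "PiE \<Lambda> V \<subseteq> W"
    using assms unfolding config_topology_def openin_product_topology_alt by meson
  then have "\<forall>j\<in>\<Lambda>. \<exists>r>0. \<forall>\<omega>'\<in>loops \<beta>. mdist (loop_metric \<beta>) (\<omega> j) \<omega>' < r \<longrightarrow> \<omega>' \<in> V j"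
    unfolding openin_loop_topology by (meson PiE_mem)
  then obtain r where r: "\<And>j. j \<in> \<Lambda> \<Longrightarrow> r j > 0"
      "\<And>j \<omega>'. j \<in> \<Lambda> \<Longrightarrow> \<omega>' \<in> loops \<beta> \<Longrightarrow> mdist (loop_metric \<beta>) (\<omega> j) \<omega>' < r j \<Longrightarrow> \<omega>' \<in> V j"
    by metis
  \<comment> \<open>The element 1 keeps the minimum over a non-empty set when
    \<open>\<Lambda>\<close> is empty.\<close>
  define R where "R = Min (insert 1 (r ` \<Lambda>))"
  have "R > 0" and R: "\<And>j. j \<in> \<Lambda> \<Longrightarrow> R \<le> r j"
    using assms(1) r(1) by (auto simp: R_def)
  have "\<omega>' \<in> W" if \<omega>': "\<omega>' \<in> configs \<beta> \<Lambda>" "\<forall>j\<in>\<Lambda>. mdist (loop_metric \<beta>) (\<omega> j) (\<omega>' j) < R" for \<omega>'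
  proof -
    have "\<omega>' j \<in> V j" if "j \<in> \<Lambda>" for j
      using that \<omega>' R[OF that]
      by (intro r(2)) (auto simp: configs_def intro: less_le_trans)
    then have "\<omega>' \<in> PiE \<Lambda> V"
      using \<omega>' by (auto simp: configs_def PiE_iff)
    then show ?thesis
      using V(3) by blast
  qed
  with \<open>R > 0\<close> show ?thesis
    by blast
qed

lemma openin_config_ball:
  assumes "finite \<Lambda>" "\<omega> \<in> configs \<beta> \<Lambda>"
  shows "openin (config_topology \<beta> \<Lambda>)
    {\<omega>' \<in> configs \<beta> \<Lambda>. \<forall>j\<in>\<Lambda>. mdist (loop_metric \<beta>) (\<omega> j) (\<omega>' j) < r}"
proof -
  have "{\<omega>' \<in> configs \<beta> \<Lambda>. \<forall>j\<in>\<Lambda>. mdist (loop_metric \<beta>) (\<omega> j) (\<omega>' j) < r} =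
     PiE \<Lambda> (\<lambda>j. Metric_space.mball (loops \<beta>) (mdist (loop_metric \<beta>)) (\<omega> j) r)"
    using assms(2) mspace_loop_metric
    by (auto simp: configs_def PiE_iff extensional_def Metric_space.mball_def[OF Metric_space_mspace_mdist, of "loop_metric \<beta>", unfolded mspace_loop_metric])
  also have "openin (config_topology \<beta> \<Lambda>) \<dots>"
    unfolding config_topology_def openin_PiE[OF assms(1)] loop_topology_def mtopology_of_def mspace_loop_metric
    using Metric_space.openin_mball[OF Metric_space_mspace_mdist, of "loop_metric \<beta>"] mspace_loop_metric by auto
  finally show ?thesis .
qed

lemma topspace_config_topology: "topspace (config_topology \<beta> \<Lambda>) = configs \<beta> \<Lambda>"
  by (simp add: config_topology_def configs_def loops_def)

lemma loop_mdist_lt_imp: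
  assumes "f \<in> loops \<beta>" "g \<in> loops \<beta>" "mdist (loop_metric \<beta>) f g < a" "t \<in> {0..\<beta>}"
  shows "\<bar>f t - g t\<bar> \<le> a"
  using loop_mdist_le[OF assms(1,2), of a] assms(3,4) by auto

lemma config_mem: "\<omega> \<in> configs \<beta> \<Lambda> \<Longrightarrow> j \<in> \<Lambda> \<Longrightarrow> \<omega> j \<in> loops \<beta>"
  by (auto simp: configs_def)

text \<open>Balls of radius \<open>inverse (real (Suc n))\<close> form a countable neighbourhood
  base, so sequences detect continuity, and sequences converging at this uniform rate suffice. In
  this form continuity of the energy becomes a matter of dominated convergence in time.\<close>

lemma continuous_map_configI:
  fixes f :: "('k \<Rightarrow> real \<Rightarrow> real) \<Rightarrow> real"
  assumes fin: "finite \<Lambda>"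
    and seq: "\<And>X \<omega>. \<lbrakk>\<And>n. X n \<in> configs \<beta> \<Lambda>; \<omega> \<in> configs \<beta> \<Lambda>;
        \<And>n j t. j \<in> \<Lambda> \<Longrightarrow> t \<in> {0..\<beta>} \<Longrightarrow> \<bar>X n j t - \<omega> j t\<bar> \<le> inverse (real (Suc n))\<rbrakk>
        \<Longrightarrow> (\<lambda>n. f (X n)) \<longlonglongrightarrow> f \<omega>"
  shows "continuous_map (config_topology \<beta> \<Lambda>) euclideanreal f"
  unfolding continuous_map_def topspace_config_topology
proof (intro conjI allI impI)
  fix V :: "real set" assume "openin euclideanreal V"
  then have V: "open V" by simp
  let ?S = "{x \<in> configs \<beta> \<Lambda>. f x \<in> V}"
  show "openin (config_topology \<beta> \<Lambda>) ?S"
    unfolding openin_subopen[of _ ?S]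
  proof
    fix \<omega> assume \<omega>: "\<omega> \<in> ?S"
    let ?B = "\<lambda>r. {\<omega>' \<in> configs \<beta> \<Lambda>. \<forall>j\<in>\<Lambda>. mdist (loop_metric \<beta>) (\<omega> j) (\<omega>' j) < r}"
    have "\<exists>n. ?B (inverse (real (Suc n))) \<subseteq> ?S"
    proof (rule ccontr)
      assume "\<nexists>n. ?B (inverse (real (Suc n))) \<subseteq> ?S"
      then have "\<forall>n. \<exists>x. x \<in> ?B (inverse (real (Suc n))) \<and> f x \<notin> V"
        by blast
      then obtain X where "\<forall>n. X n \<in> ?B (inverse (real (Suc n))) \<and> f (X n) \<notin> V"
        by (rule choice[THEN exE])
      then have X: "\<And>n. X n \<in> ?B (inverse (real (Suc n)))" "\<And>n. f (X n) \<notin> V"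
        by blast+
      have "\<bar>X n j t - \<omega> j t\<bar> \<le> inverse (real (Suc n))" if "j \<in> \<Lambda>" "t \<in> {0..\<beta>}" for n j t
      proof -
        have "mdist (loop_metric \<beta>) (\<omega> j) (X n j) < inverse (real (Suc n))" "X n j \<in> loops \<beta>" "\<omega> j \<in> loops \<beta>"
          using X(1)[of n] that \<omega> by (auto intro: config_mem)
        from loop_mdist_lt_imp[OF this(3,2,1) that(2)] show ?thesis
          by (simp add: abs_minus_commute)
      qed
      then have "(\<lambda>n. f (X n)) \<longlonglongrightarrow> f \<omega>"
        using X(1) \<omega> by (intro seq) auto
      then have "eventually (\<lambda>n. f (X n) \<in> V) sequentially"
        using V \<omega> topological_tendstoD by blast
      with X(2) show False by simp
    qed
    then obtain n where "?B (inverse (real (Suc n))) \<subseteq> ?S" ..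
    moreover have "\<omega> \<in> ?B (inverse (real (Suc n)))"
    proof -
      have "mdist (loop_metric \<beta>) (\<omega> j) (\<omega> j) = 0" if "j \<in> \<Lambda>" for j
        using \<omega> that config_mem[of \<omega> \<Lambda> j] by (simp add: mspace_loop_metric)
      then show ?thesis
        using \<omega> by simp
    qed
    ultimately show "\<exists>T. openin (config_topology \<beta> \<Lambda>) T \<and> \<omega> \<in> T \<and> T \<subseteq> ?S"
      using openin_config_ball[OF fin] \<omega> by blast
  qed
qed auto

text \<open>A loop is a configuration over a one-point index set.\<close>

lemma continuous_map_loopI:
  fixes f :: "(real \<Rightarrow> real) \<Rightarrow> real"
  assumes seq: "\<And>X \<omega>. \<lbrakk>\<And>n. X n \<in> loops \<beta>; \<omega> \<in> loops \<beta>;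
        \<And>n t. t \<in> {0..\<beta>} \<Longrightarrow> \<bar>X n t - \<omega> t\<bar> \<le> inverse (real (Suc n))\<rbrakk>
        \<Longrightarrow> (\<lambda>n. f (X n)) \<longlonglongrightarrow> f \<omega>"
  shows "continuous_map (loop_topology \<beta>) euclideanreal f"
proof -
  have "continuous_map (config_topology \<beta> {()}) euclideanreal (\<lambda>\<omega>. f (\<omega> ()))"
    by (intro continuous_map_configI seq) (auto intro: config_mem)
  moreover have "continuous_map (loop_topology \<beta>) (config_topology \<beta> {()}) (\<lambda>\<omega>. \<lambda>j\<in>{()}. \<omega>)"
    by (auto simp: config_topology_def continuous_map_componentwise)
  ultimately have "continuous_map (loop_topology \<beta>) euclideanreal ((\<lambda>\<omega>. f (\<omega> ())) \<circ> (\<lambda>\<omega>. \<lambda>j\<in>{()}. \<omega>))"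
    using continuous_map_compose by blast
  then show ?thesis
    by (simp add: o_def)
qed

section \<open>Borel measurability and separability of the loop spaces\<close>

lemma space_loop_sigma: "space (loop_sigma \<beta>) = loops \<beta>"
  unfolding loop_sigma_def by (rule space_measure_of) (auto simp: loops_def dest: openin_subset)

lemma sets_loop_sigma: "sets (loop_sigma \<beta>) = sigma_sets (loops \<beta>) {A. openin (loop_topology \<beta>) A}"
  unfolding loop_sigma_def by (rule sets_measure_of) (auto simp: loops_def dest: openin_subset)

lemma space_config_sigma: "space (config_sigma \<beta> \<Lambda>) = configs \<beta> \<Lambda>"
  by (simp add: config_sigma_def configs_def space_PiM space_loop_sigma)

lemma openin_in_loop_sigma: "openin (loop_topology \<beta>) A \<Longrightarrow> A \<in> sets (loop_sigma \<beta>)"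
  by (auto simp: sets_loop_sigma)

lemma closedin_in_loop_sigma: "closedin (loop_topology \<beta>) A \<Longrightarrow> A \<in> sets (loop_sigma \<beta>)"
  using sets.compl_sets[OF openin_in_loop_sigma, of "loops \<beta> - A"]
  by (auto simp: closedin_def space_loop_sigma loops_def double_diff)

lemma borel_measurable_loop:
  assumes "continuous_map (loop_topology \<beta>) euclideanreal f"
  shows "f \<in> borel_measurable (loop_sigma \<beta>)"
proof (rule borel_measurableI)
  fix S :: "real set" assume "open S"
  then have "openin (loop_topology \<beta>) {x \<in> topspace (loop_topology \<beta>). f x \<in> S}"
    using assms by (simp add: continuous_map_def)
  then show "f -` S \<inter> space (loop_sigma \<beta>) \<in> sets (loop_sigma \<beta>)"
    by (intro openin_in_loop_sigma) (simp add: space_loop_sigma loops_def vimage_def Int_def conj_commute)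
qed

lemma tendsto_of_inverse_Suc:
  fixes X :: "nat \<Rightarrow> real"
  assumes "\<And>n. \<bar>X n - x\<bar> \<le> inverse (real (Suc n))"
  shows "X \<longlonglongrightarrow> x"
proof -
  have "(\<lambda>n. X n - x) \<longlonglongrightarrow> 0"
    by (rule Lim_null_comparison[OF _ LIMSEQ_inverse_real_of_nat]) (use assms in auto)
  then show ?thesis
    by (simp add: LIM_zero_iff)
qed

lemma continuous_map_eval: "t \<in> {0..\<beta>} \<Longrightarrow> continuous_map (loop_topology \<beta>) euclideanreal (\<lambda>\<omega>. \<omega> t)"
  by (intro continuous_map_loopI tendsto_of_inverse_Suc) auto

lemma eval_measurable: "t \<in> {0..\<beta>} \<Longrightarrow> (\<lambda>\<omega>. \<omega> t) \<in> borel_measurable (loop_sigma \<beta>)"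
  by (intro borel_measurable_loop continuous_map_eval)

text \<open>Step functions with rational values on a grid of mesh \<open>1 / fst c\<close>. Their
  codes form a countable type, so the balls around them are a countable family; as mere centres of
  balls they may be discontinuous.\<close>

definition rat_step :: "nat \<times> rat list \<Rightarrow> real \<Rightarrow> real" where
  "rat_step c t = real_of_rat (snd c ! nat \<lfloor>real (fst c) * t\<rfloor>)"

definition step_ball :: "nat \<times> rat list \<Rightarrow> real \<Rightarrow> (real \<Rightarrow> real) set" where
  "step_ball c r = {\<omega> \<in> loops \<beta>. \<forall>t\<in>{0..\<beta>}. \<bar>\<omega> t - rat_step c t\<bar> \<le> r}"

text \<open>The condition ranges over uncountably many times, so the route is topological: each time
  gives a closed set, and closed sets survive arbitrary intersections.\<close>

lemma step_ball_measurable: "step_ball c r \<in> sets (loop_sigma \<beta>)"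
proof (rule closedin_in_loop_sigma)
  have "step_ball c r = (\<Inter>t\<in>{0..\<beta>}. {\<omega> \<in> topspace (loop_topology \<beta>). \<omega> t \<in> cball (rat_step c t) r})"
    using \<beta>_pos unfolding step_ball_def loops_def by (fastforce simp: dist_real_def abs_minus_commute)
  moreover have "closedin (loop_topology \<beta>) \<dots>"
    using \<beta>_pos
    by (intro closedin_INT closedin_continuous_map_preimage[OF continuous_map_eval]) auto
  ultimately show "closedin (loop_topology \<beta>) (step_ball c r)"
    by simp
qed

text \<open>Uniform continuity supplies a mesh on which the loop varies by less than
  \<open>r / 2\<close>; density of the rationals supplies grid values within the other
  \<open>r / 2\<close>.\<close>

lemma ex_step_ball:
  assumes \<omega>: "\<omega> \<in> loops \<beta>" and r: "r > 0"
  shows "\<exists>c. \<omega> \<in> step_ball c r"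
proof -
  have "uniformly_continuous_on {0..\<beta>} \<omega>"
    using \<omega> by (intro compact_uniformly_continuous loop_continuous) auto
  then obtain d where d: "d > 0" "\<And>s t. s \<in> {0..\<beta>} \<Longrightarrow> t \<in> {0..\<beta>} \<Longrightarrow> \<bar>s - t\<bar> < d \<Longrightarrow> \<bar>\<omega> s - \<omega> t\<bar> < r / 2"
    unfolding uniformly_continuous_on_def dist_real_def using r by (metis half_gt_zero)
  obtain n :: nat where n: "n > 0" "inverse (real n) < d"
    using d(1) ex_inverse_of_nat_less by blast
  have "\<forall>i. \<exists>q::rat. \<bar>\<omega> (real i / real n) - real_of_rat q\<bar> < r / 2"
  proof
    fix i
    obtain q :: rat where "\<omega> (real i / real n) - r/2 < real_of_rat q" "real_of_rat q < \<omega> (real i / real n) + r/2"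
      using of_rat_dense[of "\<omega> (real i / real n) - r/2" "\<omega> (real i / real n) + r/2"] r by auto
    then show "\<exists>q::rat. \<bar>\<omega> (real i / real n) - real_of_rat q\<bar> < r / 2"
      by (intro exI[of _ q]) linarith
  qed
  then obtain q where q: "\<And>i. \<bar>\<omega> (real i / real n) - real_of_rat (q i)\<bar> < r / 2"
    by metis
  \<comment> \<open>The index \<open>nat \<lfloor>real n * \<beta>\<rfloor>\<close> is attained at t
    = \<beta>, hence the successor in the length of the list.\<close>
  define l where "l = map q [0..<Suc (nat \<lfloor>real n * \<beta>\<rfloor>)]"
  have "\<bar>\<omega> t - rat_step (n, l) t\<bar> \<le> r" if t: "t \<in> {0..\<beta>}" for t
  proof -
    let ?i = "nat \<lfloor>real n * t\<rfloor>"
    have "?i < Suc (nat \<lfloor>real n * \<beta>\<rfloor>)"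
      using t n by (auto intro!: nat_mono floor_mono simp: less_Suc_eq_le)
    then have s: "rat_step (n, l) t = real_of_rat (q ?i)"
      by (auto simp: rat_step_def l_def simp del: upt_Suc)
    have fl: "real ?i \<le> real n * t" "real n * t < real ?i + 1"
      using t n by (auto simp: of_nat_nat)
    have *: "i / a \<le> s \<and> s - i / a < inverse a" if "i \<le> a * s" "a * s < i + 1" "a > 0" for i a s :: real
    proof -
      have "i / a \<le> s" "s < (i + 1) / a"
        using that by (simp_all add: field_simps)
      then show ?thesis
        by (simp add: add_divide_distrib inverse_eq_divide)
    qed
    have "real ?i / real n \<le> t" "t - real ?i / real n < inverse (real n)"
      using *[OF fl] n(1) by auto
    then have "\<bar>\<omega> t - \<omega> (real ?i / real n)\<bar> < r / 2"
      using t n d(2)[of t "real ?i / real n"] by (auto simp del: of_nat_nat)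
    with q[of ?i] s show ?thesis
      by linarith
  qed
  then show ?thesis
    using \<omega> by (intro exI[of _ "(n, l)"]) (auto simp: step_ball_def)
qed

text \<open>This is where separability enters: an open set of the product topology is a countable
  union of boxes with measurable sides. Continuous functions of a configuration thereby become
  measurable.\<close>

lemma openin_in_config_sigma:
  assumes fin: "finite \<Lambda>" and W: "openin (config_topology \<beta> \<Lambda>) W"
  shows "W \<in> sets (config_sigma \<beta> \<Lambda>)"
proof -
  let ?box = "\<lambda>(n, c). PiE \<Lambda> (\<lambda>j. step_ball (c j) (inverse (real (Suc n))))"
  define S where "S = {p \<in> (UNIV :: nat set) \<times> PiE \<Lambda> (\<lambda>_. UNIV). ?box p \<subseteq> W}"
  have "W \<subseteq> (\<Union>p\<in>S. ?box p)"
  proof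
    fix \<omega> assume \<omega>: "\<omega> \<in> W"
    then have \<omega>c: "\<omega> \<in> configs \<beta> \<Lambda>"
      using openin_subset[OF W] by (auto simp: topspace_config_topology)
    obtain r where r: "r > 0" "\<And>\<omega>'. \<omega>' \<in> configs \<beta> \<Lambda> \<Longrightarrow>
        (\<And>j. j \<in> \<Lambda> \<Longrightarrow> mdist (loop_metric \<beta>) (\<omega> j) (\<omega>' j) < r) \<Longrightarrow> \<omega>' \<in> W"
      using openin_config_topology_ball[OF fin W \<omega>] by blast
    \<comment> \<open>Half of \<open>r\<close>, because two loops in the same step ball may be twice
      its radius apart.\<close>
    obtain n where n: "inverse (real (Suc n)) < r / 2"
      using r(1) reals_Archimedean[of "r/2"] by auto
    have "\<exists>c. \<omega> j \<in> step_ball c (inverse (real (Suc n)))" if "j \<in> \<Lambda>" for j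
      using \<omega>c that by (intro ex_step_ball config_mem) auto
    then obtain c where c: "\<And>j. j \<in> \<Lambda> \<Longrightarrow> \<omega> j \<in> step_ball (c j) (inverse (real (Suc n)))"
      by metis
    \<comment> \<open>Restricting the codes to \<open>\<Lambda>\<close> puts the index into a
      \<open>PiE\<close> that is countable because \<open>\<Lambda>\<close> is finite.\<close>
    have "?box (n, restrict c \<Lambda>) \<subseteq> W"
    proof
      fix \<omega>' assume "\<omega>' \<in> ?box (n, restrict c \<Lambda>)"
      then have b: "\<And>j. j \<in> \<Lambda> \<Longrightarrow> \<omega>' j \<in> step_ball (c j) (inverse (real (Suc n)))"
        and e: "\<omega>' \<in> extensional \<Lambda>"
        by (auto simp: PiE_iff)
      have cc: "\<omega>' \<in> configs \<beta> \<Lambda>"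
        using b e by (auto simp: configs_def PiE_iff step_ball_def)
      have "mdist (loop_metric \<beta>) (\<omega> j) (\<omega>' j) < r" if "j \<in> \<Lambda>" for j
      proof -
        have "mdist (loop_metric \<beta>) (\<omega> j) (\<omega>' j) \<le> 2 * inverse (real (Suc n))"
          unfolding loop_mdist_le[OF config_mem[OF \<omega>c that] config_mem[OF cc that]]
        proof
          fix t assume "t \<in> {0..\<beta>}"
          then have "\<bar>\<omega> j t - rat_step (c j) t\<bar> \<le> inverse (real (Suc n))"
            "\<bar>\<omega>' j t - rat_step (c j) t\<bar> \<le> inverse (real (Suc n))"
            using b[OF that] c[OF that] by (auto simp: step_ball_def)
          then show "\<bar>\<omega> j t - \<omega>' j t\<bar> \<le> 2 * inverse (real (Suc n))"
            by linarith
        qed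
        with n show ?thesis by linarith
      qed
      then show "\<omega>' \<in> W"
        using r(2) cc by blast
    qed
    moreover have "\<omega> \<in> ?box (n, restrict c \<Lambda>)"
      using c \<omega>c by (auto simp: configs_def PiE_iff)
    ultimately show "\<omega> \<in> (\<Union>p\<in>S. ?box p)"
      unfolding S_def by (intro UN_I[of "(n, restrict c \<Lambda>)"]) auto
  qed
  then have "W = (\<Union>p\<in>S. ?box p)"
    by (auto simp: S_def)
  moreover have "countable S"
    unfolding S_def
    by (rule countable_subset[of _ "(UNIV :: nat set) \<times> PiE \<Lambda> (\<lambda>_. UNIV)"])
       (auto intro!: countable_SIGMA countable_PiE fin)
  moreover have "?box p \<in> sets (config_sigma \<beta> \<Lambda>)" for p
    unfolding config_sigma_def
    by (cases p) (auto intro!: sets_PiM_I_finite fin step_ball_measurable)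
  ultimately show ?thesis
    using sets.countable_UN'[of S ?box] by blast
qed

lemma borel_measurable_config:
  assumes "finite \<Lambda>" "continuous_map (config_topology \<beta> \<Lambda>) euclideanreal f"
  shows "f \<in> borel_measurable (config_sigma \<beta> \<Lambda>)"
proof (rule borel_measurableI)
  fix S :: "real set" assume "open S"
  then have "openin (config_topology \<beta> \<Lambda>) {x \<in> topspace (config_topology \<beta> \<Lambda>). f x \<in> S}"
    using assms by (simp add: continuous_map_def)
  then show "f -` S \<inter> space (config_sigma \<beta> \<Lambda>) \<in> sets (config_sigma \<beta> \<Lambda>)"
    using openin_in_config_sigma[OF assms(1)]
    by (simp add: space_config_sigma topspace_config_topology vimage_def Int_def conj_commute)
qed

lemma const_loop_measurable: "const_loop \<beta> \<in> borel \<rightarrow>\<^sub>M loop_sigma \<beta>"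
  unfolding loop_sigma_def
proof (rule measurable_measure_of)
  fix A assume "A \<in> {A. openin (loop_topology \<beta>) A}"
  then have A: "openin (loop_topology \<beta>) A" by simp
  have "open (const_loop \<beta> -` A)"
    unfolding open_dist
  proof (intro ballI)
    fix x assume "x \<in> const_loop \<beta> -` A"
    then obtain r where r: "r > 0" "\<And>\<omega>'. \<omega>' \<in> loops \<beta> \<Longrightarrow> mdist (loop_metric \<beta>) (const_loop \<beta> x) \<omega>' < r \<Longrightarrow> \<omega>' \<in> A"
      using A unfolding openin_loop_topology by auto
    have "mdist (loop_metric \<beta>) (const_loop \<beta> x) (const_loop \<beta> y) \<le> \<bar>y - x\<bar>" for y
      by (subst loop_mdist_le) (auto simp: abs_minus_commute)
    then show "\<exists>e>0. \<forall>y. dist y x < e \<longrightarrow> y \<in> const_loop \<beta> -` A"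
      using r unfolding dist_real_def
      by (metis const_loop_in_loops le_less_trans vimageI2)
  qed
  then show "const_loop \<beta> -` A \<inter> space borel \<in> sets borel"
    by simp
qed (use const_loop_in_loops in \<open>auto simp: loops_def dest: openin_subset\<close>)

end

section \<open>The covariance form on bounded test functions\<close>

text \<open>The integers are two copies of the naturals, and the term at 0 vanishes since
  \<open>0 powr x\<close> is 0. Exponent 2 gives summable eigenvalues, exponent 3/2 the sum in the
  increment estimate.\<close>

lemma summable_on_int_powr:
  fixes s :: real
  assumes "s > 1"
  shows "(\<lambda>n::int. \<bar>real_of_int n\<bar> powr - s) summable_on UNIV"
proof -
  let ?f = "\<lambda>n::int. \<bar>real_of_int n\<bar> powr - s"
  have nat: "(\<lambda>n::nat. real n powr - s) summable_on UNIV"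
    using assms by (intro norm_summable_imp_summable_on) (simp add: summable_real_powr_iff)
  have "?f summable_on range int"
    by (subst summable_on_reindex) (use nat in \<open>auto simp: o_def\<close>)
  moreover have "?f summable_on range (\<lambda>n. - int n)"
    by (subst summable_on_reindex) (use nat in \<open>auto simp: o_def inj_on_def\<close>)
  ultimately have "?f summable_on (range int \<union> range (\<lambda>n. - int n))"
    by (rule summable_on_union)
  moreover have "n \<in> range int \<union> range (\<lambda>n. - int n)" for n
    by (cases n rule: int_cases2) auto
  then have "range int \<union> range (\<lambda>n. - int n) = UNIV"
    by blast
  ultimately show ?thesis
    by simp
qed

context loop_space
begin

section \<open>Integration over \<open>{0..\<beta>}\<close> and bounded test functions\<close>

lemma set_integrable_bounded:
  fixes f :: "real \<Rightarrow> real"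
  assumes "set_borel_measurable lborel {0..\<beta>} f" "\<And>t. t \<in> {0..\<beta>} \<Longrightarrow> \<bar>f t\<bar> \<le> B"
  shows "set_integrable lborel {0..\<beta>} f"
  by (rule set_integrable_bound[of lborel _ "\<lambda>_. B"])
     (use assms in \<open>auto intro!: borel_integrable_atLeastAtMost' continuous_intros AE_I2 intro: order_trans abs_ge_self\<close>)

lemma set_integral_const: "(LBINT t:{0..\<beta>}. c) = \<beta> * c"
  using \<beta>_pos by (simp add: set_lebesgue_integral_def)

lemma set_integral_bounded:
  fixes f :: "real \<Rightarrow> real"
  assumes "set_borel_measurable lborel {0..\<beta>} f" "\<And>t. t \<in> {0..\<beta>} \<Longrightarrow> \<bar>f t\<bar> \<le> B"
  shows "\<bar>LBINT t:{0..\<beta>}. f t\<bar> \<le> \<beta> * B"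
proof -
  have i: "set_integrable lborel {0..\<beta>} f" "set_integrable lborel {0..\<beta>} (\<lambda>_. B)"
    using set_integrable_bounded[OF assms] by (auto intro!: borel_integrable_atLeastAtMost' continuous_intros)
  have "\<bar>LBINT t:{0..\<beta>}. f t\<bar> \<le> (LBINT t:{0..\<beta>}. \<bar>f t\<bar>)"
    using set_integral_norm_bound[OF i(1)] by simp
  also have "\<dots> \<le> (LBINT t:{0..\<beta>}. B)"
    using i assms(2) set_integrable_abs[OF i(1)] by (intro set_integral_mono) auto
  finally show ?thesis
    by (simp add: set_integral_const)
qed

lemma set_integral_tendsto:
  fixes f :: "nat \<Rightarrow> real \<Rightarrow> real"
  assumes "\<And>n. set_borel_measurable lborel {0..\<beta>} (f n)" "set_borel_measurable lborel {0..\<beta>} g"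
    and "\<And>n t. t \<in> {0..\<beta>} \<Longrightarrow> \<bar>f n t\<bar> \<le> B"
    and "\<And>t. t \<in> {0..\<beta>} \<Longrightarrow> (\<lambda>n. f n t) \<longlonglongrightarrow> g t"
  shows "(\<lambda>n. LBINT t:{0..\<beta>}. f n t) \<longlonglongrightarrow> (LBINT t:{0..\<beta>}. g t)"
  unfolding set_lebesgue_integral_def
proof (rule integral_dominated_convergence[where w="\<lambda>t. indicator {0..\<beta>} t *\<^sub>R B"])
  show "integrable lborel (\<lambda>t. indicator {0..\<beta>} t *\<^sub>R B)"
    using borel_integrable_atLeastAtMost'[of 0 \<beta> "\<lambda>_. B"] by (simp add: set_integrable_def)
qed (use assms in \<open>auto simp: set_borel_measurable_def indicator_def\<close>)

lemma sbm_continuous: "continuous_on {0..\<beta>} f \<Longrightarrow> set_borel_measurable lborel {0..\<beta>} (f :: real \<Rightarrow> real)"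
  using set_measurable_continuous_on[of "{0..\<beta>}" f] by (simp add: set_borel_measurable_def)

lemma sbm_mult:
  fixes f g :: "real \<Rightarrow> real"
  assumes "set_borel_measurable lborel {0..\<beta>} f" "set_borel_measurable lborel {0..\<beta>} g"
  shows "set_borel_measurable lborel {0..\<beta>} (\<lambda>t. f t * g t)"
proof -
  have "(\<lambda>t. (indicator {0..\<beta>} t *\<^sub>R f t) * (indicator {0..\<beta>} t *\<^sub>R g t)) \<in> borel_measurable lborel"
    using assms unfolding set_borel_measurable_def by (rule borel_measurable_times)
  also have "(\<lambda>t. (indicator {0..\<beta>} t *\<^sub>R f t) * (indicator {0..\<beta>} t *\<^sub>R g t)) =
      (\<lambda>t. indicator {0..\<beta>} t *\<^sub>R (f t * g t))"
    by (auto simp: indicator_def)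
  finally show ?thesis
    by (simp add: set_borel_measurable_def)
qed

lemma continuous_bounded:
  assumes "continuous_on {0..\<beta>} (f :: real \<Rightarrow> real)"
  obtains B where "B \<ge> 0" "\<And>t. t \<in> {0..\<beta>} \<Longrightarrow> \<bar>f t\<bar> \<le> B"
proof -
  have "bounded (f ` {0..\<beta>})"
    using assms compact_continuous_image compact_imp_bounded by blast
  then obtain B where "\<forall>x\<in>f ` {0..\<beta>}. norm x \<le> B"
    by (auto simp: bounded_iff)
  then show ?thesis
    by (intro that[of "max B 0"]) (auto simp: le_max_iff_disj)
qed

text \<open>This class is a linear space inside \<open>L2_functions \<beta>\<close>, contains the
  two kinds of functions used later, trigonometric polynomials and indicators of intervals, and
  pairs with loops continuously in the sup norm.\<close>

definition test_functions :: "(real \<Rightarrow> real) set" where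
  "test_functions = {\<phi> \<in> borel_measurable borel. \<exists>B. \<forall>t\<in>{0..\<beta>}. \<bar>\<phi> t\<bar> \<le> B}"

lemma test_functionE:
  assumes "\<phi> \<in> test_functions"
  obtains B where "B \<ge> 0" "\<And>t. t \<in> {0..\<beta>} \<Longrightarrow> \<bar>\<phi> t\<bar> \<le> B"
proof -
  from assms obtain B where "\<forall>t\<in>{0..\<beta>}. \<bar>\<phi> t\<bar> \<le> B"
    by (auto simp: test_functions_def)
  then show ?thesis
    by (intro that[of "max B 0"]) (auto simp: le_max_iff_disj)
qed

lemma sbm_test: "\<phi> \<in> test_functions \<Longrightarrow> set_borel_measurable lborel {0..\<beta>} \<phi>"
  unfolding test_functions_def set_borel_measurable_def by auto

lemma test_continuous: "continuous_on UNIV \<phi> \<Longrightarrow> \<phi> \<in> test_functions"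
proof -
  assume c: "continuous_on UNIV \<phi>"
  obtain B where "\<And>t. t \<in> {0..\<beta>} \<Longrightarrow> \<bar>\<phi> t\<bar> \<le> B"
    by (rule continuous_bounded[OF continuous_on_subset[OF c subset_UNIV]]) blast
  then have "\<exists>B. \<forall>t\<in>{0..\<beta>}. \<bar>\<phi> t\<bar> \<le> B"
    by blast
  with c show ?thesis
    by (simp add: test_functions_def borel_measurable_continuous_onI)
qed

lemma test_cmult: "\<phi> \<in> test_functions \<Longrightarrow> (\<lambda>t. a * \<phi> t) \<in> test_functions"
proof -
  assume a: "\<phi> \<in> test_functions"
  then obtain B where B: "B \<ge> 0" "\<And>t. t \<in> {0..\<beta>} \<Longrightarrow> \<bar>\<phi> t\<bar> \<le> B"
    by (rule test_functionE) blast
  have "\<forall>t\<in>{0..\<beta>}. \<bar>a * \<phi> t\<bar> \<le> \<bar>a\<bar> * B"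
    using B by (auto simp: abs_mult intro!: mult_left_mono)
  with a show ?thesis
    by (auto simp: test_functions_def)
qed

lemma test_add:
  assumes "\<phi> \<in> test_functions" "\<psi> \<in> test_functions"
  shows "(\<lambda>t. \<phi> t + \<psi> t) \<in> test_functions"
proof -
  obtain B where B: "\<And>t. t \<in> {0..\<beta>} \<Longrightarrow> \<bar>\<phi> t\<bar> \<le> B"
    using assms(1) by (rule test_functionE) blast
  obtain C where C: "\<And>t. t \<in> {0..\<beta>} \<Longrightarrow> \<bar>\<psi> t\<bar> \<le> C"
    using assms(2) by (rule test_functionE) blast
  have "\<forall>t\<in>{0..\<beta>}. \<bar>\<phi> t + \<psi> t\<bar> \<le> B + C"
    using B C by (metis abs_triangle_ineq add_mono order_trans)
  then show ?thesis
    using assms by (auto simp: test_functions_def)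
qed

lemma test_diff:
  assumes "\<phi> \<in> test_functions" "\<psi> \<in> test_functions"
  shows "(\<lambda>t. \<phi> t - \<psi> t) \<in> test_functions"
  using test_add[OF assms(1) test_cmult[OF assms(2), of "-1"]] by simp

lemma test_sum:
  assumes "\<And>i. i \<in> A \<Longrightarrow> \<phi> i \<in> test_functions"
  shows "(\<lambda>t. \<Sum>i\<in>A. a i * \<phi> i t) \<in> test_functions"
  using assms
proof (induction A rule: infinite_finite_induct)
  case (insert i A)
  then show ?case
    by (auto intro!: test_add test_cmult)
qed (auto intro!: test_continuous continuous_intros)

lemma test_L2: "\<phi> \<in> test_functions \<Longrightarrow> \<phi> \<in> L2_functions \<beta>"
proof -
  assume a: "\<phi> \<in> test_functions"
  then obtain B where B: "B \<ge> 0" "\<And>t. t \<in> {0..\<beta>} \<Longrightarrow> \<bar>\<phi> t\<bar> \<le> B"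
    by (rule test_functionE) blast
  have "set_integrable lborel {0..\<beta>} (\<lambda>t. (\<phi> t)\<^sup>2)"
    by (rule set_integrable_bounded[where B="B\<^sup>2"])
       (use sbm_mult[OF sbm_test[OF a] sbm_test[OF a]] B in
         \<open>auto simp: power2_eq_square abs_mult simp del: abs_mult_self_eq intro!: mult_mono\<close>)
  with a show ?thesis
    by (auto simp: L2_functions_def test_functions_def)
qed

lemma set_integrable_test:
  assumes "\<phi> \<in> test_functions" "continuous_on {0..\<beta>} f"
  shows "set_integrable lborel {0..\<beta>} (\<lambda>t. \<phi> t * f t)"
proof -
  obtain B where B: "B \<ge> 0" "\<And>t. t \<in> {0..\<beta>} \<Longrightarrow> \<bar>\<phi> t\<bar> \<le> B"
    using assms(1) by (rule test_functionE) blast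
  obtain C where C: "C \<ge> 0" "\<And>t. t \<in> {0..\<beta>} \<Longrightarrow> \<bar>f t\<bar> \<le> C"
    using assms(2) by (rule continuous_bounded) blast
  show ?thesis
    by (rule set_integrable_bounded[where B="B * C"])
       (use B C sbm_mult[OF sbm_test[OF assms(1)] sbm_continuous[OF assms(2)]] in
         \<open>auto simp: abs_mult intro!: mult_mono\<close>)
qed

lemma L2_inner_cmult: "L2_inner \<beta> (\<lambda>t. a * \<phi> t) f = a * L2_inner \<beta> \<phi> f"
  by (simp add: L2_inner_def mult.assoc)

lemma L2_inner_commute: "L2_inner \<beta> f g = L2_inner \<beta> g f"
  by (simp add: L2_inner_def mult.commute)

lemma L2_inner_add:
  assumes "\<phi> \<in> test_functions" "\<psi> \<in> test_functions" "continuous_on {0..\<beta>} f"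
  shows "L2_inner \<beta> (\<lambda>t. \<phi> t + \<psi> t) f = L2_inner \<beta> \<phi> f + L2_inner \<beta> \<psi> f"
  using set_integrable_test[OF assms(1,3)] set_integrable_test[OF assms(2,3)]
  by (simp add: L2_inner_def distrib_right)

lemma L2_inner_diff:
  assumes "\<phi> \<in> test_functions" "\<psi> \<in> test_functions" "continuous_on {0..\<beta>} f"
  shows "L2_inner \<beta> (\<lambda>t. \<phi> t - \<psi> t) f = L2_inner \<beta> \<phi> f - L2_inner \<beta> \<psi> f"
  using set_integrable_test[OF assms(1,3)] set_integrable_test[OF assms(2,3)]
  by (simp add: L2_inner_def left_diff_distrib)

lemma L2_inner_sum:
  assumes "finite A" "\<And>i. i \<in> A \<Longrightarrow> \<phi> i \<in> test_functions" "continuous_on {0..\<beta>} f"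
  shows "L2_inner \<beta> (\<lambda>t. \<Sum>i\<in>A. a i * \<phi> i t) f = (\<Sum>i\<in>A. a i * L2_inner \<beta> (\<phi> i) f)"
  using assms(1,2)
proof (induction A)
  case empty
  then show ?case by (simp add: L2_inner_def set_lebesgue_integral_def)
next
  case (insert i A)
  then show ?case
    by (simp add: L2_inner_add[OF test_cmult test_sum assms(3)] L2_inner_cmult)
qed

lemma L2_inner_self_nonneg: "L2_inner \<beta> f f \<ge> 0"
  unfolding L2_inner_def set_lebesgue_integral_def by (intro integral_nonneg_AE) (auto simp: indicator_def)

section \<open>The Fourier basis\<close>

lemma fourier_basis_continuous: "continuous_on A (fourier_basis \<beta> n)"
  unfolding fourier_basis_def by (cases "n = 0"; cases "n > 0") (auto intro!: continuous_intros)

lemma fourier_basis_bound: "\<bar>fourier_basis \<beta> n t\<bar> \<le> sqrt (2 / \<beta>)"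
proof -
  have "1 / sqrt \<beta> \<le> sqrt (2 / \<beta>)"
    using \<beta>_pos by (simp add: real_sqrt_divide divide_right_mono)
  moreover have "sqrt (2 / \<beta>) * \<bar>x\<bar> \<le> sqrt (2 / \<beta>)" if "\<bar>x\<bar> \<le> 1" for x
    using that \<beta>_pos by (simp add: mult_left_le)
  ultimately show ?thesis
    using \<beta>_pos by (auto simp: fourier_basis_def abs_mult)
qed

lemma fourier_basis_Lipschitz:
  "\<bar>fourier_basis \<beta> n s - fourier_basis \<beta> n t\<bar> \<le> sqrt (2 / \<beta>) * (\<bar>freq \<beta> n\<bar> * \<bar>s - t\<bar>)"
proof -
  have c: "\<bar>cos x - cos y\<bar> \<le> \<bar>x - y\<bar>" for x y :: real
  proof -
    have "cos x - cos y = 2 * sin ((x + y) / 2) * sin ((y - x) / 2)"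
      by (rule cos_diff_cos)
    then have "\<bar>cos x - cos y\<bar> = 2 * \<bar>sin ((x + y) / 2)\<bar> * \<bar>sin ((y - x) / 2)\<bar>"
      by (simp add: abs_mult)
    also have "\<dots> \<le> 2 * 1 * \<bar>(y - x) / 2\<bar>"
      by (intro mult_mono abs_sin_x_le_abs_x) auto
    finally show ?thesis by simp
  qed
  have s: "\<bar>sin x - sin y\<bar> \<le> \<bar>x - y\<bar>" for x y :: real
    using c[of "pi / 2 - x" "pi / 2 - y"] by (simp add: cos_diff)
  have d: "\<bar>sqrt (2 / \<beta>) * a - sqrt (2 / \<beta>) * b\<bar> \<le> sqrt (2 / \<beta>) * (\<bar>freq \<beta> n\<bar> * \<bar>s - t\<bar>)"
    if "\<bar>a - b\<bar> \<le> \<bar>freq \<beta> n * s - freq \<beta> n * t\<bar>" for a b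
    using that \<beta>_pos
    by (simp only: right_diff_distrib[symmetric] abs_mult) (simp add: mult_left_mono)
  consider "n = 0" | "n > 0" | "n < 0" by linarith
  then show ?thesis
  proof cases
    case 1
    then show ?thesis
      using \<beta>_pos by (simp add: fourier_basis_def)
  qed (simp_all add: fourier_basis_def d c s)
qed

lemma
  shows integral_cos_freq: "(LBINT t:{0..\<beta>}. cos (freq \<beta> n * t)) = (if n = 0 then \<beta> else 0)"
    and integral_sin_freq: "(LBINT t:{0..\<beta>}. sin (freq \<beta> n * t)) = 0"
proof -
  let ?q = "freq \<beta> n"
  have q0: "?q = 0 \<longleftrightarrow> n = 0"
    using \<beta>_pos by (simp add: freq_def)
  have "?q * \<beta> = 2 * pi * of_int n"
    using \<beta>_pos by (simp add: freq_def)
  then have qb: "sin (?q * \<beta>) = 0" "cos (?q * \<beta>) = 1"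
    by (simp_all add: sin_integer_2pi cos_integer_2pi)
  have "(LBINT t:{0..\<beta>}. cos (?q * t)) = sin (?q * \<beta>) / ?q - sin (?q * 0) / ?q" if "n \<noteq> 0"
    unfolding set_lebesgue_integral_def using \<beta>_pos that q0
    by (intro integral_FTC_atLeastAtMost)
       (auto intro!: derivative_eq_intros continuous_intros simp flip: has_real_derivative_iff_has_vector_derivative)
  then show "(LBINT t:{0..\<beta>}. cos (?q * t)) = (if n = 0 then \<beta> else 0)"
    using qb q0 by (cases "n = 0") (simp_all add: set_integral_const)
  have "((\<lambda>t. - cos (?q * t) / ?q) has_real_derivative sin (?q * t)) (at t within S)" if "n \<noteq> 0" for t S
    using that q0 by (auto intro!: derivative_eq_intros)
  then have "(LBINT t:{0..\<beta>}. sin (?q * t)) = - cos (?q * \<beta>) / ?q - - cos (?q * 0) / ?q" if "n \<noteq> 0"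
    unfolding set_lebesgue_integral_def using \<beta>_pos that
    by (intro integral_FTC_atLeastAtMost)
       (auto intro!: continuous_intros simp flip: has_real_derivative_iff_has_vector_derivative)
  then show "(LBINT t:{0..\<beta>}. sin (?q * t)) = 0"
    using qb q0 by (cases "n = 0") (simp_all add: set_integral_const)
qed

text \<open>Product-to-sum formulas leave frequencies of index n - k and n + k, and only index 0 has
  non-zero mean. For non-zero indices n = - k pairs a cosine with a sine, whose product integrates
  to 0.\<close>

lemma fourier_basis_orthonormal:
  "L2_inner \<beta> (fourier_basis \<beta> n) (fourier_basis \<beta> k) = (if n = k then 1 else 0)"
proof -
  have fd: "freq \<beta> (n + k) * t = freq \<beta> n * t + freq \<beta> k * t"
    "freq \<beta> (n - k) * t = freq \<beta> n * t - freq \<beta> k * t" for n k t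
    by (simp_all add: freq_def algebra_simps add_divide_distrib diff_divide_distrib)
  have si: "set_integrable lborel {0..\<beta>} (\<lambda>t. cos (freq \<beta> n * t))"
      "set_integrable lborel {0..\<beta>} (\<lambda>t. sin (freq \<beta> n * t))" for n
    by (auto intro!: borel_integrable_atLeastAtMost' continuous_intros)
  have cc: "(LBINT t:{0..\<beta>}. cos (freq \<beta> n * t) * cos (freq \<beta> k * t)) =
      ((if n = k then \<beta> else 0) + (if n = - k then \<beta> else 0)) / 2" for n k
  proof -
    have "(LBINT t:{0..\<beta>}. cos (freq \<beta> n * t) * cos (freq \<beta> k * t)) =
      (LBINT t:{0..\<beta>}. (1/2) * (cos (freq \<beta> (n - k) * t) + cos (freq \<beta> (n + k) * t)))"
      by (simp add: cos_times_cos fd)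
    then show ?thesis
      by (auto simp: si integral_cos_freq eq_neg_iff_add_eq_0)
  qed
  have ss: "(LBINT t:{0..\<beta>}. sin (freq \<beta> n * t) * sin (freq \<beta> k * t)) =
      ((if n = k then \<beta> else 0) - (if n = - k then \<beta> else 0)) / 2" for n k
  proof -
    have "(LBINT t:{0..\<beta>}. sin (freq \<beta> n * t) * sin (freq \<beta> k * t)) =
      (LBINT t:{0..\<beta>}. (1/2) * (cos (freq \<beta> (n - k) * t) - cos (freq \<beta> (n + k) * t)))"
      by (simp add: sin_times_sin fd)
    then show ?thesis
      by (auto simp: si integral_cos_freq eq_neg_iff_add_eq_0)
  qed
  have sc: "(LBINT t:{0..\<beta>}. sin (freq \<beta> n * t) * cos (freq \<beta> k * t)) = 0" for n k
  proof -
    have "(LBINT t:{0..\<beta>}. sin (freq \<beta> n * t) * cos (freq \<beta> k * t)) =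
      (LBINT t:{0..\<beta>}. (1/2) * (sin (freq \<beta> (n + k) * t) + sin (freq \<beta> (n - k) * t)))"
      by (simp add: sin_times_cos fd)
    then show ?thesis
      by (auto simp: si integral_sin_freq)
  qed
  have cs: "(LBINT t:{0..\<beta>}. cos (freq \<beta> n * t) * sin (freq \<beta> k * t)) = 0" for n k
    using sc[of k n] by (simp add: mult.commute)
  have sq: "sqrt (2 / \<beta>) * (sqrt (2 / \<beta>) * x) = (2 / \<beta>) * x"
    "1 / sqrt \<beta> * (1 / sqrt \<beta>) = 1 / \<beta>" for x
    using \<beta>_pos by (simp_all flip: mult.assoc)
  have r: "(sqrt (2 / \<beta>) * x) * (sqrt (2 / \<beta>) * y) = (2 / \<beta>) * (x * y)" for x y
    using sq(1)[of "x * y"] by (simp add: algebra_simps)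
  have r0: "(1 / sqrt \<beta>) * (sqrt (2 / \<beta>) * y) = (1 / sqrt \<beta> * sqrt (2 / \<beta>)) * y"
    "(sqrt (2 / \<beta>) * y) * (1 / sqrt \<beta>) = (1 / sqrt \<beta> * sqrt (2 / \<beta>)) * y" for y
    by simp_all
  have e: "fourier_basis \<beta> 0 = (\<lambda>t. 1 / sqrt \<beta>)"
    "n > 0 \<Longrightarrow> fourier_basis \<beta> n = (\<lambda>t. sqrt (2 / \<beta>) * cos (freq \<beta> n * t))"
    "n < 0 \<Longrightarrow> fourier_basis \<beta> n = (\<lambda>t. sqrt (2 / \<beta>) * sin (freq \<beta> n * t))" for n
    by (auto simp: fourier_basis_def fun_eq_iff)
  consider "n = 0" "k = 0" | "n = 0" "k > 0" | "n = 0" "k < 0" | "n > 0" "k = 0" | "n < 0" "k = 0"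
    | "n > 0" "k > 0" | "n > 0" "k < 0" | "n < 0" "k > 0" | "n < 0" "k < 0"
    by linarith
  then show ?thesis
    unfolding L2_inner_def
    by cases (use \<beta>_pos in \<open>simp_all only: e r r0 sq set_integral_mult_right cc ss sc cs
        integral_cos_freq integral_sin_freq set_integral_const\<close>, use \<beta>_pos in simp_all)
qed

section \<open>Eigenvalues and the variance of a test function\<close>

definition eigenvalue :: "real \<Rightarrow> int \<Rightarrow> real" where
  "eigenvalue m n = 1 / (m * (freq \<beta> n)\<^sup>2 + 1)"

text \<open>The quadratic form of the covariance operator, diagonalized. By
  \<open>distr_L2_inner\<close> it is the variance of the pairing with \<phi>, so variances can be
  estimated mode by mode.\<close>

definition variance_form :: "real \<Rightarrow> (real \<Rightarrow> real) \<Rightarrow> real" where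
  "variance_form m \<phi> = (\<Sum>\<^sub>\<infinity>n. eigenvalue m n * (L2_inner \<beta> \<phi> (fourier_basis \<beta> n))\<^sup>2)"

lemma eigenvalue_pos: "m > 0 \<Longrightarrow> eigenvalue m n > 0"
  unfolding eigenvalue_def by (intro divide_pos_pos add_nonneg_pos) auto

lemma eigenvalue_le_1: "m > 0 \<Longrightarrow> eigenvalue m n \<le> 1"
  unfolding eigenvalue_def by (simp add: divide_le_eq_1 add_nonneg_pos)

lemma eigenvalue_0 [simp]: "eigenvalue m 0 = 1"
  by (simp add: eigenvalue_def freq_def)

lemma eigenvalue_antimono: "0 < m \<Longrightarrow> m \<le> m' \<Longrightarrow> eigenvalue m' n \<le> eigenvalue m n"
  unfolding eigenvalue_def by (intro divide_left_mono mult_pos_pos add_nonneg_pos add_mono mult_right_mono) auto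

text \<open>Dropping the 1 in the denominator produces the factor \<open>1 / m\<close> that drives
  the limit, for every mode but the constant one.\<close>

lemma eigenvalue_le:
  assumes "m > 0" "n \<noteq> 0"
  shows "eigenvalue m n \<le> (\<beta> / (2 * pi))\<^sup>2 / m * \<bar>real_of_int n\<bar> powr - 2"
proof -
  have f: "(freq \<beta> n)\<^sup>2 > 0"
    using assms \<beta>_pos by (simp add: freq_def)
  have "eigenvalue m n \<le> 1 / (m * (freq \<beta> n)\<^sup>2)"
    unfolding eigenvalue_def using assms f by (intro divide_left_mono) (auto intro!: mult_pos_pos add_pos_pos)
  also have "\<dots> = (\<beta> / (2 * pi))\<^sup>2 / m * \<bar>real_of_int n\<bar> powr - 2"
    using assms by (simp add: freq_def powr_minus powr_numeral power_divide power_mult_distrib divide_simps)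
  finally show ?thesis .
qed

lemma summable_eigenvalue:
  assumes "m > 0"
  shows "eigenvalue m summable_on UNIV"
proof -
  have "(\<lambda>n. (\<beta> / (2 * pi))\<^sup>2 / m * \<bar>real_of_int n\<bar> powr - 2) summable_on (UNIV - {0})"
    by (intro summable_on_cmult_right summable_on_subset[OF summable_on_int_powr]) auto
  then have "eigenvalue m summable_on (UNIV - {0})"
    by (rule summable_on_comparison_test) (use assms eigenvalue_le eigenvalue_pos in \<open>auto simp: less_imp_le\<close>)
  then have "eigenvalue m summable_on ((UNIV - {0}) \<union> {0})"
    by (intro summable_on_union) auto
  then show ?thesis by simp
qed

lemma L2_inner_fourier_bound:
  assumes "\<phi> \<in> test_functions" "\<And>t. t \<in> {0..\<beta>} \<Longrightarrow> \<bar>\<phi> t\<bar> \<le> B"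
  shows "\<bar>L2_inner \<beta> \<phi> (fourier_basis \<beta> n)\<bar> \<le> \<beta> * (B * sqrt (2 / \<beta>))"
proof -
  have "B \<ge> 0" using assms(2)[of 0] \<beta>_pos by auto
  then show ?thesis
    unfolding L2_inner_def
    by (intro set_integral_bounded sbm_mult sbm_test sbm_continuous assms fourier_basis_continuous)
       (use assms fourier_basis_bound in \<open>auto simp: abs_mult intro!: mult_mono\<close>)
qed

lemma summable_variance_form:
  assumes "m > 0" "\<phi> \<in> test_functions"
  shows "(\<lambda>n. eigenvalue m n * (L2_inner \<beta> \<phi> (fourier_basis \<beta> n))\<^sup>2) summable_on UNIV"
proof -
  obtain B where B: "B \<ge> 0" "\<And>t. t \<in> {0..\<beta>} \<Longrightarrow> \<bar>\<phi> t\<bar> \<le> B"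
    using assms(2) by (rule test_functionE) blast
  let ?C = "(\<beta> * (B * sqrt (2 / \<beta>)))\<^sup>2"
  have *: "(L2_inner \<beta> \<phi> (fourier_basis \<beta> n))\<^sup>2 \<le> ?C" for n
    using L2_inner_fourier_bound[OF assms(2) B(2), of n]
    by (metis abs_ge_zero power2_abs power_mono)
  have "(\<lambda>n. ?C * eigenvalue m n) summable_on UNIV"
    by (intro summable_on_cmult_right summable_eigenvalue assms)
  then show ?thesis
    by (rule summable_on_comparison_test)
       (use * eigenvalue_pos[OF assms(1)] in \<open>auto simp: mult.commute[of _ "eigenvalue m _"] less_imp_le intro!: mult_left_mono\<close>)
qed

text \<open>Termwise integration of the series that defines the operator: the basis is uniformly
  bounded and the eigenvalues are summable, so the integrals of the absolute values are
  summable.\<close>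

lemma variance_form_eq:
  assumes m: "m > 0" and \<phi>: "\<phi> \<in> test_functions"
  shows "L2_inner \<beta> \<phi> (cov_operator \<beta> m \<phi>) = variance_form m \<phi>"
proof -
  obtain B where B: "B \<ge> 0" "\<And>t. t \<in> {0..\<beta>} \<Longrightarrow> \<bar>\<phi> t\<bar> \<le> B"
    using \<phi> by (rule test_functionE) blast
  define K where "K = \<beta> * (B * sqrt (2 / \<beta>))"
  define c where "c n = eigenvalue m n * L2_inner \<beta> \<phi> (fourier_basis \<beta> n)" for n
  have K0: "K \<ge> 0" using B \<beta>_pos by (simp add: K_def)
  have cb: "\<bar>c n\<bar> \<le> K * eigenvalue m n" for n
    using L2_inner_fourier_bound[OF \<phi> B(2), of n] eigenvalue_pos[OF m, of n]
    by (simp add: c_def K_def abs_mult mult.commute mult_left_mono)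
  have bij: "bij int_decode"
    by (rule bij_int_decode)
  \<comment> \<open>Unordered sums over the integers become series along \<open>int_decode\<close>,
    the form in which \<open>integral_suminf\<close> exchanges sum and integral.\<close>
  have enum: "summable (\<lambda>i. f (int_decode i)) \<and> (\<Sum>i. f (int_decode i)) = infsum f UNIV"
    if "f summable_on UNIV" for f :: "int \<Rightarrow> real"
  proof -
    have "((\<lambda>i. f (int_decode i)) has_sum infsum f UNIV) UNIV"
      using that summable_on_reindex_bij_betw[OF bij, of f] infsum_reindex_bij_betw[OF bij, of f]
        has_sum_infsum[of "\<lambda>i. f (int_decode i)" UNIV] by simp
    then show ?thesis
      using has_sum_imp_sums sums_iff by blast
  qed
  have sl: "eigenvalue m summable_on UNIV"
    by (rule summable_eigenvalue[OF m])
  have tb: "\<bar>c n * fourier_basis \<beta> n t\<bar> \<le> K * sqrt (2 / \<beta>) * eigenvalue m n" for n t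
    using mult_mono[OF cb[of n] fourier_basis_bound[of n t]] K0 eigenvalue_pos[OF m, of n]
    by (simp add: abs_mult mult_ac less_imp_le)
  have st: "(\<lambda>n. c n * fourier_basis \<beta> n t) summable_on UNIV" for t
    by (rule abs_summable_summable, rule summable_on_comparison_test[OF summable_on_cmult_right[OF sl, of "K * sqrt (2 / \<beta>)"]])
       (use tb in auto)
  define F where "F i t = indicator {0..\<beta>} t *\<^sub>R (\<phi> t * (c (int_decode i) * fourier_basis \<beta> (int_decode i) t))" for i t
  have Fb: "\<bar>F i t\<bar> \<le> B * (K * sqrt (2 / \<beta>) * eigenvalue m (int_decode i)) * indicator {0..\<beta>} t" for i t
    using B mult_mono[OF B(2)[of t] tb[of "int_decode i" t]] by (auto simp: F_def indicator_def abs_mult)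
  have Fi: "set_integrable lborel {0..\<beta>} (\<lambda>t. \<phi> t * (c (int_decode i) * fourier_basis \<beta> (int_decode i) t))" for i
    by (intro set_integrable_test \<phi> continuous_intros fourier_basis_continuous)
  have sb: "summable (\<lambda>i. B * (K * sqrt (2 / \<beta>) * eigenvalue m (int_decode i)))"
    using enum[OF sl] by (intro summable_mult) auto
  have "L2_inner \<beta> \<phi> (cov_operator \<beta> m \<phi>) = (LINT t|lborel. (\<Sum>i. F i t))"
    unfolding L2_inner_def set_lebesgue_integral_def
  proof (rule Bochner_Integration.integral_cong[OF refl])
    fix t
    have s: "summable (\<lambda>i. c (int_decode i) * fourier_basis \<beta> (int_decode i) t)"
      and e: "(\<Sum>i. c (int_decode i) * fourier_basis \<beta> (int_decode i) t) = (\<Sum>\<^sub>\<infinity>n. c n * fourier_basis \<beta> n t)"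
      using enum[OF st[of t]] by auto
    have "cov_operator \<beta> m \<phi> t = (\<Sum>\<^sub>\<infinity>n. c n * fourier_basis \<beta> n t)"
      by (simp add: cov_operator_def c_def eigenvalue_def)
    then show "indicator {0..\<beta>} t *\<^sub>R (\<phi> t * cov_operator \<beta> m \<phi> t) = (\<Sum>i. F i t)"
      unfolding F_def using suminf_mult[OF s] summable_mult[OF s] e
      by (simp add: suminf_mult indicator_def)
  qed
  also have "\<dots> = (\<Sum>i. LINT t|lborel. F i t)"
  proof (rule integral_suminf)
    show "integrable lborel (F i)" for i
      using Fi[of i] unfolding F_def set_integrable_def .
    show "AE t in lborel. summable (\<lambda>i. norm (F i t))"
    proof (rule AE_I2)
      fix t
      show "summable (\<lambda>i. norm (F i t))"
        by (rule summable_comparison_test'[OF summable_mult2[OF sb, of "indicator {0..\<beta>} t"], of 0])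
           (use Fb[of _ t] in auto)
    qed
    show "summable (\<lambda>i. LINT t|lborel. norm (F i t))"
    proof (rule summable_comparison_test'[OF summable_mult[OF sb, of \<beta>], of 0])
      fix i
      have "(LINT t|lborel. norm (F i t)) \<le> (LINT t|lborel. indicator {0..\<beta>} t *\<^sub>R (B * (K * sqrt (2 / \<beta>) * eigenvalue m (int_decode i))))"
      proof (rule integral_mono)
        show "integrable lborel (\<lambda>t. norm (F i t))"
          using Fi[of i] unfolding F_def set_integrable_def by (rule integrable_norm)
        show "integrable lborel (\<lambda>t. indicator {0..\<beta>} t *\<^sub>R (B * (K * sqrt (2 / \<beta>) * eigenvalue m (int_decode i))))"
          using borel_integrable_atLeastAtMost'[of 0 \<beta> "\<lambda>_. B * (K * sqrt (2 / \<beta>) * eigenvalue m (int_decode i))"]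
          by (simp add: set_integrable_def)
      qed (use Fb[of i] in \<open>auto simp: mult_ac\<close>)
      also have "\<dots> = \<beta> * (B * (K * sqrt (2 / \<beta>) * eigenvalue m (int_decode i)))"
        using set_integral_const[of "B * (K * sqrt (2 / \<beta>) * eigenvalue m (int_decode i))"]
        by (simp add: set_lebesgue_integral_def)
      finally show "norm (LINT t|lborel. norm (F i t)) \<le> \<beta> * (B * (K * sqrt (2 / \<beta>) * eigenvalue m (int_decode i)))"
        by (simp add: integral_nonneg)
    qed
  qed
  also have "\<dots> = (\<Sum>i. eigenvalue m (int_decode i) * (L2_inner \<beta> \<phi> (fourier_basis \<beta> (int_decode i)))\<^sup>2)"
  proof (rule suminf_cong)
    fix i
    have "(LINT t|lborel. F i t) = (LBINT t:{0..\<beta>}. c (int_decode i) * (\<phi> t * fourier_basis \<beta> (int_decode i) t))"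
      unfolding F_def set_lebesgue_integral_def by (simp add: mult_ac)
    then show "(LINT t|lborel. F i t) = eigenvalue m (int_decode i) * (L2_inner \<beta> \<phi> (fourier_basis \<beta> (int_decode i)))\<^sup>2"
      by (simp add: c_def L2_inner_def power2_eq_square)
  qed
  also have "\<dots> = variance_form m \<phi>"
    unfolding variance_form_def using enum[OF summable_variance_form[OF m \<phi>]] by simp
  finally show ?thesis .
qed

end

section \<open>Gaussian laws of linear functionals\<close>

lemma nn_integral_normal_density: "\<tau> > 0 \<Longrightarrow> (\<integral>\<^sup>+x. ennreal (normal_density \<mu> \<tau> x) \<partial>lborel) = 1"
  by (subst nn_integral_eq_integral) auto

text \<open>Multiplying the standard density by \<open>exp (a * x\<^sup>2)\<close> gives \<tau>
  times a centred normal density of variance \<open>1 / (1 - 2 * a)\<close>, so \<tau> is the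
  integral.\<close>

lemma nn_integral_std_normal_exp_square:
  assumes "2 * a < 1"
  shows "(\<integral>\<^sup>+x. ennreal (exp (a * x\<^sup>2)) \<partial>std_normal_distribution) = ennreal (1 / sqrt (1 - 2 * a))"
proof -
  define \<tau> where "\<tau> = 1 / sqrt (1 - 2 * a)"
  have \<tau>: "\<tau> > 0" "\<tau>\<^sup>2 = 1 / (1 - 2 * a)"
    using assms by (simp_all add: \<tau>_def power_divide)
  have *: "std_normal_density x * exp (a * x\<^sup>2) = \<tau> * normal_density 0 \<tau> x" for x
  proof -
    have "sqrt (2 * pi * \<tau>\<^sup>2) = \<tau> * sqrt (2 * pi)"
      using \<tau>(1) by (simp add: real_sqrt_mult)
    moreover have "- x\<^sup>2 / (2 * \<tau>\<^sup>2) = - x\<^sup>2 / 2 + a * x\<^sup>2"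
      using assms by (simp add: \<tau>(2) algebra_simps diff_divide_distrib)
    then have "exp (- x\<^sup>2 / (2 * \<tau>\<^sup>2)) = exp (- x\<^sup>2 / 2) * exp (a * x\<^sup>2)"
      by (simp only: exp_add)
    ultimately show ?thesis
      using \<tau>(1) by (simp add: normal_density_def)
  qed
  have "(\<integral>\<^sup>+x. ennreal (exp (a * x\<^sup>2)) \<partial>std_normal_distribution) =
      (\<integral>\<^sup>+x. ennreal \<tau> * ennreal (normal_density 0 \<tau> x) \<partial>lborel)"
    using \<tau>(1) by (subst nn_integral_density) (simp_all add: ennreal_mult' [symmetric] *)
  also have "\<dots> = ennreal \<tau>"
    using \<tau>(1) by (subst nn_integral_cmult) (simp_all add: nn_integral_normal_density)
  finally show ?thesis
    by (simp add: \<tau>_def)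
qed

text \<open>Completing the square: the tilt by \<open>exp (a * x)\<close> moves the mean to
  \<open>a\<close> and leaves the factor \<open>exp (a\<^sup>2 / 2)\<close>.\<close>

lemma nn_integral_std_normal_exp:
  "(\<integral>\<^sup>+x. ennreal (exp (a * x)) \<partial>std_normal_distribution) = ennreal (exp (a\<^sup>2 / 2))"
proof -
  have *: "std_normal_density x * exp (a * x) = exp (a\<^sup>2 / 2) * normal_density a 1 x" for x
  proof -
    have "- x\<^sup>2 / 2 + a * x = a\<^sup>2 / 2 + - (x - a)\<^sup>2 / 2"
      by (simp add: power2_eq_square field_simps)
    then have "exp (- x\<^sup>2 / 2) * exp (a * x) = exp (a\<^sup>2 / 2) * exp (- (x - a)\<^sup>2 / 2)"
      by (simp only: exp_add [symmetric])
    then show ?thesis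
      by (simp add: normal_density_def)
  qed
  have "(\<integral>\<^sup>+x. ennreal (exp (a * x)) \<partial>std_normal_distribution) =
      (\<integral>\<^sup>+x. ennreal (exp (a\<^sup>2 / 2)) * ennreal (normal_density a 1 x) \<partial>lborel)"
    by (subst nn_integral_density) (simp_all add: ennreal_mult' [symmetric] *)
  then show ?thesis
    by (simp add: nn_integral_cmult nn_integral_normal_density)
qed

context loop_space
begin

lemma L2_inner_measurable:
  assumes \<phi>: "\<phi> \<in> test_functions"
  shows "L2_inner \<beta> \<phi> \<in> borel_measurable (loop_sigma \<beta>)"
proof (intro borel_measurable_loop continuous_map_loopI)
  fix X \<omega>
  assume X: "\<And>n. X n \<in> loops \<beta>" "\<omega> \<in> loops \<beta>"
    "\<And>n t. t \<in> {0..\<beta>} \<Longrightarrow> \<bar>X n t - \<omega> t\<bar> \<le> inverse (real (Suc n))"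
  obtain B where B: "B \<ge> 0" "\<And>t. t \<in> {0..\<beta>} \<Longrightarrow> \<bar>\<phi> t\<bar> \<le> B"
    using \<phi> by (rule test_functionE) blast
  obtain C where C: "C \<ge> 0" "\<And>t. t \<in> {0..\<beta>} \<Longrightarrow> \<bar>\<omega> t\<bar> \<le> C"
    by (rule continuous_bounded[OF loop_continuous[OF X(2)]]) blast
  show "(\<lambda>n. L2_inner \<beta> \<phi> (X n)) \<longlonglongrightarrow> L2_inner \<beta> \<phi> \<omega>"
    unfolding L2_inner_def
  proof (rule set_integral_tendsto[where B="B * (C + 1)"])
    fix n t assume t: "t \<in> {0..\<beta>}"
    have "inverse (real (Suc n)) \<le> 1" by (simp add: field_simps)
    then have "\<bar>X n t\<bar> \<le> C + 1"
      using X(3)[OF t, of n] C(2)[OF t] by linarith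
    then show "\<bar>\<phi> t * X n t\<bar> \<le> B * (C + 1)"
      using B t by (auto simp: abs_mult intro!: mult_mono)
  next
    fix t assume "t \<in> {0..\<beta>}"
    then show "(\<lambda>n. \<phi> t * X n t) \<longlonglongrightarrow> \<phi> t * \<omega> t"
      by (intro tendsto_mult_left tendsto_of_inverse_Suc X(3))
  qed (intro sbm_mult sbm_test \<phi> sbm_continuous loop_continuous X)+
qed

lemma variance_form_nonneg: "m > 0 \<Longrightarrow> variance_form m \<phi> \<ge> 0"
  unfolding variance_form_def by (intro infsum_nonneg mult_nonneg_nonneg) (auto simp: eigenvalue_pos less_imp_le)

lemma variance_form_cmult: "variance_form m (\<lambda>t. a * \<phi> t) = a\<^sup>2 * variance_form m \<phi>"
  unfolding variance_form_def L2_inner_cmult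
  by (subst infsum_cmult_right'[symmetric]) (simp add: power_mult_distrib mult_ac)

end

text \<open>One mass and its measure. Statements uniform in the mass live in
  \<open>loop_space\<close> and interpret this locale for each mass separately.\<close>

locale gaussian_loop = loop_space +
  fixes m :: real and \<gamma> :: "(real \<Rightarrow> real) measure"
  assumes m_pos: "m > 0" and quantum_reference: "quantum_reference \<beta> m \<gamma>"
begin

lemma prob_space_\<gamma>: "prob_space \<gamma>"
  using quantum_reference by (simp add: quantum_reference_def)

lemma sets_\<gamma> [measurable_cong]: "sets \<gamma> = sets (loop_sigma \<beta>)"
  using quantum_reference by (simp add: quantum_reference_def)

lemma space_\<gamma>: "space \<gamma> = loops \<beta>"
  using sets_eq_imp_space_eq[OF sets_\<gamma>] by (simp add: space_loop_sigma)

lemma L2_inner_measurable_\<gamma>: "\<phi> \<in> test_functions \<Longrightarrow> L2_inner \<beta> \<phi> \<in> borel_measurable \<gamma>"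
  using L2_inner_measurable by (simp cong: measurable_cong_sets add: sets_\<gamma>)

text \<open>Along the ray \<open>t * \<phi>\<close> the characteristic functional is the
  characteristic function of the pairing, so Levy's theorem identifies the law. A scaled standard
  normal, rather than a density, also covers variance 0.\<close>

lemma distr_L2_inner:
  assumes \<phi>: "\<phi> \<in> test_functions"
  shows "distr \<gamma> borel (L2_inner \<beta> \<phi>) =
    distr std_normal_distribution borel (\<lambda>x. sqrt (variance_form m \<phi>) * x)"
proof (rule Levy_uniqueness)
  note M = L2_inner_measurable_\<gamma>[OF \<phi>]
  let ?\<sigma> = "sqrt (variance_form m \<phi>)"
  show "real_distribution (distr \<gamma> borel (L2_inner \<beta> \<phi>))"
    by (simp add: real_distribution_def real_distribution_axioms_def prob_space.prob_space_distr[OF prob_space_\<gamma> M])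
  interpret N: real_distribution std_normal_distribution
    by (rule real_dist_normal_dist)
  show "real_distribution (distr std_normal_distribution borel (\<lambda>x. ?\<sigma> * x))"
    by (rule N.real_distribution_distr) simp
  show "char (distr \<gamma> borel (L2_inner \<beta> \<phi>)) = char (distr std_normal_distribution borel (\<lambda>x. ?\<sigma> * x))"
  proof
    fix t
    have t\<phi>: "(\<lambda>u. t * \<phi> u) \<in> test_functions"
      using \<phi> by (rule test_cmult)
    have "char (distr \<gamma> borel (L2_inner \<beta> \<phi>)) t = (CLINT \<omega>|\<gamma>. iexp (L2_inner \<beta> (\<lambda>u. t * \<phi> u) \<omega>))"
      unfolding char_def by (subst integral_distr[OF M]) (simp_all add: L2_inner_cmult)
    also have "\<dots> = complex_of_real (exp (- L2_inner \<beta> (\<lambda>u. t * \<phi> u) (cov_operator \<beta> m (\<lambda>u. t * \<phi> u)) / 2))"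
      using quantum_reference test_L2[OF t\<phi>] unfolding quantum_reference_def by blast
    also have "L2_inner \<beta> (\<lambda>u. t * \<phi> u) (cov_operator \<beta> m (\<lambda>u. t * \<phi> u)) = (?\<sigma> * t)\<^sup>2"
      using variance_form_eq[OF m_pos t\<phi>] variance_form_nonneg[OF m_pos, of \<phi>]
      by (simp add: variance_form_cmult power_mult_distrib)
    also have "complex_of_real (exp (- (?\<sigma> * t)\<^sup>2 / 2)) = char std_normal_distribution (?\<sigma> * t)"
      by (simp add: char_std_normal_distribution)
    also have "\<dots> = char (distr std_normal_distribution borel (\<lambda>x. ?\<sigma> * x)) t"
      unfolding char_def by (subst integral_distr) (simp_all add: mult_ac)
    finally show "char (distr \<gamma> borel (L2_inner \<beta> \<phi>)) t =
      char (distr std_normal_distribution borel (\<lambda>x. ?\<sigma> * x)) t" .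
  qed
qed

lemma nn_integral_L2_inner:
  assumes "\<phi> \<in> test_functions" "f \<in> borel_measurable borel"
  shows "(\<integral>\<^sup>+\<omega>. f (L2_inner \<beta> \<phi> \<omega>) \<partial>\<gamma>) =
    (\<integral>\<^sup>+x. f (sqrt (variance_form m \<phi>) * x) \<partial>std_normal_distribution)"
  using nn_integral_distr[OF L2_inner_measurable_\<gamma>[OF assms(1)], of f]
    nn_integral_distr[of "\<lambda>x. sqrt (variance_form m \<phi>) * x" std_normal_distribution borel f] assms(2)
  by (simp add: distr_L2_inner[OF assms(1)])

lemma nn_integral_exp_L2_inner_square:
  assumes "\<phi> \<in> test_functions" "2 * s * variance_form m \<phi> < 1"
  shows "(\<integral>\<^sup>+\<omega>. ennreal (exp (s * (L2_inner \<beta> \<phi> \<omega>)\<^sup>2)) \<partial>\<gamma>) = ennreal (1 / sqrt (1 - 2 * s * variance_form m \<phi>))"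
  using nn_integral_L2_inner[OF assms(1), of "\<lambda>x. ennreal (exp (s * x\<^sup>2))"]
    nn_integral_std_normal_exp_square[of "s * variance_form m \<phi>"] assms(2)
    variance_form_nonneg[OF m_pos, of \<phi>]
  by (simp add: power_mult_distrib mult.assoc)

lemma nn_integral_exp_L2_inner:
  assumes "\<phi> \<in> test_functions"
  shows "(\<integral>\<^sup>+\<omega>. ennreal (exp (L2_inner \<beta> \<phi> \<omega>)) \<partial>\<gamma>) = ennreal (exp (variance_form m \<phi> / 2))"
  using nn_integral_L2_inner[OF assms(1), of "\<lambda>x. ennreal (exp x)"]
    nn_integral_std_normal_exp[of "sqrt (variance_form m \<phi>)"] variance_form_nonneg[OF m_pos, of \<phi>]
  by simp

text \<open>Fatou's lemma carries exponential moments from pairings to their pointwise limits, such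
  as increments of a loop between two times.\<close>

lemma nn_integral_exp_square_limit:
  assumes \<phi>: "\<And>n. \<phi> n \<in> test_functions"
    and lim: "\<And>\<omega>. \<omega> \<in> loops \<beta> \<Longrightarrow> (\<lambda>n. L2_inner \<beta> (\<phi> n) \<omega>) \<longlonglongrightarrow> X \<omega>"
    and var: "eventually (\<lambda>n. variance_form m (\<phi> n) \<le> v) sequentially"
    and s: "0 \<le> s" "2 * s * v < 1"
  shows "(\<integral>\<^sup>+\<omega>. ennreal (exp (s * (X \<omega>)\<^sup>2)) \<partial>\<gamma>) \<le> ennreal (1 / sqrt (1 - 2 * s * v))"
proof -
  have "(\<integral>\<^sup>+\<omega>. ennreal (exp (s * (X \<omega>)\<^sup>2)) \<partial>\<gamma>) =
      (\<integral>\<^sup>+\<omega>. liminf (\<lambda>n. ennreal (exp (s * (L2_inner \<beta> (\<phi> n) \<omega>)\<^sup>2))) \<partial>\<gamma>)"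
  proof (rule nn_integral_cong)
    fix \<omega> assume "\<omega> \<in> space \<gamma>"
    then have "(\<lambda>n. ennreal (exp (s * (L2_inner \<beta> (\<phi> n) \<omega>)\<^sup>2))) \<longlonglongrightarrow> ennreal (exp (s * (X \<omega>)\<^sup>2))"
      by (intro tendsto_ennrealI tendsto_exp tendsto_mult_left tendsto_power lim) (simp add: space_\<gamma>)
    then show "ennreal (exp (s * (X \<omega>)\<^sup>2)) = liminf (\<lambda>n. ennreal (exp (s * (L2_inner \<beta> (\<phi> n) \<omega>)\<^sup>2)))"
      by (rule lim_imp_Liminf[OF trivial_limit_sequentially, symmetric])
  qed
  also have "\<dots> \<le> liminf (\<lambda>n. \<integral>\<^sup>+\<omega>. ennreal (exp (s * (L2_inner \<beta> (\<phi> n) \<omega>)\<^sup>2)) \<partial>\<gamma>)"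
  proof (rule nn_integral_liminf)
    note L2_inner_measurable[OF \<phi>, measurable]
    show "(\<lambda>\<omega>. ennreal (exp (s * (L2_inner \<beta> (\<phi> n) \<omega>)\<^sup>2))) \<in> borel_measurable \<gamma>" for n
      by measurable
  qed
  also have "\<dots> \<le> limsup (\<lambda>n. \<integral>\<^sup>+\<omega>. ennreal (exp (s * (L2_inner \<beta> (\<phi> n) \<omega>)\<^sup>2)) \<partial>\<gamma>)"
    by (rule Liminf_le_Limsup) simp
  also have "\<dots> \<le> ennreal (1 / sqrt (1 - 2 * s * v))"
  proof (rule Limsup_bounded, use var in eventually_elim)
    fix n assume v: "variance_form m (\<phi> n) \<le> v"
    have l: "2 * s * variance_form m (\<phi> n) \<le> 2 * s * v"
      using v s by (intro mult_left_mono) auto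
    show "(\<integral>\<^sup>+\<omega>. ennreal (exp (s * (L2_inner \<beta> (\<phi> n) \<omega>)\<^sup>2)) \<partial>\<gamma>) \<le> ennreal (1 / sqrt (1 - 2 * s * v))"
      using l s by (subst nn_integral_exp_L2_inner_square[OF \<phi>]) (auto intro!: ennreal_leI divide_left_mono)
  qed
  finally show ?thesis .
qed

end

section \<open>Increments and dyadic chaining\<close>

text \<open>Interpolates between a bounded amplitude and a Lipschitz bound. The power 1/2 is low
  enough: with x proportional to the frequency index k, the eigenvalue decay of order 2 still leaves
  the summable order 3/2.\<close>

lemma min_square_le_sqrt:
  fixes x y :: real
  assumes "0 \<le> x" "0 \<le> y" "y \<le> 2" "y \<le> 3 * x"
  shows "y\<^sup>2 \<le> 9 * sqrt x"
proof (cases "x \<le> 1")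
  case True
  have "y\<^sup>2 \<le> (3 * x)\<^sup>2"
    using assms by (intro power_mono) auto
  also have "\<dots> = 9 * (x * x)"
    by (simp add: power2_eq_square)
  also have "x * x \<le> x * 1"
    using True assms by (intro mult_left_mono) auto
  also have "x \<le> sqrt x"
    using True assms by (intro real_le_rsqrt) (simp add: power2_eq_square mult_left_le)
  finally show ?thesis
    by simp
next
  case False
  have "y\<^sup>2 \<le> 4"
    using power_mono[of y 2 2] assms by simp
  moreover have "1 \<le> sqrt x"
    using False by simp
  ultimately show ?thesis
    by linarith
qed

context loop_space
begin

section \<open>Averages over short windows in place of point evaluation\<close>

definition window :: "real \<Rightarrow> real \<Rightarrow> real \<Rightarrow> real" where
  "window a b = (\<lambda>u. indicator {a..b} u / (b - a))"

lemma window_test: "window a b \<in> test_functions"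
proof -
  have "\<forall>t\<in>{0..\<beta>}. \<bar>window a b t\<bar> \<le> \<bar>1 / (b - a)\<bar>"
    by (auto simp: window_def indicator_def)
  then show ?thesis
    by (auto simp: test_functions_def window_def)
qed

lemma L2_inner_window_le:
  assumes ab: "0 \<le> a" "a < b" "b \<le> \<beta>" and f: "continuous_on {0..\<beta>} f"
    and le: "\<And>u. u \<in> {a..b} \<Longrightarrow> f u \<le> x"
  shows "L2_inner \<beta> (window a b) f \<le> x"
proof -
  have "L2_inner \<beta> (window a b) f \<le> L2_inner \<beta> (window a b) (\<lambda>_. x)"
    unfolding L2_inner_def
    by (intro set_integral_mono set_integrable_test window_test f continuous_intros)
       (use ab le in \<open>auto simp: window_def indicator_def divide_right_mono\<close>)
  also have "\<dots> = (LBINT u:{a..b}. x / (b - a))"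
    unfolding L2_inner_def set_lebesgue_integral_def window_def
    by (rule Bochner_Integration.integral_cong) (use ab in \<open>auto simp: indicator_def\<close>)
  also have "\<dots> = x"
    using ab by (simp add: set_lebesgue_integral_def)
  finally show ?thesis .
qed

lemma L2_inner_uminus: "L2_inner \<beta> \<phi> (\<lambda>t. - f t) = - L2_inner \<beta> \<phi> f"
  by (simp add: L2_inner_def set_lebesgue_integral_def)

lemma L2_inner_window:
  assumes ab: "0 \<le> a" "a < b" "b \<le> \<beta>" and f: "continuous_on {0..\<beta>} f"
    and le: "\<And>u. u \<in> {a..b} \<Longrightarrow> \<bar>f u - x\<bar> \<le> \<epsilon>"
  shows "\<bar>L2_inner \<beta> (window a b) f - x\<bar> \<le> \<epsilon>"
proof -
  have "L2_inner \<beta> (window a b) f \<le> x + \<epsilon>"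
    by (rule L2_inner_window_le[OF ab f]) (use le in \<open>auto simp: abs_le_iff algebra_simps\<close>)
  moreover have "L2_inner \<beta> (window a b) (\<lambda>u. - f u) \<le> - x + \<epsilon>"
    by (rule L2_inner_window_le[OF ab]) (use f le in \<open>auto simp: abs_le_iff algebra_simps intro: continuous_intros\<close>)
  ultimately show ?thesis
    by (auto simp: L2_inner_uminus)
qed

text \<open>The cut at 0 and \<beta> makes the window one-sided at the end points without letting it
  degenerate.\<close>

definition loc_window :: "real \<Rightarrow> nat \<Rightarrow> real \<Rightarrow> real" where
  "loc_window t n = window (max 0 (t - inverse (real (Suc n)))) (min \<beta> (t + inverse (real (Suc n))))"

lemma loc_window_test: "loc_window t n \<in> test_functions"
  by (simp add: loc_window_def window_test)

lemma L2_inner_loc_window: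
  assumes t: "t \<in> {0..\<beta>}" and f: "continuous_on {0..\<beta>} f"
    and le: "\<And>u. u \<in> {0..\<beta>} \<Longrightarrow> \<bar>u - t\<bar> \<le> inverse (real (Suc n)) \<Longrightarrow> \<bar>f u - x\<bar> \<le> \<epsilon>"
  shows "\<bar>L2_inner \<beta> (loc_window t n) f - x\<bar> \<le> \<epsilon>"
proof -
  define d where "d = inverse (real (Suc n))"
  have "d > 0"
    by (simp add: d_def)
  with t have d: "d > 0" "t - d < \<beta>" "0 < t + d"
    by auto
  show ?thesis
    unfolding loc_window_def d_def[symmetric]
    by (rule L2_inner_window[OF _ _ _ f le[folded d_def]]) (use t d \<beta>_pos in auto)
qed

lemma L2_inner_loc_window_tendsto:
  assumes t: "t \<in> {0..\<beta>}" and f: "continuous_on {0..\<beta>} f"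
  shows "(\<lambda>n. L2_inner \<beta> (loc_window t n) f) \<longlonglongrightarrow> f t"
proof (rule LIMSEQ_I)
  fix r :: real assume r: "r > 0"
  obtain d where d: "d > 0" "\<And>u. u \<in> {0..\<beta>} \<Longrightarrow> \<bar>u - t\<bar> < d \<Longrightarrow> \<bar>f u - f t\<bar> < r / 2"
    using f t r unfolding continuous_on_iff dist_real_def by (metis half_gt_zero)
  obtain N where N: "inverse (real (Suc N)) < d"
    using reals_Archimedean d(1) by blast
  have "norm (L2_inner \<beta> (loc_window t n) f - f t) < r" if "n \<ge> N" for n
  proof -
    have "inverse (real (Suc n)) \<le> inverse (real (Suc N))"
      using that by (simp add: field_simps)
    with N have "inverse (real (Suc n)) < d"
      by linarith
    then have "\<bar>L2_inner \<beta> (loc_window t n) f - f t\<bar> \<le> r / 2"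
      by (intro L2_inner_loc_window[OF t f] less_imp_le d(2)) auto
    with r show ?thesis
      by simp
  qed
  then show "\<exists>N. \<forall>n\<ge>N. norm (L2_inner \<beta> (loc_window t n) f - f t) < r"
    by blast
qed

lemma L2_inner_loc_window_fourier_bound:
  assumes "t \<in> {0..\<beta>}"
  shows "\<bar>L2_inner \<beta> (loc_window t n) (fourier_basis \<beta> k)\<bar> \<le> sqrt (2 / \<beta>)"
  using L2_inner_loc_window[OF assms fourier_basis_continuous, of n k 0 "sqrt (2 / \<beta>)"] fourier_basis_bound
  by simp

lemma L2_inner_loc_window_fourier:
  assumes "t \<in> {0..\<beta>}"
  shows "\<bar>L2_inner \<beta> (loc_window t n) (fourier_basis \<beta> k) - fourier_basis \<beta> k t\<bar>
    \<le> sqrt (2 / \<beta>) * (\<bar>freq \<beta> k\<bar> * inverse (real (Suc n)))"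
  by (rule L2_inner_loc_window[OF assms fourier_basis_continuous order_trans[OF fourier_basis_Lipschitz]])
     (use \<beta>_pos in \<open>auto intro!: mult_left_mono\<close>)

text \<open>The factors come from the mode bound in \<open>variance_form_increment\<close>:
  \<open>18 / \<beta>\<close> is 9 times the squared amplitude \<open>2 / \<beta>\<close> of the
  basis, \<open>(\<beta> / (2 * pi))\<^sup>2\<close> belongs to the eigenvalue, and
  \<open>sqrt (2 * pi / \<beta>)\<close> to the square root of the frequency. The final 1 makes the
  constant positive without evaluating the sum.\<close>

definition increment_const :: real where
  "increment_const = (18 / \<beta>) * (\<beta> / (2 * pi))\<^sup>2 * sqrt (2 * pi / \<beta>)
     * (\<Sum>\<^sub>\<infinity>k::int. \<bar>real_of_int k\<bar> powr - (3 / 2)) + 1"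

lemma increment_const_pos: "increment_const > 0"
  unfolding increment_const_def using \<beta>_pos
  by (intro add_nonneg_pos mult_nonneg_nonneg infsum_nonneg) auto

text \<open>Each mode of the difference is bounded both by its amplitude and by frequency times
  \<open>h\<close>, and \<open>min_square_le_sqrt\<close> combines the two. The bound is the same
  for all windows of half-width at most \<open>h\<close>, so it survives the passage to point
  evaluations. Order \<open>sqrt h\<close> suffices for chaining, since the tail bound takes its
  fourth power.\<close>

lemma variance_form_increment:
  assumes m: "m > 0" and st: "s \<in> {0..\<beta>}" "t \<in> {0..\<beta>}" and h: "h > 0" "\<bar>s - t\<bar> \<le> h"
    and n: "inverse (real (Suc n)) \<le> h"
  shows "variance_form m (\<lambda>u. loc_window s n u - loc_window t n u) \<le> increment_const * sqrt h / m"
proof -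
  let ?\<phi> = "\<lambda>u. loc_window s n u - loc_window t n u"
  let ?C = "(18 / \<beta>) * (\<beta> / (2 * pi))\<^sup>2 * sqrt (2 * pi / \<beta>) * sqrt h / m"
  have t\<phi>: "?\<phi> \<in> test_functions"
    by (intro test_diff loc_window_test)
  have mode: "eigenvalue m k * (L2_inner \<beta> ?\<phi> (fourier_basis \<beta> k))\<^sup>2 \<le> ?C * \<bar>real_of_int k\<bar> powr - (3 / 2)" for k
  proof -
    define y where "y = L2_inner \<beta> ?\<phi> (fourier_basis \<beta> k) / sqrt (2 / \<beta>)"
    have sp: "sqrt (2 / \<beta>) > 0"
      using \<beta>_pos by simp
    have in_eq: "L2_inner \<beta> ?\<phi> (fourier_basis \<beta> k) =
        L2_inner \<beta> (loc_window s n) (fourier_basis \<beta> k) - L2_inner \<beta> (loc_window t n) (fourier_basis \<beta> k)"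
      by (intro L2_inner_diff loc_window_test fourier_basis_continuous)
    have "\<bar>L2_inner \<beta> ?\<phi> (fourier_basis \<beta> k)\<bar> \<le> sqrt (2 / \<beta>) * 2"
      using L2_inner_loc_window_fourier_bound[OF st(1), of n k] L2_inner_loc_window_fourier_bound[OF st(2), of n k]
      unfolding in_eq by linarith
    then have y2: "\<bar>y\<bar> \<le> 2"
      using sp by (simp add: y_def pos_divide_le_eq mult.commute)
    \<comment> \<open>Triangle inequality through the values at the two centres: one window error at
      each and the increment of the basis function. Each is at most the amplitude times frequency
      times \<open>h\<close>, hence the 3 in \<open>min_square_le_sqrt\<close>.\<close>
    have "\<bar>L2_inner \<beta> ?\<phi> (fourier_basis \<beta> k)\<bar> \<le>
        sqrt (2 / \<beta>) * (\<bar>freq \<beta> k\<bar> * inverse (real (Suc n))) + sqrt (2 / \<beta>) * (\<bar>freq \<beta> k\<bar> * \<bar>s - t\<bar>) +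
        sqrt (2 / \<beta>) * (\<bar>freq \<beta> k\<bar> * inverse (real (Suc n)))"
      using L2_inner_loc_window_fourier[OF st(1), of n k] L2_inner_loc_window_fourier[OF st(2), of n k]
        fourier_basis_Lipschitz[of k s t]
      unfolding in_eq by linarith
    also have "\<dots> \<le> sqrt (2 / \<beta>) * (\<bar>freq \<beta> k\<bar> * h) + sqrt (2 / \<beta>) * (\<bar>freq \<beta> k\<bar> * h) + sqrt (2 / \<beta>) * (\<bar>freq \<beta> k\<bar> * h)"
      using h n sp by (intro add_mono mult_left_mono) auto
    also have "\<dots> = sqrt (2 / \<beta>) * (3 * (\<bar>freq \<beta> k\<bar> * h))"
      by simp
    finally have "\<bar>y\<bar> \<le> 3 * (\<bar>freq \<beta> k\<bar> * h)"
      using sp by (simp add: y_def pos_divide_le_eq mult.commute)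
    then have "\<bar>y\<bar>\<^sup>2 \<le> 9 * sqrt (\<bar>freq \<beta> k\<bar> * h)"
      using y2 h by (intro min_square_le_sqrt) auto
    moreover have "(L2_inner \<beta> ?\<phi> (fourier_basis \<beta> k))\<^sup>2 = (2 / \<beta>) * \<bar>y\<bar>\<^sup>2"
      using \<beta>_pos by (simp add: y_def power_divide)
    ultimately have sq: "(L2_inner \<beta> ?\<phi> (fourier_basis \<beta> k))\<^sup>2 \<le> (18 / \<beta>) * sqrt (\<bar>freq \<beta> k\<bar> * h)"
      using \<beta>_pos by (simp add: divide_right_mono)
    show ?thesis
    proof (cases "k = 0")
      \<comment> \<open>The constant mode has frequency 0, so \<open>sq\<close> already makes its
        coefficient vanish; \<open>eigenvalue_le\<close> covers the other modes.\<close>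
      case True
      then have "L2_inner \<beta> ?\<phi> (fourier_basis \<beta> k) = 0"
        using sq by (simp add: freq_def)
      with True show ?thesis
        by simp
    next
      case False
      define x where "x = \<bar>real_of_int k\<bar>"
      have x: "x > 0"
        using False by (simp add: x_def)
      have fk: "sqrt (\<bar>freq \<beta> k\<bar> * h) = sqrt (2 * pi / \<beta>) * sqrt h * x powr (1 / 2)"
        using \<beta>_pos x by (simp add: freq_def x_def abs_mult abs_divide powr_half_sqrt flip: real_sqrt_mult)
      have "eigenvalue m k * (L2_inner \<beta> ?\<phi> (fourier_basis \<beta> k))\<^sup>2 \<le>
          ((\<beta> / (2 * pi))\<^sup>2 / m * x powr - 2) * ((18 / \<beta>) * sqrt (\<bar>freq \<beta> k\<bar> * h))"
        using eigenvalue_le[OF m False] sq eigenvalue_pos[OF m] m \<beta>_pos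
        unfolding x_def by (intro mult_mono) (auto simp: less_imp_le)
      also have "\<dots> = ?C * (x powr - 2 * x powr (1 / 2))"
        unfolding fk by (simp add: mult_ac)
      also have "x powr - 2 * x powr (1 / 2) = x powr - (3 / 2)"
        by (simp flip: powr_add)
      finally show ?thesis
        by (simp add: x_def)
    qed
  qed
  have S: "(\<lambda>k::int. \<bar>real_of_int k\<bar> powr - (3 / 2)) summable_on UNIV"
    by (rule summable_on_int_powr) simp
  have "variance_form m ?\<phi> \<le> (\<Sum>\<^sub>\<infinity>k::int. ?C * \<bar>real_of_int k\<bar> powr - (3 / 2))"
    unfolding variance_form_def
    by (intro infsum_mono summable_variance_form m t\<phi> summable_on_cmult_right S mode)
  also have "\<dots> = ?C * (\<Sum>\<^sub>\<infinity>k::int. \<bar>real_of_int k\<bar> powr - (3 / 2))"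
    by (rule infsum_cmult_right')
  also have "\<dots> = (increment_const - 1) * sqrt h / m"
    by (simp add: increment_const_def)
  also have "\<dots> \<le> increment_const * sqrt h / m"
    using m h by (intro divide_right_mono mult_right_mono) auto
  finally show ?thesis .
qed

text \<open>A point is reached from \<open>0\<close> along its binary expansion.\<close>

lemma dyadic_chaining:
  fixes f :: "real \<Rightarrow> real"
  assumes f: "continuous_on {0..\<beta>} f" and \<theta>: "0 < \<theta>" "\<theta> < 1"
    and inc: "\<And>k i. i < 2 ^ k \<Longrightarrow> \<bar>f (real (Suc i) * \<beta> / 2 ^ k) - f (real i * \<beta> / 2 ^ k)\<bar> \<le> \<delta> * \<theta> ^ k"
    and t: "t \<in> {0..\<beta>}"
  shows "\<bar>f t - f 0\<bar> \<le> \<delta> / (1 - \<theta>)"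
proof -
  define x where "x = t / \<beta>"
  have x: "0 \<le> x" "x \<le> 1" "t = x * \<beta>"
    using t \<beta>_pos by (auto simp: x_def)
  define p where "p k = nat \<lfloor>2 ^ k * x\<rfloor>" for k
  have p: "real (p k) \<le> 2 ^ k * x" "2 ^ k * x < real (p k) + 1" for k
    using x(1) by (auto simp: p_def of_nat_nat)
  have p_le: "p k \<le> 2 ^ k" for k
  proof -
    have "2 ^ k * x \<le> 2 ^ k * 1"
      using x(2) by (intro mult_left_mono) auto
    then have "real (p k) \<le> real (2 ^ k)"
      using p(1)[of k] unfolding of_nat_power of_nat_numeral by linarith
    then show ?thesis
      by (simp only: of_nat_le_iff)
  qed
  define q where "q k = real (p k) * \<beta> / 2 ^ k" for k
  have \<delta>: "\<delta> \<ge> 0"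
    using inc[of 0 0] by (simp add: order_trans[OF abs_ge_zero])
  have step: "\<bar>f (q (Suc k)) - f (q k)\<bar> \<le> \<delta> * \<theta> ^ Suc k" for k
  proof -
    \<comment> \<open>The next level appends one binary digit, so the grid point stays or moves
      right by a single step of the finer grid.\<close>
    have a: "real (p (Suc k)) < real (2 * p k + 2)" "real (2 * p k) < real (p (Suc k) + 1)"
      using p[of k] p[of "Suc k"] by auto
    then have "p (Suc k) < 2 * p k + 2" "2 * p k < p (Suc k) + 1"
      by (simp_all only: of_nat_less_iff)
    then consider "p (Suc k) = 2 * p k" | "p (Suc k) = Suc (2 * p k)"
      by linarith
    then show ?thesis
    proof cases
      case 1
      then show ?thesis
        using \<delta> \<theta> by (simp add: q_def)
    next
      case 2
      then have "2 * p k < 2 ^ Suc k"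
        using p_le[of "Suc k"] by linarith
      from inc[OF this] show ?thesis
        using 2 by (simp add: q_def)
    qed
  qed
  have start: "\<bar>f (q 0) - f 0\<bar> \<le> \<delta>"
  proof -
    \<comment> \<open>The value 1 occurs only at t = \<beta>; the whole interval is then the single
      increment of level 0, bounded by \<delta>.\<close>
    have "p 0 = 0 \<or> p 0 = 1"
      using p_le[of 0] by auto
    then show ?thesis
      using inc[of 0 0] \<delta> by (auto simp: q_def)
  qed
  have bound: "\<bar>f (q k) - f 0\<bar> \<le> \<delta> * (\<Sum>i\<le>k. \<theta> ^ i)" for k
  proof (induction k)
    case 0
    then show ?case using start by simp
  next
    case (Suc k)
    have "\<bar>f (q (Suc k)) - f 0\<bar> \<le> \<delta> * (\<Sum>i\<le>k. \<theta> ^ i) + \<delta> * \<theta> ^ Suc k"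
      using Suc step[of k] by linarith
    then show ?case
      by (simp add: distrib_left)
  qed
  have bound': "\<bar>f (q k) - f 0\<bar> \<le> \<delta> / (1 - \<theta>)" for k
  proof -
    have "(\<Sum>i\<le>k. \<theta> ^ i) \<le> (\<Sum>i. \<theta> ^ i)"
      using \<theta> by (intro sum_le_suminf) (auto intro: summable_geometric)
    also have "\<dots> = 1 / (1 - \<theta>)"
      using \<theta> by (intro suminf_geometric) auto
    finally have "\<delta> * (\<Sum>i\<le>k. \<theta> ^ i) \<le> \<delta> * (1 / (1 - \<theta>))"
      using \<delta> by (intro mult_left_mono)
    with bound[of k] show ?thesis
      by simp
  qed
  have q: "0 \<le> q k" "q k \<le> t" "t - q k \<le> \<beta> * (1 / 2) ^ k" for k
  proof -
    show "0 \<le> q k"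
      using \<beta>_pos by (simp add: q_def)
    have "real (p k) * \<beta> \<le> 2 ^ k * x * \<beta>"
      using p(1)[of k] \<beta>_pos by (intro mult_right_mono) auto
    then show "q k \<le> t"
      by (simp add: q_def x(3) pos_divide_le_eq mult_ac)
    have "2 ^ k * x * \<beta> \<le> (real (p k) + 1) * \<beta>"
      using p(2)[of k] \<beta>_pos by (intro mult_right_mono) auto
    then have "x * \<beta> \<le> (real (p k) + 1) * \<beta> / 2 ^ k"
      by (simp add: pos_le_divide_eq mult_ac)
    then show "t - q k \<le> \<beta> * (1 / 2) ^ k"
      by (simp add: q_def x(3) power_one_over distrib_right add_divide_distrib)
  qed
  have "(\<lambda>k. \<beta> * (1 / 2) ^ k) \<longlonglongrightarrow> \<beta> * 0"
    by (intro tendsto_mult_left LIMSEQ_power_zero) auto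
  then have "(\<lambda>k. t - q k) \<longlonglongrightarrow> 0"
    using q by (intro tendsto_sandwich[of "\<lambda>_. 0" "\<lambda>k. t - q k" _ "\<lambda>k. \<beta> * (1 / 2) ^ k" 0]) auto
  then have "q \<longlonglongrightarrow> t"
    using tendsto_diff[OF tendsto_const[of t], of "\<lambda>k. t - q k" 0 sequentially] by simp
  then have "(\<lambda>k. f (q k)) \<longlonglongrightarrow> f t"
    using q t by (intro continuous_on_tendsto_compose[OF f]) (auto intro!: always_eventually intro: order_trans)
  then have "(\<lambda>k. \<bar>f (q k) - f 0\<bar>) \<longlonglongrightarrow> \<bar>f t - f 0\<bar>"
    by (intro tendsto_rabs tendsto_diff tendsto_const)
  then show ?thesis
    by (rule LIMSEQ_le_const2) (use bound' in auto)
qed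

text \<open>Written as a pairing with a constant test function, so that its law is an instance of
  \<open>distr_L2_inner\<close>.\<close>

definition loop_mean :: "(real \<Rightarrow> real) \<Rightarrow> real" where
  "loop_mean \<omega> = L2_inner \<beta> (\<lambda>_. 1 / \<beta>) \<omega>"

lemma loop_mean_diff_le:
  assumes "continuous_on {0..\<beta>} \<omega>" "\<And>t. t \<in> {0..\<beta>} \<Longrightarrow> \<bar>\<omega> t - x\<bar> \<le> \<epsilon>"
  shows "\<bar>loop_mean \<omega> - x\<bar> \<le> \<epsilon>"
proof -
  have "loop_mean \<omega> = L2_inner \<beta> (window 0 \<beta>) \<omega>"
    unfolding loop_mean_def L2_inner_def window_def
    by (intro set_lebesgue_integral_cong) auto
  then show ?thesis
    using L2_inner_window[OF _ \<beta>_pos _ assms] by simp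
qed

text \<open>The thresholds must be summable for the chaining, yet shrink slowly enough that a tail
  bound of order \<open>h\<^sup>2 / a ^ 8\<close>, with \<open>h = \<beta> / 2 ^ k\<close> and
  \<open>2 ^ k\<close> increments per level, can be summed. This asks for a ratio below 1 whose
  eighth power exceeds 1/2; 15/16 is such a ratio.\<close>

definition rough_loops :: "real \<Rightarrow> (real \<Rightarrow> real) set" where
  "rough_loops \<delta> = (\<Union>k. \<Union>i<2 ^ k. {\<omega> \<in> loops \<beta>.
     \<bar>\<omega> (real (Suc i) * \<beta> / 2 ^ k) - \<omega> (real i * \<beta> / 2 ^ k)\<bar> > \<delta> * (15 / 16) ^ k})"

lemma dyadic_point_in:
  assumes "i < 2 ^ k"
  shows "real i * \<beta> / 2 ^ k \<in> {0..\<beta>}" "real (Suc i) * \<beta> / 2 ^ k \<in> {0..\<beta>}"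
proof -
  have "real (Suc i) \<le> 2 ^ k"
    using assms by (metis Suc_leI of_nat_le_iff of_nat_numeral of_nat_power)
  moreover from this have "real i \<le> 2 ^ k"
    unfolding of_nat_Suc by linarith
  ultimately have "real i * \<beta> \<le> 2 ^ k * \<beta>" "real (Suc i) * \<beta> \<le> 2 ^ k * \<beta>"
    using \<beta>_pos by (intro mult_right_mono; simp)+
  then show "real i * \<beta> / 2 ^ k \<in> {0..\<beta>}" "real (Suc i) * \<beta> / 2 ^ k \<in> {0..\<beta>}"
    using \<beta>_pos by (auto simp: pos_divide_le_eq mult.commute)
qed

lemma increment_event_measurable:
  assumes "s \<in> {0..\<beta>}" "t \<in> {0..\<beta>}"
  shows "{\<omega> \<in> loops \<beta>. \<bar>\<omega> s - \<omega> t\<bar> > a} \<in> sets (loop_sigma \<beta>)"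
proof -
  note eval_measurable[OF assms(1), measurable] eval_measurable[OF assms(2), measurable]
  have "{\<omega> \<in> space (loop_sigma \<beta>). \<bar>\<omega> s - \<omega> t\<bar> > a} \<in> sets (loop_sigma \<beta>)"
    by measurable
  then show ?thesis
    by (simp add: space_loop_sigma)
qed

lemma rough_loops_measurable: "rough_loops \<delta> \<in> sets (loop_sigma \<beta>)"
  unfolding rough_loops_def
  by (intro sets.countable_UN image_subsetI sets.finite_UN increment_event_measurable dyadic_point_in)
     (simp_all del: of_nat_Suc)

text \<open>Chaining from time 0 gives \<open>16 * \<delta>\<close>, as 1 / (1 - 15/16) = 16. The
  mean is equally close to the value at 0, which doubles the bound.\<close>

lemma smooth_loop_near_mean:
  assumes "\<omega> \<in> loops \<beta>" "\<omega> \<notin> rough_loops \<delta>" "t \<in> {0..\<beta>}"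
  shows "\<bar>\<omega> t - loop_mean \<omega>\<bar> \<le> 32 * \<delta>"
proof -
  have c: "continuous_on {0..\<beta>} \<omega>"
    using assms(1) by (rule loop_continuous)
  have b: "\<bar>\<omega> u - \<omega> 0\<bar> \<le> 16 * \<delta>" if "u \<in> {0..\<beta>}" for u
    using dyadic_chaining[OF c, of "15 / 16" \<delta> u] assms(1,2) that by (force simp: rough_loops_def not_less)
  from loop_mean_diff_le[OF c b] b[OF assms(3)] show ?thesis
    by linarith
qed

text \<open>Collects the factors of \<open>increment_tail\<close>: the fourth power of
  \<open>16 * v\<close>, where v is proportional to \<open>increment_const\<close>, and the bound 2
  for the exponential moment.\<close>

definition tail_const :: real where
  "tail_const = 16 ^ 4 * increment_const ^ 4 * 2"

end

context gaussian_loop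
begin

text \<open>Markov's inequality with an exponential moment, weakened to a power. The fourth power
  turns a variance of order \<open>sqrt h / m\<close> into \<open>h\<^sup>2 / m ^ 4\<close>, and the
  square of \<open>h\<close> outweighs the \<open>2 ^ k\<close> increments of dyadic level
  k.\<close>

lemma increment_tail:
  assumes st: "s \<in> {0..\<beta>}" "t \<in> {0..\<beta>}" and h: "h > 0" "\<bar>s - t\<bar> \<le> h" and a: "a > 0"
  shows "emeasure \<gamma> {\<omega> \<in> loops \<beta>. \<bar>\<omega> s - \<omega> t\<bar> > a} \<le> ennreal (tail_const * h\<^sup>2 / (m ^ 4 * a ^ 8))"
proof -
  define v where "v = increment_const * sqrt h / m"
  have v: "v > 0"
    using increment_const_pos h m_pos by (simp add: v_def)
  obtain N where N: "inverse (real (Suc N)) < h"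
    using reals_Archimedean h(1) by blast
  have "eventually (\<lambda>n. variance_form m (\<lambda>u. loc_window s n u - loc_window t n u) \<le> v) sequentially"
    unfolding eventually_sequentially v_def
  proof (intro exI[of _ N] allI impI variance_form_increment m_pos st h)
    fix n assume "N \<le> n"
    then have "inverse (real (Suc n)) \<le> inverse (real (Suc N))"
      by (simp add: field_simps)
    with N show "inverse (real (Suc n)) \<le> h"
      by linarith
  qed
  then have I: "(\<integral>\<^sup>+\<omega>. ennreal (exp (1 / (4 * v) * (\<omega> s - \<omega> t)\<^sup>2)) \<partial>\<gamma>) \<le> ennreal (1 / sqrt (1 - 2 * (1 / (4 * v)) * v))"
    using v by (intro nn_integral_exp_square_limit[where \<phi>="\<lambda>n u. loc_window s n u - loc_window t n u"] test_diff loc_window_test)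
      (auto simp: L2_inner_diff[OF loc_window_test loc_window_test loop_continuous] intro!: tendsto_diff
        L2_inner_loc_window_tendsto st loop_continuous)
  \<comment> \<open>With the exponent \<open>1 / (4 * v)\<close> the moment bound is the square root
    of 2, rounded up.\<close>
  have "1 / sqrt (1 - 2 * (1 / (4 * v)) * v) \<le> 2"
    using v by (simp add: real_sqrt_divide real_le_lsqrt)
  with I have I: "(\<integral>\<^sup>+\<omega>. ennreal (exp (1 / (4 * v) * (\<omega> s - \<omega> t)\<^sup>2)) \<partial>\<gamma>) \<le> ennreal 2"
    by (meson ennreal_leI order_trans)
  define K where "K = (16 * v / a\<^sup>2) ^ 4"
  have K0: "K \<ge> 0" using v by (simp add: K_def)
  \<comment> \<open>Beyond \<open>a\<close> the exponential dominates a fourth power: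
    \<open>y \<le> exp y\<close> is applied to \<open>y = x\<^sup>2 / (16 * v)\<close> and raised to
    the power 4.\<close>
  have ind: "1 \<le> K * exp (1 / (4 * v) * x\<^sup>2)" if "\<bar>x\<bar> > a" for x
  proof -
    have "\<bar>a\<bar> \<le> \<bar>x\<bar>"
      using that a by simp
    then have le: "a\<^sup>2 \<le> x\<^sup>2"
      by (simp only: abs_le_square_iff)
    define y where "y = 1 / (4 * v) * x\<^sup>2 / 4"
    have "a\<^sup>2 / (16 * v) \<le> x\<^sup>2 / (16 * v)"
      using v le by (intro divide_right_mono) auto
    also have "\<dots> = y"
      by (simp add: y_def)
    also have "y \<le> exp y"
      using exp_ge_add_one_self[of y] by linarith
    finally have "(a\<^sup>2 / (16 * v)) ^ 4 \<le> exp y ^ 4"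
      using v by (intro power_mono) auto
    also have "exp y ^ 4 = exp (1 / (4 * v) * x\<^sup>2)"
      by (simp add: y_def flip: exp_of_nat_mult)
    finally have "K * (a\<^sup>2 / (16 * v)) ^ 4 \<le> K * exp (1 / (4 * v) * x\<^sup>2)"
      using K0 by (rule mult_left_mono)
    moreover have "K * (a\<^sup>2 / (16 * v)) ^ 4 = (16 * v / a\<^sup>2 * (a\<^sup>2 / (16 * v))) ^ 4"
      by (simp only: K_def power_mult_distrib)
    moreover have "16 * v / a\<^sup>2 * (a\<^sup>2 / (16 * v)) = 1"
      using v a by simp
    ultimately show ?thesis by simp
  qed
  note eval_measurable[OF st(1), measurable] eval_measurable[OF st(2), measurable]
  have A: "{\<omega> \<in> loops \<beta>. \<bar>\<omega> s - \<omega> t\<bar> > a} \<in> sets \<gamma>"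
    using increment_event_measurable[OF st] by (simp add: sets_\<gamma>)
  have "emeasure \<gamma> {\<omega> \<in> loops \<beta>. \<bar>\<omega> s - \<omega> t\<bar> > a} = (\<integral>\<^sup>+\<omega>. indicator {\<omega> \<in> loops \<beta>. \<bar>\<omega> s - \<omega> t\<bar> > a} \<omega> \<partial>\<gamma>)"
    using A by simp
  also have "\<dots> \<le> (\<integral>\<^sup>+\<omega>. ennreal K * ennreal (exp (1 / (4 * v) * (\<omega> s - \<omega> t)\<^sup>2)) \<partial>\<gamma>)"
    using ind K0
    by (intro nn_integral_mono) (auto simp: indicator_def ennreal_mult'[symmetric] simp flip: ennreal_1 intro!: ennreal_leI)
  also have "\<dots> = ennreal K * (\<integral>\<^sup>+\<omega>. ennreal (exp (1 / (4 * v) * (\<omega> s - \<omega> t)\<^sup>2)) \<partial>\<gamma>)"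
    by (rule nn_integral_cmult) measurable
  also have "\<dots> \<le> ennreal K * ennreal 2"
    by (intro mult_left_mono I) simp
  also have "\<dots> = ennreal (K * 2)"
    by (simp add: ennreal_mult K0)
  also have "K * 2 = tail_const * h\<^sup>2 / (m ^ 4 * a ^ 8)"
  proof -
    have "sqrt h ^ 4 = h\<^sup>2"
      using h by (simp add: power4_eq_xxxx power2_eq_square)
    moreover have "(a\<^sup>2) ^ 4 = a ^ 8"
      by (simp flip: power_mult)
    ultimately show ?thesis
      by (simp add: K_def v_def tail_const_def power_divide power_mult_distrib)
  qed
  finally show ?thesis .
qed

text \<open>Union bound over the levels and the \<open>2 ^ k\<close> increments of each. One
  increment costs \<open>C * (1 / 2) ^ k * r ^ k\<close>, hence level k costs
  \<open>C * r ^ k\<close>, and a geometric series remains.\<close>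

lemma rough_loops_emeasure:
  assumes "\<delta> > 0"
  shows "emeasure \<gamma> (rough_loops \<delta>) \<le> ennreal (8 * (tail_const * \<beta>\<^sup>2 / (m ^ 4 * \<delta> ^ 8)))"
proof -
  define C where "C = tail_const * \<beta>\<^sup>2 / (m ^ 4 * \<delta> ^ 8)"
  define w :: real where "w = (15 / 16) ^ 8"
  \<comment> \<open>Each level contributes 1/4 through the square of the length, divided by
    \<open>w\<close> through the eighth power of the threshold; this is half of \<open>r\<close>. As
    (15/16)^8 exceeds 1/2, \<open>r\<close> is below 1, and the 8 in the statement bounds
    \<open>1 / (1 - r)\<close>.\<close>
  define r where "r = 1 / (2 * w)"
  have r: "0 < r" "r < 1" "1 / (1 - r) \<le> 8"
    by (simp_all add: r_def w_def field_simps)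
  have C: "C \<ge> 0"
    using increment_const_pos m_pos assms by (simp add: C_def tail_const_def)
  let ?A = "\<lambda>k i. {\<omega> \<in> loops \<beta>. \<bar>\<omega> (real (Suc i) * \<beta> / 2 ^ k) - \<omega> (real i * \<beta> / 2 ^ k)\<bar> > \<delta> * (15 / 16) ^ k}"
  have A: "?A k i \<in> sets \<gamma>" if "i < 2 ^ k" for k i
    using that unfolding sets_\<gamma> by (intro increment_event_measurable dyadic_point_in)
  have one: "emeasure \<gamma> (?A k i) \<le> ennreal (C * (1 / 2) ^ k * r ^ k)" if "i < 2 ^ k" for k i
  proof -
    have d: "\<bar>real (Suc i) * \<beta> / 2 ^ k - real i * \<beta> / 2 ^ k\<bar> \<le> \<beta> / 2 ^ k"
      using \<beta>_pos by (simp add: diff_divide_distrib[symmetric] left_diff_distrib[symmetric])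
    have "emeasure \<gamma> (?A k i) \<le> ennreal (tail_const * (\<beta> / 2 ^ k)\<^sup>2 / (m ^ 4 * (\<delta> * (15 / 16) ^ k) ^ 8))"
      using \<beta>_pos assms that d by (intro increment_tail dyadic_point_in) auto
    also have "tail_const * (\<beta> / 2 ^ k)\<^sup>2 / (m ^ 4 * (\<delta> * (15 / 16) ^ k) ^ 8) = C * (1 / 2) ^ k * r ^ k"
    proof -
      have "((15 / 16 :: real) ^ k) ^ 8 = w ^ k"
        by (simp only: w_def power_mult[symmetric] mult.commute)
      then show ?thesis
        by (simp only: C_def r_def power_mult_distrib power_divide) (simp add: power2_eq_square)
    qed
    finally show ?thesis .
  qed
  have "emeasure \<gamma> (rough_loops \<delta>) \<le> (\<Sum>k. emeasure \<gamma> (\<Union>i<2 ^ k. ?A k i))"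
    unfolding rough_loops_def
    by (rule emeasure_subadditive_countably) (use A in \<open>auto intro!: sets.finite_UN\<close>)
  also have "\<dots> \<le> (\<Sum>k. ennreal (C * r ^ k))"
  proof (rule suminf_le)
    fix k
    have "emeasure \<gamma> (\<Union>i<2 ^ k. ?A k i) \<le> (\<Sum>i<2 ^ k. emeasure \<gamma> (?A k i))"
      using A by (intro emeasure_subadditive_finite) auto
    also have "\<dots> \<le> (\<Sum>i<(2::nat) ^ k. ennreal (C * (1 / 2) ^ k * r ^ k))"
      by (intro sum_mono one) auto
    also have "\<dots> = ennreal (C * r ^ k)"
      using C r by (simp add: ennreal_of_nat_eq_real_of_nat ennreal_mult'[symmetric] power_one_over)
    finally show "emeasure \<gamma> (\<Union>i<2 ^ k. ?A k i) \<le> ennreal (C * r ^ k)" .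
  qed auto
  also have "\<dots> = ennreal (\<Sum>k. C * r ^ k)"
    using C r by (intro suminf_ennreal2) (auto intro!: summable_mult summable_geometric)
  also have "(\<Sum>k. C * r ^ k) = C * (1 / (1 - r))"
    using r by (subst suminf_mult) (auto simp: suminf_geometric intro!: summable_geometric)
  also have "ennreal (C * (1 / (1 - r))) \<le> ennreal (C * 8)"
    using C r by (intro ennreal_leI mult_left_mono)
  finally show ?thesis
    by (simp add: C_def mult.commute)
qed

end

section \<open>Exponential moments of the square norm\<close>

context loop_space
begin

text \<open>Jensen's inequality from the tangent line: with c the mean of g, the bound
  \<open>exp c * (1 + (g t - c)) \<le> exp (g t)\<close> is integrated over the period.\<close>

lemma jensen_exp:
  fixes g :: "real \<Rightarrow> real"
  assumes g: "continuous_on {0..\<beta>} g"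
  shows "\<beta> * exp ((1 / \<beta>) * (LBINT t:{0..\<beta>}. g t)) \<le> (LBINT t:{0..\<beta>}. exp (g t))"
proof -
  define c where "c = (1 / \<beta>) * (LBINT t:{0..\<beta>}. g t)"
  have gi: "set_integrable lborel {0..\<beta>} g"
    using g by (rule borel_integrable_atLeastAtMost')
  have ci: "set_integrable lborel {0..\<beta>} (\<lambda>t. k)" for k :: real
    by (intro borel_integrable_atLeastAtMost' continuous_intros)
  have "\<beta> * exp c = exp c * ((LBINT t:{0..\<beta>}. 1 - c) + (LBINT t:{0..\<beta>}. g t))"
    using \<beta>_pos by (simp add: set_integral_const c_def algebra_simps)
  also have "\<dots> = (LBINT t:{0..\<beta>}. exp c * ((1 - c) + g t))"
    by (subst set_integral_mult_right, subst set_integral_add(2)[OF ci gi]) simp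
  also have "\<dots> \<le> (LBINT t:{0..\<beta>}. exp (g t))"
  proof (intro set_integral_mono borel_integrable_atLeastAtMost' continuous_intros g)
    fix t
    have "exp c * (1 + (g t - c)) \<le> exp c * exp (g t - c)"
      by (intro mult_left_mono exp_ge_add_one_self) auto
    also have "\<dots> = exp (g t)"
      by (simp flip: exp_add)
    finally show "exp c * ((1 - c) + g t) \<le> exp (g t)"
      by (simp add: algebra_simps)
  qed
  finally show ?thesis
    by (simp add: c_def)
qed

text \<open>Convexity of exp with weights \<open>1 / p\<close> and \<open>1 / q\<close>. It will
  separate the low modes of a loop from the rest whatever their dependence.\<close>

lemma exp_add_le:
  fixes p q x y :: real
  assumes "p > 0" "q > 0" "1 / p + 1 / q = 1"
  shows "exp (x + y) \<le> (1 / p) * exp (p * x) + (1 / q) * exp (q * y)"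
proof -
  have u: "1 - 1 / q = 1 / p"
    using assms(3) by linarith
  have "0 \<le> 1 / q" "1 / q \<le> 1"
    using assms(1,2) u by (simp, smt (verit) zero_less_divide_1_iff)
  then have "exp ((1 - 1 / q) * (p * x) + 1 / q * (q * y)) \<le> (1 - 1 / q) * exp (p * x) + 1 / q * exp (q * y)"
    using convex_onD[OF exp_convex, of "1 / q" "p * x" "q * y"] by simp
  moreover have "1 / p * (p * x) + 1 / q * (q * y) = x + y"
    using assms(1,2) by simp
  ultimately show ?thesis
    unfolding u by metis
qed

text \<open>Loops are \<open>undefined\<close> outside the period. Evaluation at the clamped time
  gives a function on the whole product of loops and the line, to which Tonelli's theorem
  applies.\<close>

definition clamp :: "real \<Rightarrow> real" where
  "clamp t = max 0 (min \<beta> t)"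

lemma clamp_in: "clamp t \<in> {0..\<beta>}"
  using \<beta>_pos by (auto simp: clamp_def)

lemma clamp_id: "t \<in> {0..\<beta>} \<Longrightarrow> clamp t = t"
  by (auto simp: clamp_def)

text \<open>By continuity of loops the map is the pointwise limit of evaluations at times rounded
  down to a grid; each approximation involves countably many times, at each of which evaluation is
  measurable.\<close>

lemma eval_jointly_measurable:
  "(\<lambda>p. fst p (clamp (snd p))) \<in> borel_measurable (loop_sigma \<beta> \<Otimes>\<^sub>M lborel)"
proof (rule borel_measurable_LIMSEQ_real)
  fix p assume "p \<in> space (loop_sigma \<beta> \<Otimes>\<^sub>M (lborel :: real measure))"
  then have p: "fst p \<in> loops \<beta>"
    by (auto simp: space_pair_measure space_loop_sigma)
  let ?r = "\<lambda>n. of_int \<lfloor>real (Suc n) * snd p\<rfloor> / real (Suc n)"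
  have "\<bar>?r n - snd p\<bar> \<le> inverse (real (Suc n))" for n
  proof -
    define a where "a = real (Suc n)"
    have a: "a > 0" by (simp add: a_def)
    have "of_int \<lfloor>a * snd p\<rfloor> / a \<le> a * snd p / a" "(a * snd p - 1) / a \<le> of_int \<lfloor>a * snd p\<rfloor> / a"
      using a by (intro divide_right_mono; linarith)+
    then show ?thesis
      using a unfolding a_def[symmetric] by (simp add: diff_divide_distrib inverse_eq_divide)
  qed
  then have "?r \<longlonglongrightarrow> snd p"
    by (rule tendsto_of_inverse_Suc)
  then have "(\<lambda>n. clamp (?r n)) \<longlonglongrightarrow> clamp (snd p)"
    unfolding clamp_def by (intro tendsto_intros)
  then show "(\<lambda>n. fst p (clamp (?r n))) \<longlonglongrightarrow> fst p (clamp (snd p))"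
    by (rule continuous_on_tendsto_compose[OF loop_continuous[OF p] _ clamp_in always_eventually]) (intro allI clamp_in)
next
  fix n :: nat
  show "(\<lambda>p. fst p (clamp (of_int \<lfloor>real (Suc n) * snd p\<rfloor> / real (Suc n)))) \<in> borel_measurable (loop_sigma \<beta> \<Otimes>\<^sub>M lborel)"
  proof (rule measurable_compose_countable[where f="\<lambda>i p. fst p (clamp (of_int i / real (Suc n)))" and g="\<lambda>p. \<lfloor>real (Suc n) * snd p\<rfloor>"])
    fix i :: int
    note eval_measurable[OF clamp_in, measurable]
    show "(\<lambda>p. fst p (clamp (of_int i / real (Suc n)))) \<in> borel_measurable (loop_sigma \<beta> \<Otimes>\<^sub>M lborel)"
      by measurable
  next
    show "(\<lambda>p. \<lfloor>real (Suc n) * snd p\<rfloor>) \<in> loop_sigma \<beta> \<Otimes>\<^sub>M lborel \<rightarrow>\<^sub>M count_space UNIV"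
      by measurable
  qed
qed

lemma L2_inner_loops_tendsto:
  assumes X: "\<And>n. X n \<in> loops \<beta>" "\<omega> \<in> loops \<beta>"
      "\<And>n t. t \<in> {0..\<beta>} \<Longrightarrow> \<bar>X n t - \<omega> t\<bar> \<le> inverse (real (Suc n))"
    and Y: "\<And>n. Y n \<in> loops \<beta>" "\<zeta> \<in> loops \<beta>"
      "\<And>n t. t \<in> {0..\<beta>} \<Longrightarrow> \<bar>Y n t - \<zeta> t\<bar> \<le> inverse (real (Suc n))"
  shows "(\<lambda>n. L2_inner \<beta> (X n) (Y n)) \<longlonglongrightarrow> L2_inner \<beta> \<omega> \<zeta>"
proof -
  obtain C where C: "C \<ge> 0" "\<And>t. t \<in> {0..\<beta>} \<Longrightarrow> \<bar>\<omega> t\<bar> \<le> C"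
    by (rule continuous_bounded[OF loop_continuous[OF X(2)]]) blast
  obtain D where D: "D \<ge> 0" "\<And>t. t \<in> {0..\<beta>} \<Longrightarrow> \<bar>\<zeta> t\<bar> \<le> D"
    by (rule continuous_bounded[OF loop_continuous[OF Y(2)]]) blast
  show ?thesis
    unfolding L2_inner_def
  proof (rule set_integral_tendsto[where B="(C + 1) * (D + 1)"])
    fix n t assume t: "t \<in> {0..\<beta>}"
    have "inverse (real (Suc n)) \<le> 1" by (simp add: field_simps)
    then have "\<bar>X n t\<bar> \<le> C + 1" "\<bar>Y n t\<bar> \<le> D + 1"
      using X(3)[OF t, of n] C(2)[OF t] Y(3)[OF t, of n] D(2)[OF t] by linarith+
    then show "\<bar>X n t * Y n t\<bar> \<le> (C + 1) * (D + 1)"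
      unfolding abs_mult by (intro mult_mono) (use C in auto)
  next
    fix t assume "t \<in> {0..\<beta>}"
    then show "(\<lambda>n. X n t * Y n t) \<longlonglongrightarrow> \<omega> t * \<zeta> t"
      by (intro tendsto_mult tendsto_of_inverse_Suc X(3) Y(3))
  qed (intro sbm_mult sbm_continuous loop_continuous X Y)+
qed

lemma L2_square_measurable: "(\<lambda>\<omega>. L2_inner \<beta> \<omega> \<omega>) \<in> borel_measurable (loop_sigma \<beta>)"
  by (intro borel_measurable_loop continuous_map_loopI L2_inner_loops_tendsto) auto

section \<open>Removing finitely many Fourier modes\<close>

definition residual :: "int set \<Rightarrow> (real \<Rightarrow> real) \<Rightarrow> real \<Rightarrow> real" where
  "residual A \<omega> t = \<omega> t - (\<Sum>n\<in>A. L2_inner \<beta> (fourier_basis \<beta> n) \<omega> * fourier_basis \<beta> n t)"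

lemma fourier_basis_test: "fourier_basis \<beta> n \<in> test_functions"
  by (intro test_continuous fourier_basis_continuous)

lemma residual_continuous: "\<omega> \<in> loops \<beta> \<Longrightarrow> continuous_on {0..\<beta>} (residual A \<omega>)"
  unfolding residual_def by (intro continuous_intros loop_continuous fourier_basis_continuous)

text \<open>Pythagoras: the residual is what orthogonal projection onto the modes in A leaves
  over.\<close>

lemma L2_inner_residual:
  assumes A: "finite A" and \<omega>: "\<omega> \<in> loops \<beta>"
  shows "L2_inner \<beta> \<omega> \<omega> =
    (\<Sum>n\<in>A. (L2_inner \<beta> (fourier_basis \<beta> n) \<omega>)\<^sup>2) + L2_inner \<beta> (residual A \<omega>) (residual A \<omega>)"
proof -
  define X where "X n = L2_inner \<beta> (fourier_basis \<beta> n) \<omega>" for n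
  define P where "P t = (\<Sum>n\<in>A. X n * fourier_basis \<beta> n t)" for t
  have c: "continuous_on {0..\<beta>} \<omega>" "continuous_on {0..\<beta>} P"
    unfolding P_def by (intro continuous_intros loop_continuous[OF \<omega>] fourier_basis_continuous)+
  have P\<omega>: "L2_inner \<beta> P \<omega> = (\<Sum>n\<in>A. (X n)\<^sup>2)"
    unfolding P_def using L2_inner_sum[OF A fourier_basis_test c(1), of X]
    by (simp add: X_def power2_eq_square)
  have "L2_inner \<beta> P (fourier_basis \<beta> k) = X k" if "k \<in> A" for k
    unfolding P_def using that
    by (subst L2_inner_sum[OF A fourier_basis_test fourier_basis_continuous])
       (simp add: fourier_basis_orthonormal if_distrib A sum.delta' cong: if_cong)
  then have PP: "L2_inner \<beta> P P = (\<Sum>n\<in>A. (X n)\<^sup>2)"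
    unfolding P_def[of, abs_def] using L2_inner_sum[OF A fourier_basis_test c(2), of X]
    by (simp add: P_def[abs_def] L2_inner_commute[of "fourier_basis \<beta> _"] power2_eq_square)
  have i: "set_integrable lborel {0..\<beta>} (\<lambda>t. \<omega> t * \<omega> t)" "set_integrable lborel {0..\<beta>} (\<lambda>t. P t * \<omega> t)"
     "set_integrable lborel {0..\<beta>} (\<lambda>t. P t * P t)"
    by (intro borel_integrable_atLeastAtMost' continuous_intros c)+
  have "L2_inner \<beta> (residual A \<omega>) (residual A \<omega>) = (LBINT t:{0..\<beta>}. \<omega> t * \<omega> t - (2 * (P t * \<omega> t) - P t * P t))"
    unfolding L2_inner_def residual_def P_def X_def
    by (intro set_lebesgue_integral_cong) (auto simp: algebra_simps)
  also have "\<dots> = L2_inner \<beta> \<omega> \<omega> - (2 * L2_inner \<beta> P \<omega> - L2_inner \<beta> P P)"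
    unfolding L2_inner_def using i by simp
  finally show ?thesis
    unfolding P\<omega> PP X_def by simp
qed

text \<open>Bounds the variance of \<open>residual A \<omega> t\<close> uniformly in t,
  \<open>2 / \<beta>\<close> being the bound on the squared basis functions.\<close>

definition tail_variance :: "real \<Rightarrow> int set \<Rightarrow> real" where
  "tail_variance m A = (2 / \<beta>) * (\<Sum>\<^sub>\<infinity>k\<in>-A. eigenvalue m k)"

lemma ex_small_tail_variance:
  assumes "m > 0" "\<epsilon> > 0"
  shows "\<exists>A. finite A \<and> tail_variance m A \<le> \<epsilon>"
proof -
  note S = summable_eigenvalue[OF assms(1)]
  obtain A where A: "finite A" "dist (sum (eigenvalue m) A) (infsum (eigenvalue m) UNIV) \<le> \<epsilon> * \<beta> / 2"
    using infsum_finite_approximation[OF S, of "\<epsilon> * \<beta> / 2"] assms \<beta>_pos by auto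
  have "infsum (eigenvalue m) (A \<union> -A) = infsum (eigenvalue m) A + infsum (eigenvalue m) (-A)"
    by (intro infsum_Un_disjoint summable_on_subset[OF S]) auto
  then have "infsum (eigenvalue m) (-A) \<le> \<epsilon> * \<beta> / 2"
    using A by (simp add: dist_real_def)
  then have "tail_variance m A \<le> (2 / \<beta>) * (\<epsilon> * \<beta> / 2)"
    unfolding tail_variance_def using \<beta>_pos by (intro mult_left_mono) auto
  with A(1) \<beta>_pos show ?thesis
    by auto
qed

text \<open>Lets a set of modes chosen for one mass serve all larger masses.\<close>

lemma tail_variance_antimono:
  assumes "0 < m" "m \<le> m'"
  shows "tail_variance m' A \<le> tail_variance m A"
  unfolding tail_variance_def using \<beta>_pos assms
  by (intro mult_left_mono infsum_mono summable_on_subset[OF summable_eigenvalue] eigenvalue_antimono) auto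

text \<open>The projection is moved from the loop to the test function: pairing with it is the
  window average of \<open>residual A \<omega>\<close>, so the residual at a time is a limit of
  pairings.\<close>

definition residual_window :: "int set \<Rightarrow> real \<Rightarrow> nat \<Rightarrow> real \<Rightarrow> real" where
  "residual_window A t n =
    (\<lambda>u. loc_window t n u - (\<Sum>k\<in>A. L2_inner \<beta> (loc_window t n) (fourier_basis \<beta> k) * fourier_basis \<beta> k u))"

lemma residual_window_test: "residual_window A t n \<in> test_functions"
  unfolding residual_window_def by (intro test_diff test_sum loc_window_test fourier_basis_test)

lemma L2_inner_residual_window:
  assumes "finite A" "continuous_on {0..\<beta>} f"
  shows "L2_inner \<beta> (residual_window A t n) f = L2_inner \<beta> (loc_window t n) f -
    (\<Sum>k\<in>A. L2_inner \<beta> (loc_window t n) (fourier_basis \<beta> k) * L2_inner \<beta> (fourier_basis \<beta> k) f)"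
  unfolding residual_window_def
  by (simp add: L2_inner_diff[OF loc_window_test test_sum[OF fourier_basis_test] assms(2)]
      L2_inner_sum[OF assms(1) fourier_basis_test assms(2)])

lemma residual_window_tendsto:
  assumes "finite A" "t \<in> {0..\<beta>}" "\<omega> \<in> loops \<beta>"
  shows "(\<lambda>n. L2_inner \<beta> (residual_window A t n) \<omega>) \<longlonglongrightarrow> residual A \<omega> t"
proof -
  have "(\<lambda>n. L2_inner \<beta> (loc_window t n) \<omega> -
    (\<Sum>k\<in>A. L2_inner \<beta> (loc_window t n) (fourier_basis \<beta> k) * L2_inner \<beta> (fourier_basis \<beta> k) \<omega>))
    \<longlonglongrightarrow> \<omega> t - (\<Sum>k\<in>A. fourier_basis \<beta> k t * L2_inner \<beta> (fourier_basis \<beta> k) \<omega>)"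
    by (intro tendsto_intros L2_inner_loc_window_tendsto assms loop_continuous fourier_basis_continuous)
  then show ?thesis
    by (simp add: L2_inner_residual_window[OF assms(1) loop_continuous[OF assms(3)]] residual_def mult.commute)
qed

text \<open>The modes in A are annihilated; on the others the coefficient is a window average of a
  basis function, hence at most \<open>sqrt (2 / \<beta>)\<close> in absolute value.\<close>

lemma variance_form_residual_window:
  assumes m: "m > 0" and A: "finite A" and t: "t \<in> {0..\<beta>}"
  shows "variance_form m (residual_window A t n) \<le> tail_variance m A"
proof -
  have z: "L2_inner \<beta> (residual_window A t n) (fourier_basis \<beta> k) =
      (if k \<in> A then 0 else L2_inner \<beta> (loc_window t n) (fourier_basis \<beta> k))" for k
    by (simp add: L2_inner_residual_window[OF A fourier_basis_continuous] fourier_basis_orthonormal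
        if_distrib A sum.delta cong: if_cong)
  have "variance_form m (residual_window A t n) =
      (\<Sum>\<^sub>\<infinity>k\<in>-A. eigenvalue m k * (L2_inner \<beta> (residual_window A t n) (fourier_basis \<beta> k))\<^sup>2)"
    unfolding variance_form_def by (rule infsum_cong_neutral) (auto simp: z)
  also have "\<dots> \<le> (\<Sum>\<^sub>\<infinity>k\<in>-A. (2 / \<beta>) * eigenvalue m k)"
  proof (intro infsum_mono summable_on_cmult_right)
    show "eigenvalue m summable_on - A"
      by (rule summable_on_subset[OF summable_eigenvalue[OF m]]) auto
    show "(\<lambda>k. eigenvalue m k * (L2_inner \<beta> (residual_window A t n) (fourier_basis \<beta> k))\<^sup>2) summable_on - A"
      by (rule summable_on_subset[OF summable_variance_form[OF m residual_window_test]]) auto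
    fix k assume "k \<in> - A"
    then have "\<bar>L2_inner \<beta> (residual_window A t n) (fourier_basis \<beta> k)\<bar>\<^sup>2 \<le> (sqrt (2 / \<beta>))\<^sup>2"
      using L2_inner_loc_window_fourier_bound[OF t, of n k] by (intro power_mono) (auto simp: z)
    then have "eigenvalue m k * (L2_inner \<beta> (residual_window A t n) (fourier_basis \<beta> k))\<^sup>2 \<le> eigenvalue m k * (2 / \<beta>)"
      using eigenvalue_pos[OF m, of k] \<beta>_pos by (intro mult_left_mono) auto
    then show "eigenvalue m k * (L2_inner \<beta> (residual_window A t n) (fourier_basis \<beta> k))\<^sup>2 \<le> (2 / \<beta>) * eigenvalue m k"
      by (simp add: mult.commute)
  qed
  also have "\<dots> = tail_variance m A"
    unfolding tail_variance_def by (rule infsum_cmult_right')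
  finally show ?thesis .
qed

end

context gaussian_loop
begin

text \<open>
  Integrating out auxiliary standard Gaussian variables \<open>T\<close> linearizes the squares:
  \<open>exp (a x\<^sup>2 / 2)\<close> is the mean of \<open>exp (sqrt a T x)\<close>.
\<close>

lemma nn_integral_exp_low_modes:
  assumes A: "finite A" and a: "0 \<le> a" "a < 1"
  shows "(\<integral>\<^sup>+\<omega>. ennreal (exp (a / 2 * (\<Sum>n\<in>A. (L2_inner \<beta> (fourier_basis \<beta> n) \<omega>)\<^sup>2))) \<partial>\<gamma>)
    \<le> ennreal ((1 / sqrt (1 - a)) ^ card A)"
proof -
  let ?N = "std_normal_distribution"
  let ?X = "\<lambda>n \<omega>. L2_inner \<beta> (fourier_basis \<beta> n) \<omega>"
  interpret N: real_distribution ?N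
    by (rule real_dist_normal_dist)
  interpret T: product_sigma_finite "\<lambda>_::int. ?N"
    by standard
  interpret \<gamma>: prob_space \<gamma>
    by (rule prob_space_\<gamma>)
  interpret PT: prob_space "PiM A (\<lambda>_. ?N)"
    by (intro prob_space_PiM N.prob_space_axioms)
  interpret PP: pair_sigma_finite \<gamma> "PiM A (\<lambda>_. ?N)"
    by standard
  note L2_inner_measurable[OF fourier_basis_test, measurable]
  have lin: "ennreal (exp (a / 2 * (\<Sum>n\<in>A. (x n)\<^sup>2))) =
      (\<integral>\<^sup>+T. ennreal (exp (\<Sum>n\<in>A. sqrt a * T n * x n)) \<partial>PiM A (\<lambda>_. ?N))" for x :: "int \<Rightarrow> real"
  proof -
    have "ennreal (exp (a / 2 * (\<Sum>n\<in>A. (x n)\<^sup>2))) = (\<Prod>n\<in>A. ennreal (exp ((sqrt a * x n)\<^sup>2 / 2)))"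
      using a by (simp add: prod_ennreal exp_sum[OF A, symmetric] sum_distrib_left power_mult_distrib)
    also have "\<dots> = (\<Prod>n\<in>A. \<integral>\<^sup>+t. ennreal (exp (sqrt a * x n * t)) \<partial>?N)"
      by (simp add: nn_integral_std_normal_exp)
    also have "\<dots> = (\<integral>\<^sup>+T. (\<Prod>n\<in>A. ennreal (exp (sqrt a * x n * T n))) \<partial>PiM A (\<lambda>_. ?N))"
      by (rule T.product_nn_integral_prod[symmetric, OF A]) simp
    also have "\<dots> = (\<integral>\<^sup>+T. ennreal (exp (\<Sum>n\<in>A. sqrt a * T n * x n)) \<partial>PiM A (\<lambda>_. ?N))"
      by (intro nn_integral_cong) (simp add: prod_ennreal exp_sum[OF A] mult_ac)
    finally show ?thesis .
  qed
  have "(\<integral>\<^sup>+\<omega>. ennreal (exp (a / 2 * (\<Sum>n\<in>A. (?X n \<omega>)\<^sup>2))) \<partial>\<gamma>) =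
      (\<integral>\<^sup>+\<omega>. \<integral>\<^sup>+T. ennreal (exp (\<Sum>n\<in>A. sqrt a * T n * ?X n \<omega>)) \<partial>PiM A (\<lambda>_. ?N) \<partial>\<gamma>)"
    by (simp only: lin)
  also have "\<dots> = (\<integral>\<^sup>+T. \<integral>\<^sup>+\<omega>. ennreal (exp (\<Sum>n\<in>A. sqrt a * T n * ?X n \<omega>)) \<partial>\<gamma> \<partial>PiM A (\<lambda>_. ?N))"
    by (rule PP.Fubini'[symmetric]) measurable
  \<comment> \<open>With T fixed, the integrand is the exponential of a single pairing with a
    trigonometric polynomial, whose variance is at most \<open>a\<close> times the sum of the
    squares of T, as no eigenvalue exceeds 1. The outer integral then factorizes.\<close>
  also have "\<dots> \<le> (\<integral>\<^sup>+T. (\<Prod>n\<in>A. ennreal (exp (a / 2 * (T n)\<^sup>2))) \<partial>PiM A (\<lambda>_. ?N))"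
  proof (rule nn_integral_mono)
    fix T :: "int \<Rightarrow> real"
    let ?\<phi> = "\<lambda>u. \<Sum>n\<in>A. (sqrt a * T n) * fourier_basis \<beta> n u"
    have t: "?\<phi> \<in> test_functions"
      by (intro test_sum fourier_basis_test)
    have k: "L2_inner \<beta> ?\<phi> (fourier_basis \<beta> k) = (if k \<in> A then sqrt a * T k else 0)" for k
      by (subst L2_inner_sum[OF A fourier_basis_test fourier_basis_continuous])
         (simp add: fourier_basis_orthonormal if_distrib A sum.delta' cong: if_cong)
    have "variance_form m ?\<phi> = (\<Sum>\<^sub>\<infinity>n\<in>A. eigenvalue m n * (sqrt a * T n)\<^sup>2)"
      unfolding variance_form_def by (rule infsum_cong_neutral) (auto simp: k)
    also have "\<dots> = (\<Sum>n\<in>A. eigenvalue m n * (sqrt a * T n)\<^sup>2)"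
      using A by simp
    also have "\<dots> \<le> (\<Sum>n\<in>A. 1 * (sqrt a * T n)\<^sup>2)"
      by (intro sum_mono mult_right_mono eigenvalue_le_1 m_pos) auto
    finally have v: "variance_form m ?\<phi> / 2 \<le> (\<Sum>n\<in>A. a / 2 * (T n)\<^sup>2)"
      using a by (simp add: power_mult_distrib flip: sum_divide_distrib)
    have "(\<integral>\<^sup>+\<omega>. ennreal (exp (\<Sum>n\<in>A. sqrt a * T n * ?X n \<omega>)) \<partial>\<gamma>) =
        (\<integral>\<^sup>+\<omega>. ennreal (exp (L2_inner \<beta> ?\<phi> \<omega>)) \<partial>\<gamma>)"
      by (intro nn_integral_cong)
         (simp add: L2_inner_sum[OF A fourier_basis_test loop_continuous] space_\<gamma>)
    also have "\<dots> = ennreal (exp (variance_form m ?\<phi> / 2))"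
      by (rule nn_integral_exp_L2_inner[OF t])
    also have "\<dots> \<le> ennreal (exp (\<Sum>n\<in>A. a / 2 * (T n)\<^sup>2))"
      using v by (intro ennreal_leI) simp
    also have "\<dots> = (\<Prod>n\<in>A. ennreal (exp (a / 2 * (T n)\<^sup>2)))"
      by (simp add: prod_ennreal exp_sum[OF A])
    finally show "(\<integral>\<^sup>+\<omega>. ennreal (exp (\<Sum>n\<in>A. sqrt a * T n * ?X n \<omega>)) \<partial>\<gamma>) \<le> (\<Prod>n\<in>A. ennreal (exp (a / 2 * (T n)\<^sup>2)))" .
  qed
  also have "\<dots> = (\<Prod>n\<in>A. \<integral>\<^sup>+t. ennreal (exp (a / 2 * t\<^sup>2)) \<partial>?N)"
    by (rule T.product_nn_integral_prod[OF A]) simp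
  also have "\<dots> = ennreal (1 / sqrt (1 - a)) ^ card A"
    using nn_integral_std_normal_exp_square[of "a / 2"] a by simp
  also have "\<dots> = ennreal ((1 / sqrt (1 - a)) ^ card A)"
    using a by (simp add: ennreal_power)
  finally show ?thesis .
qed

text \<open>Jensen over the period replaces the exponential of the integrated square by the time
  average of \<open>exp (s * \<beta> * (residual A \<omega> t)\<^sup>2)\<close>. After Tonelli only
  the variance at a single time matters, and enlarging A makes it as small as a large
  \<open>s\<close> demands.\<close>

lemma nn_integral_exp_residual:
  assumes A: "finite A" and s: "0 \<le> s" and v: "tail_variance m A \<le> v" "2 * (s * \<beta>) * v < 1"
  shows "(\<integral>\<^sup>+\<omega>. ennreal (exp (s * L2_inner \<beta> (residual A \<omega>) (residual A \<omega>))) \<partial>\<gamma>)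
    \<le> ennreal (1 / sqrt (1 - 2 * (s * \<beta>) * v))"
proof -
  let ?C = "1 / sqrt (1 - 2 * (s * \<beta>) * v)"
  let ?R = "\<lambda>\<omega> t. \<omega> (clamp t) - (\<Sum>n\<in>A. L2_inner \<beta> (fourier_basis \<beta> n) \<omega> * fourier_basis \<beta> n t)"
  interpret \<gamma>: prob_space \<gamma>
    by (rule prob_space_\<gamma>)
  interpret PP: pair_sigma_finite \<gamma> "lborel :: real measure"
    by standard
  note [measurable] = L2_inner_measurable[OF fourier_basis_test] borel_measurable_continuous_onI[OF fourier_basis_continuous]
    eval_jointly_measurable
  have RM: "(\<lambda>(\<omega>, t). ennreal (indicator {0..\<beta>} t * exp (s * \<beta> * (?R \<omega> t)\<^sup>2))) \<in> borel_measurable (\<gamma> \<Otimes>\<^sub>M lborel)"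
  proof -
    have "(\<lambda>p. ennreal (indicator {0..\<beta>} (snd p) * exp (s * \<beta> * (fst p (clamp (snd p)) - (\<Sum>n\<in>A. L2_inner \<beta> (fourier_basis \<beta> n) (fst p) * fourier_basis \<beta> n (snd p)))\<^sup>2))) \<in> borel_measurable (loop_sigma \<beta> \<Otimes>\<^sub>M lborel)"
      by measurable
    then show ?thesis
      by (simp add: case_prod_unfold cong: measurable_cong_sets sets_pair_measure_cong[OF sets_\<gamma> refl])
  qed
  have "(\<integral>\<^sup>+\<omega>. ennreal (exp (s * L2_inner \<beta> (residual A \<omega>) (residual A \<omega>))) \<partial>\<gamma>) \<le>
     (\<integral>\<^sup>+\<omega>. \<integral>\<^sup>+t. ennreal (1 / \<beta>) * ennreal (indicator {0..\<beta>} t * exp (s * \<beta> * (?R \<omega> t)\<^sup>2)) \<partial>lborel \<partial>\<gamma>)"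
  proof (rule nn_integral_mono)
    fix \<omega> assume "\<omega> \<in> space \<gamma>"
    then have \<omega>: "\<omega> \<in> loops \<beta>" by (simp add: space_\<gamma>)
    note c = residual_continuous[OF \<omega>, of A]
    have c': "continuous_on {0..\<beta>} (\<lambda>t. exp (s * \<beta> * (residual A \<omega> t)\<^sup>2))"
      by (intro continuous_intros c)
    have "\<beta> * exp (s * L2_inner \<beta> (residual A \<omega>) (residual A \<omega>)) \<le> (LBINT t:{0..\<beta>}. exp (s * \<beta> * (residual A \<omega> t)\<^sup>2))"
      using jensen_exp[of "\<lambda>t. s * \<beta> * (residual A \<omega> t)\<^sup>2"] \<beta>_pos
      by (simp add: L2_inner_def power2_eq_square continuous_intros c)
    then have "exp (s * L2_inner \<beta> (residual A \<omega>) (residual A \<omega>)) \<le> (1 / \<beta>) * (LBINT t:{0..\<beta>}. exp (s * \<beta> * (residual A \<omega> t)\<^sup>2))"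
      using \<beta>_pos by (simp add: pos_le_divide_eq mult.commute)
    then have "ennreal (exp (s * L2_inner \<beta> (residual A \<omega>) (residual A \<omega>))) \<le> ennreal (1 / \<beta>) * ennreal (LBINT t:{0..\<beta>}. exp (s * \<beta> * (residual A \<omega> t)\<^sup>2))"
      using \<beta>_pos by (simp add: ennreal_leI flip: ennreal_mult')
    also have "ennreal (LBINT t:{0..\<beta>}. exp (s * \<beta> * (residual A \<omega> t)\<^sup>2)) = (\<integral>\<^sup>+t. ennreal (indicator {0..\<beta>} t * exp (s * \<beta> * (residual A \<omega> t)\<^sup>2)) \<partial>lborel)"
      unfolding set_lebesgue_integral_def
      using borel_integrable_atLeastAtMost'[OF c'] by (subst nn_integral_eq_integral) (simp_all add: set_integrable_def)
    also have "ennreal (1 / \<beta>) * \<dots> = (\<integral>\<^sup>+t. ennreal (1 / \<beta>) * ennreal (indicator {0..\<beta>} t * exp (s * \<beta> * (residual A \<omega> t)\<^sup>2)) \<partial>lborel)"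
      using borel_integrable_atLeastAtMost'[OF c'] by (subst nn_integral_cmult) (simp_all add: set_integrable_def)
    also have "\<dots> = (\<integral>\<^sup>+t. ennreal (1 / \<beta>) * ennreal (indicator {0..\<beta>} t * exp (s * \<beta> * (?R \<omega> t)\<^sup>2)) \<partial>lborel)"
      by (intro nn_integral_cong) (auto simp: indicator_def residual_def clamp_id)
    finally show "ennreal (exp (s * L2_inner \<beta> (residual A \<omega>) (residual A \<omega>))) \<le> \<dots>" .
  qed
  also have "\<dots> = (\<integral>\<^sup>+t. \<integral>\<^sup>+\<omega>. ennreal (1 / \<beta>) * ennreal (indicator {0..\<beta>} t * exp (s * \<beta> * (?R \<omega> t)\<^sup>2)) \<partial>\<gamma> \<partial>lborel)"
    using RM by (intro PP.Fubini'[symmetric]) (simp add: case_prod_unfold)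
  also have "\<dots> \<le> (\<integral>\<^sup>+t. ennreal (1 / \<beta> * ?C) * indicator {0..\<beta>} t \<partial>lborel)"
  proof (rule nn_integral_mono)
    fix t
    have C: "ennreal (1 / \<beta> * ?C) = ennreal (1 / \<beta>) * ennreal ?C"
      using \<beta>_pos by (intro ennreal_mult') simp
    show "(\<integral>\<^sup>+\<omega>. ennreal (1 / \<beta>) * ennreal (indicator {0..\<beta>} t * exp (s * \<beta> * (?R \<omega> t)\<^sup>2)) \<partial>\<gamma>) \<le> ennreal (1 / \<beta> * ?C) * indicator {0..\<beta>} t"
    proof (cases "t \<in> {0..\<beta>}")
      case True
      have "(\<integral>\<^sup>+\<omega>. ennreal (exp (s * \<beta> * (residual A \<omega> t)\<^sup>2)) \<partial>\<gamma>) \<le> ennreal ?C"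
        using s \<beta>_pos v residual_window_tendsto[OF A True]
          order_trans[OF variance_form_residual_window[OF m_pos A True] v(1)]
        by (intro nn_integral_exp_square_limit[of "residual_window A t"] residual_window_test) auto
      moreover have "(\<integral>\<^sup>+\<omega>. ennreal (1 / \<beta>) * ennreal (indicator {0..\<beta>} t * exp (s * \<beta> * (?R \<omega> t)\<^sup>2)) \<partial>\<gamma>) = ennreal (1 / \<beta>) * (\<integral>\<^sup>+\<omega>. ennreal (exp (s * \<beta> * (residual A \<omega> t)\<^sup>2)) \<partial>\<gamma>)"
      proof -
        note [measurable] = eval_measurable[OF True]
        show ?thesis
          using True by (subst nn_integral_cmult[symmetric]) (simp_all add: residual_def clamp_id)
      qed
      ultimately show ?thesis
        using True C by (simp only: C) (simp add: mult_left_mono)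
    qed simp
  qed
  also have "\<dots> = ennreal ?C"
    using \<beta>_pos v s by (simp add: nn_integral_cmult flip: ennreal_mult'')
  finally show ?thesis .
qed

end

text \<open>Finitely many low modes tolerate every exponent below 1; the residual tolerates any
  exponent once enough modes are removed. \<open>exp_add_le\<close> joins the two estimates, and
  monotonicity in the mass makes one choice of A serve every \<open>m \<ge> m0\<close>.\<close>

lemma (in loop_space) exp_moment_bound:
  assumes \<alpha>: "0 \<le> \<alpha>" "\<alpha> < 1" and m0: "m0 > 0"
  shows "\<exists>K. \<forall>m \<gamma>. m0 \<le> m \<longrightarrow> quantum_reference \<beta> m \<gamma> \<longrightarrow>
    (\<integral>\<^sup>+\<omega>. ennreal (exp (\<alpha> / 2 * L2_inner \<beta> \<omega> \<omega>)) \<partial>\<gamma>) \<le> ennreal K"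
proof -
  \<comment> \<open>Chosen so that \<open>p > 1\<close> while
    \<open>p * \<alpha> = 2 * \<alpha> / (1 + \<alpha>)\<close> stays below 1; \<open>q\<close> is
    the conjugate exponent.\<close>
  define p where "p = 2 / (1 + \<alpha>)"
  define q where "q = 2 / (1 - \<alpha>)"
  have pq: "p > 0" "q > 0" "1 / p + 1 / q = 1"
    using \<alpha> by (simp_all add: p_def q_def field_simps)
  have pa: "0 \<le> p * \<alpha>" "p * \<alpha> < 1"
    using \<alpha> by (simp_all add: p_def field_simps)
  define s where "s = q * \<alpha> / 2"
  have s: "s \<ge> 0"
    using pq \<alpha> by (simp add: s_def)
  \<comment> \<open>Makes \<open>2 * (s * \<beta>) * v\<close> less than 1/2; the added 1 covers
    \<open>s = 0\<close>, which occurs for \<alpha> = 0.\<close>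
  define v where "v = 1 / (4 * (s * \<beta> + 1))"
  have v: "v > 0" "2 * (s * \<beta>) * v < 1"
    using s \<beta>_pos by (simp_all add: v_def field_simps add_pos_nonneg)
  obtain A where A: "finite A" "tail_variance m0 A \<le> v"
    using ex_small_tail_variance[OF m0 v(1)] by blast
  define K1 where "K1 = (1 / sqrt (1 - p * \<alpha>)) ^ card A"
  define K2 where "K2 = 1 / sqrt (1 - 2 * (s * \<beta>) * v)"
  have K0: "K1 \<ge> 0" "K2 \<ge> 0"
    using pa v by (simp_all add: K1_def K2_def)
  have "(\<integral>\<^sup>+\<omega>. ennreal (exp (\<alpha> / 2 * L2_inner \<beta> \<omega> \<omega>)) \<partial>\<gamma>) \<le> ennreal (1 / p * K1 + 1 / q * K2)"
    if m: "m0 \<le> m" and ref: "quantum_reference \<beta> m \<gamma>" for m \<gamma>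
  proof -
    interpret gaussian_loop \<beta> m \<gamma>
      using m m0 ref by unfold_locales auto
    let ?L = "\<lambda>\<omega>. \<Sum>n\<in>A. (L2_inner \<beta> (fourier_basis \<beta> n) \<omega>)\<^sup>2"
    let ?R = "\<lambda>\<omega>. L2_inner \<beta> (residual A \<omega>) (residual A \<omega>)"
    note [measurable] = L2_inner_measurable[OF fourier_basis_test]
    have LM: "(\<lambda>\<omega>. ennreal (1 / p) * ennreal (exp (p * \<alpha> / 2 * ?L \<omega>))) \<in> borel_measurable \<gamma>"
      by measurable
    have "(\<integral>\<^sup>+\<omega>. ennreal (exp (\<alpha> / 2 * L2_inner \<beta> \<omega> \<omega>)) \<partial>\<gamma>) \<le>
      (\<integral>\<^sup>+\<omega>. ennreal (1 / p) * ennreal (exp (p * \<alpha> / 2 * ?L \<omega>)) + ennreal (1 / q) * ennreal (exp (s * ?R \<omega>)) \<partial>\<gamma>)"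
    proof (rule nn_integral_mono)
      fix \<omega> assume "\<omega> \<in> space \<gamma>"
      then have \<omega>: "\<omega> \<in> loops \<beta>"
        by (simp add: space_\<gamma>)
      have "exp (\<alpha> / 2 * L2_inner \<beta> \<omega> \<omega>) \<le> (1 / p) * exp (p * \<alpha> / 2 * ?L \<omega>) + (1 / q) * exp (s * ?R \<omega>)"
        using exp_add_le[OF pq, of "\<alpha> / 2 * ?L \<omega>" "\<alpha> / 2 * ?R \<omega>"]
        by (simp add: L2_inner_residual[OF A(1) \<omega>] s_def distrib_left mult.assoc)
      then show "ennreal (exp (\<alpha> / 2 * L2_inner \<beta> \<omega> \<omega>)) \<le>
          ennreal (1 / p) * ennreal (exp (p * \<alpha> / 2 * ?L \<omega>)) + ennreal (1 / q) * ennreal (exp (s * ?R \<omega>))"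
        using pq by (simp add: ennreal_leI flip: ennreal_mult' ennreal_plus)
    qed
    also have "\<dots> = ennreal (1 / p) * (\<integral>\<^sup>+\<omega>. ennreal (exp (p * \<alpha> / 2 * ?L \<omega>)) \<partial>\<gamma>)
        + ennreal (1 / q) * (\<integral>\<^sup>+\<omega>. ennreal (exp (s * ?R \<omega>)) \<partial>\<gamma>)"
    proof -
      \<comment> \<open>By \<open>L2_inner_residual\<close> the squared norm of the residual is a
        difference of two measurable functions.\<close>
      have RM: "(\<lambda>\<omega>. ennreal (1 / q) * ennreal (exp (s * ?R \<omega>))) \<in> borel_measurable \<gamma>"
      proof (subst measurable_cong)
        fix \<omega> assume "\<omega> \<in> space \<gamma>"
        then show "ennreal (1 / q) * ennreal (exp (s * ?R \<omega>)) = ennreal (1 / q) * ennreal (exp (s * (L2_inner \<beta> \<omega> \<omega> - ?L \<omega>)))"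
          by (simp add: space_\<gamma> L2_inner_residual[OF A(1)])
      next
        note [measurable] = L2_square_measurable
        show "(\<lambda>\<omega>. ennreal (1 / q) * ennreal (exp (s * (L2_inner \<beta> \<omega> \<omega> - ?L \<omega>)))) \<in> borel_measurable \<gamma>"
          by measurable
      qed
      have "f \<in> borel_measurable \<gamma>" if "(\<lambda>\<omega>. ennreal (1 / q) * f \<omega>) \<in> borel_measurable \<gamma>" for f
      proof -
        have "(\<lambda>\<omega>. ennreal q * (ennreal (1 / q) * f \<omega>)) \<in> borel_measurable \<gamma>"
          using that by measurable
        then show ?thesis
          using pq by (simp flip: mult.assoc ennreal_mult')
      qed
      from this[OF RM] show ?thesis
        by (subst nn_integral_add[OF LM RM]) (simp add: nn_integral_cmult)
    qed
    also have "\<dots> \<le> ennreal (1 / p) * ennreal K1 + ennreal (1 / q) * ennreal K2"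
    proof (intro add_mono mult_left_mono)
      show "(\<integral>\<^sup>+\<omega>. ennreal (exp (p * \<alpha> / 2 * ?L \<omega>)) \<partial>\<gamma>) \<le> ennreal K1"
        unfolding K1_def by (rule nn_integral_exp_low_modes[OF A(1) pa])
      show "(\<integral>\<^sup>+\<omega>. ennreal (exp (s * ?R \<omega>)) \<partial>\<gamma>) \<le> ennreal K2"
        unfolding K2_def
        by (rule nn_integral_exp_residual[OF A(1) s order_trans[OF tail_variance_antimono[OF m0 m] A(2)] v(2)])
    qed auto
    also have "\<dots> = ennreal (1 / p * K1 + 1 / q * K2)"
      using pq K0 by (simp flip: ennreal_mult' ennreal_plus)
    finally show ?thesis .
  qed
  then show ?thesis
    by blast
qed

section \<open>The energy\<close>

text \<open>The lattice enters only through the finiteness of each set of neighbours and the bound c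
  on the row sums, so the index type is left arbitrary.\<close>

locale interaction = loop_space +
  fixes J :: "'k \<Rightarrow> 'k \<Rightarrow> real" and U :: "'k \<Rightarrow> real \<Rightarrow> real"
    and c c' b :: real and \<Lambda> :: "'k set"
  assumes J_sym: "J j k = J k j"
    and J_finite: "finite {k. J j k \<noteq> 0}"
    and J_sum: "(\<Sum>\<^sub>\<infinity>k. \<bar>J j k\<bar>) \<le> c"
    and U_cont: "continuous_on UNIV (U k)"
    and U_bound: "U k x \<ge> (1 / 2) * c' * x\<^sup>2 + b"
    and \<Lambda>_fin: "finite \<Lambda>"
begin

text \<open>Only finitely many boundary sites interact with a given site, so limits and estimates
  can be taken term by term.\<close>

lemma energy_eq:
  "energy \<beta> J U \<Lambda> \<omega> \<zeta> =
     (\<Sum>j\<in>\<Lambda>. LBINT \<tau>:{0..\<beta>}. U j (\<omega> j \<tau>))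
     + (1 / 2) * (\<Sum>j\<in>\<Lambda>. \<Sum>k\<in>\<Lambda>. J j k * L2_inner \<beta> (\<omega> j) (\<omega> k))
     + (\<Sum>j\<in>\<Lambda>. \<Sum>k\<in>{k. J j k \<noteq> 0} - \<Lambda>. J j k * L2_inner \<beta> (\<omega> j) (\<zeta> k))"
proof -
  have "(\<Sum>\<^sub>\<infinity>k\<in>-\<Lambda>. J j k * L2_inner \<beta> (\<omega> j) (\<zeta> k)) =
      (\<Sum>k\<in>{k. J j k \<noteq> 0} - \<Lambda>. J j k * L2_inner \<beta> (\<omega> j) (\<zeta> k))" for j
  proof -
    have "(\<Sum>\<^sub>\<infinity>k\<in>-\<Lambda>. J j k * L2_inner \<beta> (\<omega> j) (\<zeta> k)) =
        (\<Sum>\<^sub>\<infinity>k\<in>{k. J j k \<noteq> 0} - \<Lambda>. J j k * L2_inner \<beta> (\<omega> j) (\<zeta> k))"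
      by (rule infsum_cong_neutral) auto
    then show ?thesis
      using J_finite[of j] by simp
  qed
  then show ?thesis
    by (simp add: energy_def L2_inner_def)
qed

lemma sum_abs_J_le: "finite A \<Longrightarrow> (\<Sum>k\<in>A. \<bar>J j k\<bar>) \<le> c"
proof -
  assume "finite A"
  have "(\<lambda>k. \<bar>J j k\<bar>) summable_on {k. J j k \<noteq> 0}"
    using J_finite by simp
  then have "(\<lambda>k. \<bar>J j k\<bar>) summable_on UNIV"
    by (rule summable_on_cong_neutral[THEN iffD1, rotated -1]) auto
  then have "(\<Sum>k\<in>A. \<bar>J j k\<bar>) \<le> (\<Sum>\<^sub>\<infinity>k. \<bar>J j k\<bar>)"
    using \<open>finite A\<close> by (intro finite_sum_le_infsum) auto
  with J_sum[of j] show ?thesis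
    by linarith
qed

lemma c_nonneg: "c \<ge> 0"
  using sum_abs_J_le[of "{}"] by simp

text \<open>Uniformly convergent loops stay in one compact interval, on which the continuous
  function \<open>U j\<close> is bounded; dominated convergence applies.\<close>

lemma potential_tendsto:
  assumes X: "\<And>n. X n \<in> loops \<beta>" "\<omega> \<in> loops \<beta>"
      "\<And>n t. t \<in> {0..\<beta>} \<Longrightarrow> \<bar>X n t - \<omega> t\<bar> \<le> inverse (real (Suc n))"
  shows "(\<lambda>n. LBINT \<tau>:{0..\<beta>}. U j (X n \<tau>)) \<longlonglongrightarrow> (LBINT \<tau>:{0..\<beta>}. U j (\<omega> \<tau>))"
proof -
  obtain C where C: "C \<ge> 0" "\<And>t. t \<in> {0..\<beta>} \<Longrightarrow> \<bar>\<omega> t\<bar> \<le> C"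
    by (rule continuous_bounded[OF loop_continuous[OF X(2)]]) blast
  have "bounded (U j ` {- (C + 1)..C + 1})"
    by (intro compact_imp_bounded compact_continuous_image continuous_on_subset[OF U_cont]) auto
  then obtain B where B: "\<And>x. x \<in> {- (C + 1)..C + 1} \<Longrightarrow> \<bar>U j x\<bar> \<le> B"
    unfolding bounded_iff by auto (metis atLeastAtMost_iff diff_conv_add_uminus minus_add_distrib)
  have cont: "continuous_on {0..\<beta>} (\<lambda>t. U j (\<omega> t))" if "\<omega> \<in> loops \<beta>" for \<omega>
    by (rule continuous_on_compose2[OF U_cont loop_continuous[OF that]]) auto
  show ?thesis
  proof (rule set_integral_tendsto[where B=B])
    fix n t assume t: "t \<in> {0..\<beta>}"
    have "inverse (real (Suc n)) \<le> 1" by (simp add: field_simps)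
    then have "\<bar>X n t\<bar> \<le> C + 1"
      using X(3)[OF t, of n] C(2)[OF t] by linarith
    then show "\<bar>U j (X n t)\<bar> \<le> B"
      by (intro B) auto
  next
    fix t assume t: "t \<in> {0..\<beta>}"
    have "(\<lambda>n. X n t) \<longlonglongrightarrow> \<omega> t"
      by (intro tendsto_of_inverse_Suc X(3)[OF t])
    then show "(\<lambda>n. U j (X n t)) \<longlonglongrightarrow> U j (\<omega> t)"
      by (rule continuous_on_tendsto_compose[OF U_cont]) auto
  qed (intro sbm_continuous cont X)+
qed

lemma energy_continuous:
  assumes \<zeta>: "\<zeta> \<in> configs \<beta> UNIV"
  shows "continuous_map (config_topology \<beta> \<Lambda>) euclideanreal (\<lambda>\<omega>. energy \<beta> J U \<Lambda> \<omega> \<zeta>)"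
proof (rule continuous_map_configI[OF \<Lambda>_fin])
  fix X \<omega>
  assume X: "\<And>n. X n \<in> configs \<beta> \<Lambda>" "\<omega> \<in> configs \<beta> \<Lambda>"
     "\<And>n j t. j \<in> \<Lambda> \<Longrightarrow> t \<in> {0..\<beta>} \<Longrightarrow> \<bar>X n j t - \<omega> j t\<bar> \<le> inverse (real (Suc n))"
  have \<zeta>k: "\<zeta> k \<in> loops \<beta>" for k
    using \<zeta> by (rule config_mem) simp
  show "(\<lambda>n. energy \<beta> J U \<Lambda> (X n) \<zeta>) \<longlonglongrightarrow> energy \<beta> J U \<Lambda> \<omega> \<zeta>"
    unfolding energy_eq
    by (intro tendsto_add tendsto_sum tendsto_mult_left potential_tendsto L2_inner_loops_tendsto
        config_mem[OF X(1)] config_mem[OF X(2)] X(3) \<zeta>k) auto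
qed

lemma abs_L2_inner_le:
  assumes "continuous_on {0..\<beta>} f" "continuous_on {0..\<beta>} g" "\<epsilon> > 0"
  shows "\<bar>L2_inner \<beta> f g\<bar> \<le> \<epsilon> / 2 * L2_inner \<beta> f f + 1 / (2 * \<epsilon>) * L2_inner \<beta> g g"
proof -
  have i: "set_integrable lborel {0..\<beta>} (\<lambda>t. f t * g t)" "set_integrable lborel {0..\<beta>} (\<lambda>t. f t * f t)"
    "set_integrable lborel {0..\<beta>} (\<lambda>t. g t * g t)"
    by (intro borel_integrable_atLeastAtMost' continuous_intros assms)+
  have y: "\<bar>x * y\<bar> \<le> \<epsilon> / 2 * (x * x) + 1 / (2 * \<epsilon>) * (y * y)" for x y :: real
  proof -
    have "0 \<le> (\<epsilon> * \<bar>x\<bar> - \<bar>y\<bar>)\<^sup>2 / (2 * \<epsilon>)"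
      using assms(3) by simp
    also have "\<dots> = \<epsilon> / 2 * (x * x) + 1 / (2 * \<epsilon>) * (y * y) - \<bar>x * y\<bar>"
      using assms(3) by (simp add: power2_diff power_mult_distrib abs_mult field_simps power2_eq_square)
    finally show ?thesis by simp
  qed
  have "\<bar>L2_inner \<beta> f g\<bar> \<le> (LBINT t:{0..\<beta>}. \<bar>f t * g t\<bar>)"
    unfolding L2_inner_def using set_integral_norm_bound[OF i(1)] by simp
  also have "\<dots> \<le> (LBINT t:{0..\<beta>}. \<epsilon> / 2 * (f t * f t) + 1 / (2 * \<epsilon>) * (g t * g t))"
    by (intro set_integral_mono set_integrable_abs i set_integral_add set_integrable_mult_right y)
  also have "\<dots> = \<epsilon> / 2 * L2_inner \<beta> f f + 1 / (2 * \<epsilon>) * L2_inner \<beta> g g"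
    unfolding L2_inner_def using i by (subst set_integral_add) auto
  finally show ?thesis .
qed

text \<open>In units of half the squared norm at each site, the potential gains \<open>c'\<close>
  and the pair interaction costs at most \<open>c\<close>. The boundary term is linear in \<omega>,
  so it costs an arbitrarily small further multiple and a constant depending on \<zeta>. Hence any
  \<alpha> above \<open>c - c'\<close> suffices.\<close>

lemma energy_lower_bound:
  assumes \<zeta>: "\<zeta> \<in> configs \<beta> UNIV" and \<alpha>: "\<alpha> > c - c'"
  shows "\<exists>K. \<forall>\<omega>\<in>configs \<beta> \<Lambda>. - energy \<beta> J U \<Lambda> \<omega> \<zeta> \<le> K + \<alpha> / 2 * (\<Sum>j\<in>\<Lambda>. L2_inner \<beta> (\<omega> j) (\<omega> j))"
proof -
  define \<delta> where "\<delta> = \<alpha> - (c - c')"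
  \<comment> \<open>Young's parameter for the boundary term. Dividing by \<open>c + 1\<close> rather
    than c covers c = 0 and still gives \<open>c * \<epsilon> \<le> \<delta>\<close>.\<close>
  define \<epsilon> where "\<epsilon> = \<delta> / (c + 1)"
  have \<epsilon>: "\<epsilon> > 0" "c * \<epsilon> \<le> \<delta>"
    using \<alpha> c_nonneg by (simp_all add: \<epsilon>_def \<delta>_def field_simps)
  define N where "N j = {k. J j k \<noteq> 0} - \<Lambda>" for j
  have N: "finite (N j)" for j
    using J_finite[of j] by (simp add: N_def)
  define z where "z j = (\<Sum>k\<in>N j. \<bar>J j k\<bar> * (1 / (2 * \<epsilon>) * L2_inner \<beta> (\<zeta> k) (\<zeta> k)))" for j
  define K where "K = (\<Sum>j\<in>\<Lambda>. z j - \<beta> * b)"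
  have \<zeta>c: "continuous_on {0..\<beta>} (\<zeta> k)" for k
    using config_mem[OF \<zeta>, of k] by (intro loop_continuous) simp
  have "- energy \<beta> J U \<Lambda> \<omega> \<zeta> \<le> K + \<alpha> / 2 * (\<Sum>j\<in>\<Lambda>. L2_inner \<beta> (\<omega> j) (\<omega> j))" if \<omega>: "\<omega> \<in> configs \<beta> \<Lambda>" for \<omega>
  proof -
    define n where "n j = L2_inner \<beta> (\<omega> j) (\<omega> j)" for j
    have n0: "n j \<ge> 0" for j
      by (simp add: n_def L2_inner_self_nonneg)
    have \<omega>c: "continuous_on {0..\<beta>} (\<omega> j)" if "j \<in> \<Lambda>" for j
      using config_mem[OF \<omega> that] by (rule loop_continuous)
    have pot: "(LBINT t:{0..\<beta>}. U j (\<omega> j t)) \<ge> c' / 2 * n j + \<beta> * b" if j: "j \<in> \<Lambda>" for j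
    proof -
      have i: "set_integrable lborel {0..\<beta>} (\<lambda>t. \<omega> j t * \<omega> j t)" "set_integrable lborel {0..\<beta>} (\<lambda>t. b)"
        "set_integrable lborel {0..\<beta>} (\<lambda>t. U j (\<omega> j t))"
        by (intro borel_integrable_atLeastAtMost' continuous_intros \<omega>c j
            continuous_on_compose2[OF U_cont \<omega>c[OF j]] subset_UNIV)+
      have "c' / 2 * n j + \<beta> * b = (LBINT t:{0..\<beta>}. c' / 2 * (\<omega> j t * \<omega> j t) + b)"
        using i by (subst set_integral_add) (auto simp: n_def L2_inner_def set_integral_const)
      also have "\<dots> \<le> (LBINT t:{0..\<beta>}. U j (\<omega> j t))"
        using i U_bound[of "\<omega> j _" j] by (intro set_integral_mono) (auto simp: power2_eq_square)
      finally show ?thesis .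
    qed
    have "(\<Sum>j\<in>\<Lambda>. \<Sum>k\<in>\<Lambda>. - (J j k * L2_inner \<beta> (\<omega> j) (\<omega> k))) \<le>
        (\<Sum>j\<in>\<Lambda>. \<Sum>k\<in>\<Lambda>. \<bar>J j k\<bar> * (n j / 2) + \<bar>J j k\<bar> * (n k / 2))"
    proof (intro sum_mono)
      fix j k assume jk: "j \<in> \<Lambda>" "k \<in> \<Lambda>"
      have "- (J j k * L2_inner \<beta> (\<omega> j) (\<omega> k)) \<le> \<bar>J j k\<bar> * \<bar>L2_inner \<beta> (\<omega> j) (\<omega> k)\<bar>"
        using abs_ge_minus_self[of "J j k * L2_inner \<beta> (\<omega> j) (\<omega> k)"] by (simp add: abs_mult)
      also have "\<dots> \<le> \<bar>J j k\<bar> * (n j / 2 + n k / 2)"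
        using abs_L2_inner_le[OF \<omega>c[OF jk(1)] \<omega>c[OF jk(2)], of 1]
        by (intro mult_left_mono) (auto simp: n_def)
      finally show "- (J j k * L2_inner \<beta> (\<omega> j) (\<omega> k)) \<le> \<bar>J j k\<bar> * (n j / 2) + \<bar>J j k\<bar> * (n k / 2)"
        by (simp add: distrib_left)
    qed
    \<comment> \<open>Exchanging the summations and using the symmetry of J turns both halves into
      the same weighted row sums, which c bounds.\<close>
    also have "\<dots> = (\<Sum>j\<in>\<Lambda>. \<Sum>k\<in>\<Lambda>. \<bar>J j k\<bar> * (n j / 2)) + (\<Sum>j\<in>\<Lambda>. \<Sum>k\<in>\<Lambda>. \<bar>J k j\<bar> * (n j / 2))"
      unfolding sum.distrib by (subst (2) sum.swap) (rule refl)
    also have "(\<lambda>j k. \<bar>J k j\<bar> * (n j / 2)) = (\<lambda>j k. \<bar>J j k\<bar> * (n j / 2))"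
      using J_sym by metis
    also have "(\<Sum>j\<in>\<Lambda>. \<Sum>k\<in>\<Lambda>. \<bar>J j k\<bar> * (n j / 2)) + (\<Sum>j\<in>\<Lambda>. \<Sum>k\<in>\<Lambda>. \<bar>J j k\<bar> * (n j / 2)) =
        (\<Sum>j\<in>\<Lambda>. (\<Sum>k\<in>\<Lambda>. \<bar>J j k\<bar>) * n j)"
      by (simp add: mult.commute sum_distrib_left flip: sum.distrib)
    also have "\<dots> \<le> (\<Sum>j\<in>\<Lambda>. c * n j)"
      by (intro sum_mono mult_right_mono sum_abs_J_le \<Lambda>_fin n0)
    finally have pair: "- (1 / 2 * (\<Sum>j\<in>\<Lambda>. \<Sum>k\<in>\<Lambda>. J j k * L2_inner \<beta> (\<omega> j) (\<omega> k))) \<le> (\<Sum>j\<in>\<Lambda>. c / 2 * n j)"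
      by (simp add: sum_negf sum_distrib_left[symmetric] sum_divide_distrib[symmetric])
    have "(\<Sum>j\<in>\<Lambda>. \<Sum>k\<in>N j. - (J j k * L2_inner \<beta> (\<omega> j) (\<zeta> k))) \<le> (\<Sum>j\<in>\<Lambda>. \<delta> / 2 * n j + z j)"
    proof (intro sum_mono)
      fix j assume j: "j \<in> \<Lambda>"
      have "(\<Sum>k\<in>N j. - (J j k * L2_inner \<beta> (\<omega> j) (\<zeta> k))) \<le>
          (\<Sum>k\<in>N j. \<bar>J j k\<bar> * (\<epsilon> / 2 * n j + 1 / (2 * \<epsilon>) * L2_inner \<beta> (\<zeta> k) (\<zeta> k)))"
      proof (intro sum_mono)
        fix k
        have "- (J j k * L2_inner \<beta> (\<omega> j) (\<zeta> k)) \<le> \<bar>J j k\<bar> * \<bar>L2_inner \<beta> (\<omega> j) (\<zeta> k)\<bar>"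
          using abs_ge_minus_self[of "J j k * L2_inner \<beta> (\<omega> j) (\<zeta> k)"] by (simp add: abs_mult)
        also have "\<dots> \<le> \<bar>J j k\<bar> * (\<epsilon> / 2 * n j + 1 / (2 * \<epsilon>) * L2_inner \<beta> (\<zeta> k) (\<zeta> k))"
          unfolding n_def by (intro mult_left_mono abs_L2_inner_le \<omega>c \<zeta>c j \<epsilon>) auto
        finally show "- (J j k * L2_inner \<beta> (\<omega> j) (\<zeta> k)) \<le> \<dots>" .
      qed
      also have "\<dots> = (\<Sum>k\<in>N j. \<bar>J j k\<bar>) * (\<epsilon> / 2 * n j) + z j"
        by (simp add: z_def distrib_left sum.distrib sum_distrib_right)
      also have "\<dots> \<le> c * (\<epsilon> / 2 * n j) + z j"
        using \<epsilon> n0 by (intro add_right_mono mult_right_mono sum_abs_J_le N) auto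
      also have "\<dots> = (c * \<epsilon>) * (n j / 2) + z j"
        by simp
      also have "\<dots> \<le> \<delta> * (n j / 2) + z j"
        using \<epsilon> n0[of j] by (intro add_right_mono mult_right_mono) auto
      finally show "(\<Sum>k\<in>N j. - (J j k * L2_inner \<beta> (\<omega> j) (\<zeta> k))) \<le> \<delta> / 2 * n j + z j"
        by simp
    qed
    then have bdry: "- (\<Sum>j\<in>\<Lambda>. \<Sum>k\<in>N j. J j k * L2_inner \<beta> (\<omega> j) (\<zeta> k)) \<le> (\<Sum>j\<in>\<Lambda>. \<delta> / 2 * n j + z j)"
      by (simp add: sum_negf)
    have pot': "- (\<Sum>j\<in>\<Lambda>. LBINT t:{0..\<beta>}. U j (\<omega> j t)) \<le> (\<Sum>j\<in>\<Lambda>. - (c' / 2 * n j + \<beta> * b))"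
    proof (unfold sum_negf[symmetric], intro sum_mono)
      fix j assume "j \<in> \<Lambda>"
      from pot[OF this] show "- (LBINT t:{0..\<beta>}. U j (\<omega> j t)) \<le> - (c' / 2 * n j + \<beta> * b)"
        by linarith
    qed
    have "- energy \<beta> J U \<Lambda> \<omega> \<zeta> \<le> (\<Sum>j\<in>\<Lambda>. - (c' / 2 * n j + \<beta> * b)) + (\<Sum>j\<in>\<Lambda>. c / 2 * n j) + (\<Sum>j\<in>\<Lambda>. \<delta> / 2 * n j + z j)"
      using pot' pair bdry unfolding energy_eq N_def by linarith
    also have "\<dots> = (\<Sum>j\<in>\<Lambda>. (z j - \<beta> * b) + \<alpha> / 2 * n j)"
      unfolding sum.distrib[symmetric]
      by (intro sum.cong refl) (simp add: \<delta>_def field_simps)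
    also have "\<dots> = K + \<alpha> / 2 * (\<Sum>j\<in>\<Lambda>. n j)"
      by (simp add: K_def sum.distrib sum_distrib_left)
    finally show ?thesis
      by (simp add: n_def)
  qed
  then show ?thesis
    by blast
qed

lemma L2_inner_const_loop: "L2_inner \<beta> (const_loop \<beta> x) f = x * (LBINT t:{0..\<beta>}. f t)"
  unfolding L2_inner_def set_integral_mult_right[symmetric]
  by (rule set_lebesgue_integral_cong) auto

text \<open>Pairing with a constant loop sees \<zeta> only through its time integrals, and these
  agree with those of the constant loops at its means.\<close>

lemma energy_const_loops:
  assumes \<zeta>: "\<zeta> \<in> mean_configs \<beta> y"
  shows "energy \<beta> J U \<Lambda> (\<lambda>j\<in>\<Lambda>. const_loop \<beta> (x j)) \<zeta> =
    energy \<beta> J U \<Lambda> (\<lambda>j\<in>\<Lambda>. const_loop \<beta> (x j)) (\<lambda>j. const_loop \<beta> (y j))"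
proof -
  have "(LBINT t:{0..\<beta>}. \<zeta> k t) = (LBINT t:{0..\<beta>}. const_loop \<beta> (y k) t)" for k
  proof -
    have "(LBINT t:{0..\<beta>}. const_loop \<beta> (y k) t) = (LBINT t:{0..\<beta>}. y k)"
      by (rule set_lebesgue_integral_cong) auto
    also have "\<dots> = \<beta> * y k"
      by (rule set_integral_const)
    finally show ?thesis
      using \<zeta> \<beta>_pos by (auto simp: mean_configs_def field_simps)
  qed
  then have "L2_inner \<beta> (const_loop \<beta> a) (\<zeta> k) = L2_inner \<beta> (const_loop \<beta> a) (const_loop \<beta> (y k))" for a k
    by (simp add: L2_inner_const_loop)
  then show ?thesis
    unfolding energy_eq by simp
qed

end

section \<open>Comparison with the configuration of mean values\<close>

context loop_space
begin

text \<open>The map P, applied at every site.\<close>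

definition flatten :: "'k set \<Rightarrow> ('k \<Rightarrow> real \<Rightarrow> real) \<Rightarrow> 'k \<Rightarrow> real \<Rightarrow> real" where
  "flatten \<Lambda> \<omega> = (\<lambda>j\<in>\<Lambda>. const_loop \<beta> (loop_mean (\<omega> j)))"

lemma flatten_in_configs: "flatten \<Lambda> \<omega> \<in> configs \<beta> \<Lambda>"
  by (auto simp: flatten_def configs_def)

lemma const_test: "(\<lambda>_. a) \<in> test_functions"
  by (intro test_continuous continuous_intros)

lemma fourier_basis_0: "fourier_basis \<beta> 0 = (\<lambda>_. 1 / sqrt \<beta>)"
  by (simp add: fourier_basis_def fun_eq_iff)

lemma loop_mean_fourier: "loop_mean \<omega> = 1 / sqrt \<beta> * L2_inner \<beta> (fourier_basis \<beta> 0) \<omega>"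
proof -
  have "(\<lambda>_::real. 1 / \<beta>) = (\<lambda>t. 1 / sqrt \<beta> * fourier_basis \<beta> 0 t)"
    using \<beta>_pos by (simp add: fourier_basis_0 fun_eq_iff)
  then show ?thesis
    unfolding loop_mean_def by (simp only: L2_inner_cmult)
qed

lemma loop_mean_measurable: "loop_mean \<in> borel_measurable (loop_sigma \<beta>)"
  unfolding loop_mean_def[abs_def] by (intro L2_inner_measurable const_test)

lemma variance_form_mean: "variance_form m (\<lambda>_. 1 / \<beta>) = 1 / \<beta>"
proof -
  have f: "L2_inner \<beta> (\<lambda>_. 1 / \<beta>) (fourier_basis \<beta> n) = (if n = 0 then 1 / sqrt \<beta> else 0)" for n
    using loop_mean_fourier[of "fourier_basis \<beta> n"] by (simp add: loop_mean_def fourier_basis_orthonormal)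
  have "variance_form m (\<lambda>_. 1 / \<beta>) = (\<Sum>\<^sub>\<infinity>n\<in>{0}. eigenvalue m n * (1 / sqrt \<beta>)\<^sup>2)"
    unfolding variance_form_def by (rule infsum_cong_neutral) (auto simp: f)
  then show ?thesis
    using \<beta>_pos by (simp add: power_divide)
qed

text \<open>Bessel's inequality for the constant mode. It hands domination by exponentials of the
  squared norms on to flattened configurations.\<close>

lemma L2_inner_const_loop_self_le:
  assumes "\<omega> \<in> loops \<beta>"
  shows "L2_inner \<beta> (const_loop \<beta> (loop_mean \<omega>)) (const_loop \<beta> (loop_mean \<omega>)) \<le> L2_inner \<beta> \<omega> \<omega>"
proof -
  have "L2_inner \<beta> (const_loop \<beta> x) (const_loop \<beta> x) = (LBINT t:{0..\<beta>}. x * x)" for x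
    unfolding L2_inner_def by (rule set_lebesgue_integral_cong) auto
  then have "L2_inner \<beta> (const_loop \<beta> (loop_mean \<omega>)) (const_loop \<beta> (loop_mean \<omega>)) = (L2_inner \<beta> (fourier_basis \<beta> 0) \<omega>)\<^sup>2"
    using \<beta>_pos by (simp add: set_integral_const loop_mean_fourier power2_eq_square)
  also have "\<dots> \<le> L2_inner \<beta> \<omega> \<omega>"
    using L2_inner_residual[OF _ assms, of "{0}"] L2_inner_self_nonneg by simp
  finally show ?thesis .
qed

lemma flatten_const_measurable:
  "(\<lambda>x. \<lambda>j\<in>\<Lambda>. const_loop \<beta> (x j)) \<in> PiM \<Lambda> (\<lambda>_. borel) \<rightarrow>\<^sub>M config_sigma \<beta> \<Lambda>"
proof -
  note [measurable] = const_loop_measurable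
  show ?thesis
    unfolding config_sigma_def by measurable
qed

lemma flatten_measurable: "flatten \<Lambda> \<in> config_sigma \<beta> \<Lambda> \<rightarrow>\<^sub>M config_sigma \<beta> \<Lambda>"
proof -
  note [measurable] = const_loop_measurable loop_mean_measurable
  show ?thesis
    unfolding config_sigma_def flatten_def[abs_def] by measurable
qed

text \<open>
  Since these open sets decrease to the empty set, any probability measure gives them small mass for
  large \<open>n\<close>; this replaces uniform continuity on compacta.
\<close>

definition jump_set ::
  "'k set \<Rightarrow> (('k \<Rightarrow> real \<Rightarrow> real) \<Rightarrow> real) \<Rightarrow> real \<Rightarrow> nat \<Rightarrow> ('k \<Rightarrow> real \<Rightarrow> real) set" where
  "jump_set \<Lambda> F \<epsilon> n = {\<xi> \<in> configs \<beta> \<Lambda>. \<exists>\<omega>\<in>configs \<beta> \<Lambda>.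
     (\<forall>j\<in>\<Lambda>. mdist (loop_metric \<beta>) (\<omega> j) (\<xi> j) < inverse (real (Suc n))) \<and> \<bar>F \<omega> - F \<xi>\<bar> > \<epsilon>}"

text \<open>For a fixed witness \<omega> the admissible \<xi> form an open set, both inequalities
  being strict; the jump set is the union over all witnesses.\<close>

lemma openin_jump_set:
  assumes fin: "finite \<Lambda>" and F: "continuous_map (config_topology \<beta> \<Lambda>) euclideanreal F"
  shows "openin (config_topology \<beta> \<Lambda>) (jump_set \<Lambda> F \<epsilon> n)"
proof -
  define V where "V \<omega> =
     {\<xi> \<in> configs \<beta> \<Lambda>. \<forall>j\<in>\<Lambda>. mdist (loop_metric \<beta>) (\<omega> j) (\<xi> j) < inverse (real (Suc n))} \<inter>
     {\<xi> \<in> topspace (config_topology \<beta> \<Lambda>). F \<xi> \<in> {x. \<bar>F \<omega> - x\<bar> > \<epsilon>}}" for \<omega>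
  have "openin (config_topology \<beta> \<Lambda>) (V \<omega>)" if "\<omega> \<in> configs \<beta> \<Lambda>" for \<omega>
  proof -
    have "open {x::real. \<bar>F \<omega> - x\<bar> > \<epsilon>}"
      by (intro open_Collect_less continuous_intros)
    then have "openin (config_topology \<beta> \<Lambda>) {\<xi> \<in> topspace (config_topology \<beta> \<Lambda>). F \<xi> \<in> {x. \<bar>F \<omega> - x\<bar> > \<epsilon>}}"
      using F by (intro openin_continuous_map_preimage[where Y=euclideanreal]) auto
    then show ?thesis
      unfolding V_def by (intro openin_Int openin_config_ball fin that)
  qed
  then have "openin (config_topology \<beta> \<Lambda>) (\<Union>\<omega>\<in>configs \<beta> \<Lambda>. V \<omega>)"
    by blast
  moreover have "jump_set \<Lambda> F \<epsilon> n = (\<Union>\<omega>\<in>configs \<beta> \<Lambda>. V \<omega>)"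
    by (auto simp: jump_set_def V_def topspace_config_topology)
  ultimately show ?thesis
    by simp
qed

text \<open>A point common to all these decreasing sets would be a discontinuity of F.\<close>

lemma jump_set_tendsto:
  assumes fin: "finite \<Lambda>" and F: "continuous_map (config_topology \<beta> \<Lambda>) euclideanreal F" and "\<epsilon> > 0"
    and Q: "prob_space Q" "sets Q = sets (config_sigma \<beta> \<Lambda>)"
  shows "(\<lambda>n. measure Q (jump_set \<Lambda> F \<epsilon> n)) \<longlonglongrightarrow> 0"
proof -
  interpret Q: prob_space Q by (rule Q)
  have "range (jump_set \<Lambda> F \<epsilon>) \<subseteq> sets Q"
    using openin_in_config_sigma[OF fin openin_jump_set[OF fin F]] Q by auto
  moreover have "decseq (jump_set \<Lambda> F \<epsilon>)"
  proof (rule decseq_SucI)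
    fix n
    have "inverse (real (Suc (Suc n))) \<le> inverse (real (Suc n))"
      by (simp add: field_simps)
    then show "jump_set \<Lambda> F \<epsilon> (Suc n) \<subseteq> jump_set \<Lambda> F \<epsilon> n"
      unfolding jump_set_def using less_le_trans by blast
  qed
  ultimately have "(\<lambda>n. measure Q (jump_set \<Lambda> F \<epsilon> n)) \<longlonglongrightarrow> measure Q (\<Inter>n. jump_set \<Lambda> F \<epsilon> n)"
    by (rule Q.finite_Lim_measure_decseq)
  moreover have "(\<Inter>n. jump_set \<Lambda> F \<epsilon> n) = {}"
  proof (rule ccontr)
    assume "(\<Inter>n. jump_set \<Lambda> F \<epsilon> n) \<noteq> {}"
    then obtain \<xi> where \<xi>: "\<And>n. \<xi> \<in> jump_set \<Lambda> F \<epsilon> n"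
      by blast
    have \<xi>c: "\<xi> \<in> configs \<beta> \<Lambda>"
      using \<xi>[of 0] by (simp add: jump_set_def)
    define W where "W = {\<omega> \<in> topspace (config_topology \<beta> \<Lambda>). F \<omega> \<in> {x. \<bar>x - F \<xi>\<bar> < \<epsilon>}}"
    have "open {x::real. \<bar>x - F \<xi>\<bar> < \<epsilon>}"
      by (intro open_Collect_less continuous_intros)
    then have oW: "openin (config_topology \<beta> \<Lambda>) W"
      unfolding W_def using F by (intro openin_continuous_map_preimage[where Y=euclideanreal]) auto
    have \<xi>W: "\<xi> \<in> W"
      using \<xi>c \<open>\<epsilon> > 0\<close> by (simp add: W_def topspace_config_topology)
    obtain r where r: "r > 0" "\<And>\<omega>. \<omega> \<in> configs \<beta> \<Lambda> \<Longrightarrow> (\<And>j. j \<in> \<Lambda> \<Longrightarrow> mdist (loop_metric \<beta>) (\<xi> j) (\<omega> j) < r) \<Longrightarrow> \<omega> \<in> W"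
      using openin_config_topology_ball[OF fin oW \<xi>W] by blast
    obtain n where n: "inverse (real (Suc n)) < r"
      using reals_Archimedean[OF r(1)] by blast
    obtain \<omega> where \<omega>: "\<omega> \<in> configs \<beta> \<Lambda>" "\<And>j. j \<in> \<Lambda> \<Longrightarrow> mdist (loop_metric \<beta>) (\<omega> j) (\<xi> j) < inverse (real (Suc n))"
        "\<bar>F \<omega> - F \<xi>\<bar> > \<epsilon>"
      using \<xi>[of n] by (auto simp: jump_set_def)
    have "\<omega> \<in> W"
    proof (rule r(2)[OF \<omega>(1)])
      fix j assume "j \<in> \<Lambda>"
      from \<omega>(2)[OF this] n show "mdist (loop_metric \<beta>) (\<xi> j) (\<omega> j) < r"
        by (simp add: mdist_commute)
    qed
    then show False
      using \<omega>(3) by (simp add: W_def)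
  qed
  ultimately show ?thesis
    by simp
qed

lemma smooth_config_near_flatten:
  assumes \<omega>: "\<omega> \<in> configs \<beta> \<Lambda>" and j: "j \<in> \<Lambda>" "\<omega> j \<notin> rough_loops \<delta>"
  shows "mdist (loop_metric \<beta>) (\<omega> j) (flatten \<Lambda> \<omega> j) \<le> 32 * \<delta>"
  using j smooth_loop_near_mean[OF config_mem[OF \<omega> j(1)] j(2)]
  by (simp add: flatten_def loop_mdist_le[OF config_mem[OF \<omega> j(1)]])

end

context gaussian_loop
begin

lemma distr_loop_mean:
  "distr \<gamma> borel loop_mean = density lborel (\<lambda>x. ennreal (sqrt (\<beta> / (2 * pi)) * exp (- \<beta> * x\<^sup>2 / 2)))"
proof -
  interpret N: prob_space std_normal_distribution
    by (rule prob_space_normal_density) simp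
  have "distributed std_normal_distribution lborel (\<lambda>x. x) std_normal_density"
    by (simp add: distributed_def distr_id2)
  then have "distributed std_normal_distribution lborel (\<lambda>x. 0 + sqrt (1 / \<beta>) * x) (normal_density (0 + sqrt (1 / \<beta>) * 0) (\<bar>sqrt (1 / \<beta>)\<bar> * 1))"
    using \<beta>_pos by (intro N.normal_density_affine) auto
  then have "distr std_normal_distribution lborel (\<lambda>x. 0 + sqrt (1 / \<beta>) * x) = density lborel (normal_density (0 + sqrt (1 / \<beta>) * 0) (\<bar>sqrt (1 / \<beta>)\<bar> * 1))"
    by (rule distributed_distr_eq_density)
  then have "distr std_normal_distribution borel (\<lambda>x. sqrt (1 / \<beta>) * x) = density lborel (normal_density 0 (sqrt (1 / \<beta>)))"
    using \<beta>_pos by (simp cong: distr_cong)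
  moreover have "normal_density 0 (sqrt (1 / \<beta>)) x = sqrt (\<beta> / (2 * pi)) * exp (- \<beta> * x\<^sup>2 / 2)" for x
  proof -
    have s: "(sqrt (1 / \<beta>))\<^sup>2 = 1 / \<beta>"
      using \<beta>_pos by simp
    show ?thesis
      unfolding normal_density_def s using \<beta>_pos by (simp add: real_sqrt_divide mult.commute)
  qed
  moreover have "distr \<gamma> borel loop_mean = distr std_normal_distribution borel (\<lambda>x. sqrt (1 / \<beta>) * x)"
    unfolding loop_mean_def[abs_def] using distr_L2_inner[OF const_test[of "1 / \<beta>"]] by (simp add: variance_form_mean)
  ultimately show ?thesis
    by simp
qed

lemma sets_PiM_\<gamma>: "sets (PiM \<Lambda> (\<lambda>_. \<gamma>)) = sets (config_sigma \<beta> \<Lambda>)"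
  unfolding config_sigma_def by (intro sets_PiM_cong sets_\<gamma> refl)

lemma space_PiM_\<gamma>: "space (PiM \<Lambda> (\<lambda>_. \<gamma>)) = configs \<beta> \<Lambda>"
  using sets_eq_imp_space_eq[OF sets_PiM_\<gamma>, of \<Lambda>] by (simp add: space_config_sigma)

lemma prob_space_PiM_\<gamma>: "prob_space (PiM \<Lambda> (\<lambda>_. \<gamma>))"
  by (intro prob_space_PiM prob_space_\<gamma>)

text \<open>\<open>flatten \<Lambda>\<close> takes means site by site and then inserts constant
  loops. The first map sends the product measure to the product of the Gaussian laws of the means;
  the second is the map that defines \<open>qc_reference\<close>.\<close>

lemma distr_flatten:
  assumes fin: "finite \<Lambda>"
  shows "distr (PiM \<Lambda> (\<lambda>_. \<gamma>)) (config_sigma \<beta> \<Lambda>) (flatten \<Lambda>) = qc_reference \<beta> \<Lambda>"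
proof -
  let ?D = "distr \<gamma> borel loop_mean"
  have m: "loop_mean \<in> borel_measurable \<gamma>"
    using loop_mean_measurable by (simp cong: measurable_cong_sets add: sets_\<gamma>)
  have D: "prob_space ?D"
    by (rule prob_space.prob_space_distr[OF prob_space_\<gamma> m])
  have "distr (PiM \<Lambda> (\<lambda>_. \<gamma>)) (PiM \<Lambda> (\<lambda>_. ?D)) (compose \<Lambda> loop_mean) = PiM \<Lambda> (\<lambda>_. distr \<gamma> ?D loop_mean)"
    using m D by (intro distr_PiM_finite_prob_space' fin prob_space_\<gamma>) auto
  also have "distr \<gamma> ?D loop_mean = ?D"
    by (rule distr_cong) auto
  finally have q: "qc_density_measure \<beta> \<Lambda> = distr (PiM \<Lambda> (\<lambda>_. \<gamma>)) (PiM \<Lambda> (\<lambda>_. ?D)) (compose \<Lambda> loop_mean)"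
    by (simp add: qc_density_measure_def distr_loop_mean)
  have "qc_reference \<beta> \<Lambda> = distr (PiM \<Lambda> (\<lambda>_. \<gamma>)) (config_sigma \<beta> \<Lambda>) ((\<lambda>x. \<lambda>j\<in>\<Lambda>. const_loop \<beta> (x j)) \<circ> compose \<Lambda> loop_mean)"
    unfolding qc_reference_def q
  proof (rule distr_distr)
    have "sets (PiM \<Lambda> (\<lambda>_. ?D)) = sets (PiM \<Lambda> (\<lambda>_. borel))"
      by (intro sets_PiM_cong) auto
    then show "(\<lambda>x. \<lambda>j\<in>\<Lambda>. const_loop \<beta> (x j)) \<in> PiM \<Lambda> (\<lambda>_. ?D) \<rightarrow>\<^sub>M config_sigma \<beta> \<Lambda>"
      using flatten_const_measurable by (simp cong: measurable_cong_sets)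
    show "compose \<Lambda> loop_mean \<in> PiM \<Lambda> (\<lambda>_. \<gamma>) \<rightarrow>\<^sub>M PiM \<Lambda> (\<lambda>_. ?D)"
      unfolding compose_def using m
      by (intro measurable_restrict) (auto intro: measurable_compose[OF measurable_component_singleton])
  qed
  also have "(\<lambda>x. \<lambda>j\<in>\<Lambda>. const_loop \<beta> (x j)) \<circ> compose \<Lambda> loop_mean = flatten \<Lambda>"
    by (auto simp: fun_eq_iff flatten_def compose_def)
  finally show ?thesis
    by simp
qed

text \<open>The sites are independent, so the moment factorizes. \<open>max K 0\<close> accounts for
  a negative K, which \<open>ennreal\<close> sends to 0.\<close>

lemma nn_integral_exp_sum:
  assumes fin: "finite \<Lambda>"
    and K: "(\<integral>\<^sup>+\<omega>. ennreal (exp (a * L2_inner \<beta> \<omega> \<omega>)) \<partial>\<gamma>) \<le> ennreal K"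
  shows "(\<integral>\<^sup>+\<omega>. ennreal (exp (a * (\<Sum>j\<in>\<Lambda>. L2_inner \<beta> (\<omega> j) (\<omega> j)))) \<partial>PiM \<Lambda> (\<lambda>_. \<gamma>)) \<le> ennreal (max K 0 ^ card \<Lambda>)"
proof -
  interpret \<gamma>: prob_space \<gamma>
    by (rule prob_space_\<gamma>)
  interpret P: product_sigma_finite "\<lambda>_. \<gamma>"
    by standard
  note [measurable] = L2_square_measurable
  have "(\<integral>\<^sup>+\<omega>. ennreal (exp (a * (\<Sum>j\<in>\<Lambda>. L2_inner \<beta> (\<omega> j) (\<omega> j)))) \<partial>PiM \<Lambda> (\<lambda>_. \<gamma>)) =
      (\<integral>\<^sup>+\<omega>. (\<Prod>j\<in>\<Lambda>. ennreal (exp (a * L2_inner \<beta> (\<omega> j) (\<omega> j)))) \<partial>PiM \<Lambda> (\<lambda>_. \<gamma>))"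
    by (simp add: prod_ennreal exp_sum[OF fin] sum_distrib_left)
  also have "\<dots> = (\<Prod>j\<in>\<Lambda>. \<integral>\<^sup>+\<omega>. ennreal (exp (a * L2_inner \<beta> \<omega> \<omega>)) \<partial>\<gamma>)"
    by (rule P.product_nn_integral_prod[OF fin]) measurable
  also have "\<dots> \<le> ennreal (max K 0) ^ card \<Lambda>"
  proof -
    have "x ^ n \<le> y ^ n" if "x \<le> y" for x y :: ennreal and n :: nat
      using that by (induction n) (auto intro: mult_mono)
    then show ?thesis
      using order_trans[OF K ennreal_leI[of K "max K 0"]] by simp
  qed
  also have "\<dots> = ennreal (max K 0 ^ card \<Lambda>)"
    by (rule ennreal_power) simp
  finally show ?thesis .
qed

lemma rough_configs_measure:
  assumes fin: "finite \<Lambda>" and \<delta>: "\<delta> > 0"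
  shows "measure (PiM \<Lambda> (\<lambda>_. \<gamma>)) (\<Union>j\<in>\<Lambda>. {\<omega> \<in> configs \<beta> \<Lambda>. \<omega> j \<in> rough_loops \<delta>})
     \<le> real (card \<Lambda>) * (8 * (tail_const * \<beta>\<^sup>2 / (m ^ 4 * \<delta> ^ 8)))"
proof -
  interpret P: prob_space "PiM \<Lambda> (\<lambda>_. \<gamma>)"
    by (rule prob_space_PiM_\<gamma>)
  have R: "rough_loops \<delta> \<in> sets \<gamma>"
    by (simp add: sets_\<gamma> rough_loops_measurable)
  have eq: "{\<omega> \<in> configs \<beta> \<Lambda>. \<omega> j \<in> rough_loops \<delta>} = (\<lambda>\<omega>. \<omega> j) -` rough_loops \<delta> \<inter> space (PiM \<Lambda> (\<lambda>_. \<gamma>))" for j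
    by (auto simp: space_PiM_\<gamma>)
  have c: "tail_const * \<beta>\<^sup>2 / (m ^ 4 * \<delta> ^ 8) \<ge> 0"
    using increment_const_pos m_pos \<delta> by (simp add: tail_const_def)
  have "measure (PiM \<Lambda> (\<lambda>_. \<gamma>)) (\<Union>j\<in>\<Lambda>. {\<omega> \<in> configs \<beta> \<Lambda>. \<omega> j \<in> rough_loops \<delta>}) \<le>
      (\<Sum>j\<in>\<Lambda>. measure (PiM \<Lambda> (\<lambda>_. \<gamma>)) {\<omega> \<in> configs \<beta> \<Lambda>. \<omega> j \<in> rough_loops \<delta>})"
    unfolding eq by (rule P.finite_measure_subadditive_finite[OF fin])
      (auto intro!: measurable_sets[OF _ R])
  also have "\<dots> \<le> (\<Sum>j\<in>\<Lambda>. 8 * (tail_const * \<beta>\<^sup>2 / (m ^ 4 * \<delta> ^ 8)))"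
  proof (rule sum_mono)
    fix j assume j: "j \<in> \<Lambda>"
    have "emeasure (PiM \<Lambda> (\<lambda>_. \<gamma>)) {\<omega> \<in> configs \<beta> \<Lambda>. \<omega> j \<in> rough_loops \<delta>} = emeasure (distr (PiM \<Lambda> (\<lambda>_. \<gamma>)) \<gamma> (\<lambda>\<omega>. \<omega> j)) (rough_loops \<delta>)"
      unfolding eq by (rule emeasure_distr[symmetric, OF measurable_component_singleton[OF j] R])
    also have "distr (PiM \<Lambda> (\<lambda>_. \<gamma>)) \<gamma> (\<lambda>\<omega>. \<omega> j) = \<gamma>"
      using j by (intro distr_PiM_component prob_space_\<gamma>)
    also have "emeasure \<gamma> (rough_loops \<delta>) \<le> ennreal (8 * (tail_const * \<beta>\<^sup>2 / (m ^ 4 * \<delta> ^ 8)))"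
      by (rule rough_loops_emeasure[OF \<delta>])
    finally show "measure (PiM \<Lambda> (\<lambda>_. \<gamma>)) {\<omega> \<in> configs \<beta> \<Lambda>. \<omega> j \<in> rough_loops \<delta>} \<le> 8 * (tail_const * \<beta>\<^sup>2 / (m ^ 4 * \<delta> ^ 8))"
      using c by (simp add: P.emeasure_eq_measure)
  qed
  finally show ?thesis
    by simp
qed

end

text \<open>Above the level \<tau> the factor \<open>exp ((p - 1) * (x - \<tau>))\<close> is at
  least 1. In the application the bounded part is weighted by a small probability, and the rest is a
  p-th moment times the small factor \<open>exp (- (p - 1) * \<tau>)\<close>.\<close>

lemma exp_truncation:
  fixes x \<tau> p :: real
  assumes "p \<ge> 1"
  shows "exp x \<le> exp \<tau> + exp (p * x - (p - 1) * \<tau>)"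
proof (cases "x \<le> \<tau>")
  case True
  then show ?thesis
    by (simp add: add_increasing2)
next
  case False
  then have "(p - 1) * \<tau> \<le> (p - 1) * x"
    using assms by (intro mult_left_mono) auto
  then have "exp x \<le> exp (p * x - (p - 1) * \<tau>)"
    by (simp add: algebra_simps)
  then show ?thesis
    by (simp add: add_increasing)
qed

lemma (in prob_space) prob_space_normalized_density:
  assumes f: "integrable M f" and pos: "\<And>x. f x > (0 :: real)"
  shows "(LINT x|M. f x) > 0" "prob_space (density M (\<lambda>x. ennreal (1 / (LINT x|M. f x) * f x)))"
proof -
  show Z: "(LINT x|M. f x) > 0"
    using integral_less_AE_space[of "\<lambda>_. 0" f] f pos emeasure_space_1 by simp
  show "prob_space (density M (\<lambda>x. ennreal (1 / (LINT x|M. f x) * f x)))"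
  proof
    have "emeasure (density M (\<lambda>x. ennreal (1 / (LINT x|M. f x) * f x))) (space (density M (\<lambda>x. ennreal (1 / (LINT x|M. f x) * f x)))) =
      (\<integral>\<^sup>+x. ennreal (1 / (LINT x|M. f x) * f x) \<partial>M)"
      using f by (simp add: emeasure_density cong: nn_integral_cong)
    also have "\<dots> = ennreal (LINT x|M. 1 / (LINT x|M. f x) * f x)"
      using f pos Z by (intro nn_integral_eq_integral) (auto intro!: AE_I2 simp: less_imp_le)
    also have "(LINT x|M. 1 / (LINT x|M. f x) * f x) = 1"
      using Z by simp
    finally show "emeasure (density M (\<lambda>x. ennreal (1 / (LINT x|M. f x) * f x))) (space (density M (\<lambda>x. ennreal (1 / (LINT x|M. f x) * f x)))) = 1"
      by simp
  qed
qed

section \<open>Convergence of the Gibbs measures\<close>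

lemma (in loop_space) L2_sum_measurable:
  "finite \<Lambda> \<Longrightarrow> (\<lambda>\<omega>. \<Sum>j\<in>\<Lambda>. L2_inner \<beta> (\<omega> j) (\<omega> j)) \<in> borel_measurable (config_sigma \<beta> \<Lambda>)"
proof -
  note [measurable] = L2_square_measurable
  show ?thesis
    unfolding config_sigma_def by measurable
qed

text \<open>Domination by this exponential is the standing integrability condition: the Boltzmann
  factor satisfies it, and so do its products with bounded functions.\<close>

lemma (in gaussian_loop) integrable_PiM_\<gamma>:
  assumes fin: "finite \<Lambda>" and F: "F \<in> borel_measurable (config_sigma \<beta> \<Lambda>)"
    and \<alpha>: "0 \<le> \<alpha>" "\<alpha> < 1"
    and bound: "\<And>\<omega>. \<omega> \<in> configs \<beta> \<Lambda> \<Longrightarrow> \<bar>F \<omega>\<bar> \<le> D * exp (\<alpha> / 2 * (\<Sum>j\<in>\<Lambda>. L2_inner \<beta> (\<omega> j) (\<omega> j)))"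
  shows "integrable (PiM \<Lambda> (\<lambda>_. \<gamma>)) F"
proof (rule integrableI_bounded)
  let ?S = "\<lambda>\<omega>. \<Sum>j\<in>\<Lambda>. L2_inner \<beta> (\<omega> j) (\<omega> j)"
  have M: "borel_measurable (PiM \<Lambda> (\<lambda>_. \<gamma>)) = borel_measurable (config_sigma \<beta> \<Lambda>)"
    by (rule measurable_cong_sets[OF sets_PiM_\<gamma> refl])
  show "F \<in> borel_measurable (PiM \<Lambda> (\<lambda>_. \<gamma>))"
    using F by (simp add: M)

  obtain K where K: "(\<integral>\<^sup>+\<omega>. ennreal (exp (\<alpha> / 2 * L2_inner \<beta> \<omega> \<omega>)) \<partial>\<gamma>) \<le> ennreal K"
    using exp_moment_bound[OF \<alpha> m_pos] quantum_reference by blast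
  have "(\<integral>\<^sup>+\<omega>. ennreal (norm (F \<omega>)) \<partial>PiM \<Lambda> (\<lambda>_. \<gamma>)) \<le>
      (\<integral>\<^sup>+\<omega>. ennreal (max D 0) * ennreal (exp (\<alpha> / 2 * ?S \<omega>)) \<partial>PiM \<Lambda> (\<lambda>_. \<gamma>))"
  proof (rule nn_integral_mono)
    fix \<omega> assume "\<omega> \<in> space (PiM \<Lambda> (\<lambda>_. \<gamma>))"
    then have "\<bar>F \<omega>\<bar> \<le> D * exp (\<alpha> / 2 * ?S \<omega>)"
      by (intro bound) (simp add: space_PiM_\<gamma>)
    also have "\<dots> \<le> max D 0 * exp (\<alpha> / 2 * ?S \<omega>)"
      by (intro mult_right_mono) auto
    finally show "ennreal (norm (F \<omega>)) \<le> ennreal (max D 0) * ennreal (exp (\<alpha> / 2 * ?S \<omega>))"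
      by (subst ennreal_mult[symmetric]) (auto intro: ennreal_leI)
  qed
  also have "\<dots> = ennreal (max D 0) * (\<integral>\<^sup>+\<omega>. ennreal (exp (\<alpha> / 2 * ?S \<omega>)) \<partial>PiM \<Lambda> (\<lambda>_. \<gamma>))"
  proof (rule nn_integral_cmult)
    note [measurable] = L2_square_measurable
    show "(\<lambda>\<omega>. ennreal (exp (\<alpha> / 2 * ?S \<omega>))) \<in> borel_measurable (PiM \<Lambda> (\<lambda>_. \<gamma>))"
      by measurable
  qed
  also have "\<dots> \<le> ennreal (max D 0) * ennreal (max K 0 ^ card \<Lambda>)"
    by (intro mult_left_mono nn_integral_exp_sum fin K) auto
  also have "\<dots> < \<infinity>"
    by (simp add: ennreal_mult_less_top)
  finally show "(\<integral>\<^sup>+\<omega>. ennreal (norm (F \<omega>)) \<partial>PiM \<Lambda> (\<lambda>_. \<gamma>)) < \<infinity>" .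
qed

lemma (in loop_space) flatten_sum_le:
  assumes "\<omega> \<in> configs \<beta> \<Lambda>"
  shows "(\<Sum>j\<in>\<Lambda>. L2_inner \<beta> (flatten \<Lambda> \<omega> j) (flatten \<Lambda> \<omega> j)) \<le> (\<Sum>j\<in>\<Lambda>. L2_inner \<beta> (\<omega> j) (\<omega> j))"
  using L2_inner_const_loop_self_le[OF config_mem[OF assms]] by (intro sum_mono) (simp add: flatten_def)

section \<open>Comparison of integrals under the two reference measures\<close>

context gaussian_loop
begin

text \<open>Total mass 1 is inherited from the loop measure through \<open>flatten\<close>.\<close>

lemma prob_space_qc_reference: "finite \<Lambda> \<Longrightarrow> prob_space (qc_reference \<beta> \<Lambda>)"
  using prob_space.prob_space_distr[OF prob_space_PiM_\<gamma>, of "flatten \<Lambda>" \<Lambda> "config_sigma \<beta> \<Lambda>"]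
    flatten_measurable[of \<Lambda>] distr_flatten[of \<Lambda>]
  by (simp cong: measurable_cong_sets add: sets_PiM_\<gamma>)

lemma integral_qc_reference:
  fixes F :: "('k \<Rightarrow> real \<Rightarrow> real) \<Rightarrow> real"
  assumes fin: "finite \<Lambda>" and F: "F \<in> borel_measurable (config_sigma \<beta> \<Lambda>)"
  shows "(LINT \<omega>|qc_reference \<beta> \<Lambda>. F \<omega>) = (LINT \<omega>|PiM \<Lambda> (\<lambda>_. \<gamma>). F (flatten \<Lambda> \<omega>))"
    and "integrable (qc_reference \<beta> \<Lambda>) F \<longleftrightarrow> integrable (PiM \<Lambda> (\<lambda>_. \<gamma>)) (\<lambda>\<omega>. F (flatten \<Lambda> \<omega>))"
proof -
  have "flatten \<Lambda> \<in> PiM \<Lambda> (\<lambda>_. \<gamma>) \<rightarrow>\<^sub>M config_sigma \<beta> \<Lambda>"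
    using flatten_measurable[of \<Lambda>] by (simp cong: measurable_cong_sets add: sets_PiM_\<gamma>)
  then show "(LINT \<omega>|qc_reference \<beta> \<Lambda>. F \<omega>) = (LINT \<omega>|PiM \<Lambda> (\<lambda>_. \<gamma>). F (flatten \<Lambda> \<omega>))"
    and "integrable (qc_reference \<beta> \<Lambda>) F \<longleftrightarrow> integrable (PiM \<Lambda> (\<lambda>_. \<gamma>)) (\<lambda>\<omega>. F (flatten \<Lambda> \<omega>))"
    using F by (simp_all add: distr_flatten[OF fin, symmetric] integral_distr integrable_distr_eq)
qed

text \<open>Unless some loop is rough, \<omega> lies within \<open>32 * \<delta>\<close> of its
  flattening at every site, so a large difference of values puts
  \<open>flatten \<Lambda> \<omega>\<close> into the jump set. The probability of the latter is
  taken under \<open>qc_reference\<close>, where the mass has disappeared.\<close>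

lemma deviation_measure:
  assumes fin: "finite \<Lambda>" and F: "continuous_map (config_topology \<beta> \<Lambda>) euclideanreal F"
    and \<delta>: "\<delta> > 0" "32 * \<delta> < inverse (real (Suc n))"
  shows "measure (PiM \<Lambda> (\<lambda>_. \<gamma>)) {\<omega> \<in> configs \<beta> \<Lambda>. \<bar>F \<omega> - F (flatten \<Lambda> \<omega>)\<bar> > \<epsilon>} \<le>
    measure (qc_reference \<beta> \<Lambda>) (jump_set \<Lambda> F \<epsilon> n)
    + real (card \<Lambda>) * (8 * (tail_const * \<beta>\<^sup>2 / (m ^ 4 * \<delta> ^ 8)))"
proof -
  interpret P: prob_space "PiM \<Lambda> (\<lambda>_. \<gamma>)"
    by (rule prob_space_PiM_\<gamma>)
  have FM: "flatten \<Lambda> \<in> PiM \<Lambda> (\<lambda>_. \<gamma>) \<rightarrow>\<^sub>M config_sigma \<beta> \<Lambda>"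
    using flatten_measurable[of \<Lambda>] by (simp cong: measurable_cong_sets add: sets_PiM_\<gamma>)
  let ?J = "flatten \<Lambda> -` jump_set \<Lambda> F \<epsilon> n \<inter> space (PiM \<Lambda> (\<lambda>_. \<gamma>))"
  let ?R = "\<Union>j\<in>\<Lambda>. {\<omega> \<in> configs \<beta> \<Lambda>. \<omega> j \<in> rough_loops \<delta>}"
  have J: "jump_set \<Lambda> F \<epsilon> n \<in> sets (config_sigma \<beta> \<Lambda>)"
    by (intro openin_in_config_sigma fin openin_jump_set F)
  have JM: "?J \<in> sets (PiM \<Lambda> (\<lambda>_. \<gamma>))"
    by (rule measurable_sets[OF FM J])
  have R: "rough_loops \<delta> \<in> sets \<gamma>"
    by (simp add: sets_\<gamma> rough_loops_measurable)
  have eq: "{\<omega> \<in> configs \<beta> \<Lambda>. \<omega> j \<in> rough_loops \<delta>} = (\<lambda>\<omega>. \<omega> j) -` rough_loops \<delta> \<inter> space (PiM \<Lambda> (\<lambda>_. \<gamma>))" for j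
    by (auto simp: space_PiM_\<gamma>)
  have RM: "?R \<in> sets (PiM \<Lambda> (\<lambda>_. \<gamma>))"
    unfolding eq by (intro sets.finite_UN[OF fin] measurable_sets[OF _ R] measurable_component_singleton)
  have "{\<omega> \<in> configs \<beta> \<Lambda>. \<bar>F \<omega> - F (flatten \<Lambda> \<omega>)\<bar> > \<epsilon>} \<subseteq> ?J \<union> ?R"
  proof
    fix \<omega> assume \<omega>: "\<omega> \<in> {\<omega> \<in> configs \<beta> \<Lambda>. \<bar>F \<omega> - F (flatten \<Lambda> \<omega>)\<bar> > \<epsilon>}"
    show "\<omega> \<in> ?J \<union> ?R"
    proof (cases "\<omega> \<in> ?R")
      case False
      have "mdist (loop_metric \<beta>) (\<omega> j) (flatten \<Lambda> \<omega> j) < inverse (real (Suc n))" if "j \<in> \<Lambda>" for j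
        using smooth_config_near_flatten[of \<omega> \<Lambda> j \<delta>] that \<omega> False \<delta>(2) by fastforce
      then have "flatten \<Lambda> \<omega> \<in> jump_set \<Lambda> F \<epsilon> n"
        using \<omega> flatten_in_configs[of \<Lambda> \<omega>] unfolding jump_set_def by blast
      then show ?thesis
        using \<omega> by (simp add: space_PiM_\<gamma>)
    qed simp
  qed
  then have "measure (PiM \<Lambda> (\<lambda>_. \<gamma>)) {\<omega> \<in> configs \<beta> \<Lambda>. \<bar>F \<omega> - F (flatten \<Lambda> \<omega>)\<bar> > \<epsilon>} \<le> measure (PiM \<Lambda> (\<lambda>_. \<gamma>)) (?J \<union> ?R)"
    using JM RM by (intro P.finite_measure_mono) auto
  also have "\<dots> \<le> measure (PiM \<Lambda> (\<lambda>_. \<gamma>)) ?J + measure (PiM \<Lambda> (\<lambda>_. \<gamma>)) ?R"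
    by (rule measure_Un_le[OF JM RM])
  also have "measure (PiM \<Lambda> (\<lambda>_. \<gamma>)) ?J = measure (qc_reference \<beta> \<Lambda>) (jump_set \<Lambda> F \<epsilon> n)"
    using FM J by (simp add: distr_flatten[OF fin, symmetric] measure_distr)
  finally show ?thesis
    using rough_configs_measure[OF fin \<delta>(1)] by linarith
qed

text \<open>Off the deviation set the two values differ by at most \<epsilon>. On it both are
  dominated by the same exponential, because flattening does not increase squared norms, and
  \<open>exp_truncation\<close> splits this exponential at the level \<tau>.\<close>

lemma integral_difference_bound:
  assumes fin: "finite \<Lambda>" and F: "continuous_map (config_topology \<beta> \<Lambda>) euclideanreal F"
    and \<alpha>: "0 \<le> \<alpha>" "\<alpha> < 1" and D: "D \<ge> 0"
    and bound: "\<And>\<omega>. \<omega> \<in> configs \<beta> \<Lambda> \<Longrightarrow> \<bar>F \<omega>\<bar> \<le> D * exp (\<alpha> / 2 * (\<Sum>j\<in>\<Lambda>. L2_inner \<beta> (\<omega> j) (\<omega> j)))"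
    and p: "p \<ge> 1" "p * \<alpha> < 1"
    and K: "(\<integral>\<^sup>+\<omega>. ennreal (exp (p * \<alpha> / 2 * L2_inner \<beta> \<omega> \<omega>)) \<partial>\<gamma>) \<le> ennreal K"
    and \<epsilon>: "\<epsilon> \<ge> 0"
  shows "\<bar>(LINT \<omega>|PiM \<Lambda> (\<lambda>_. \<gamma>). F \<omega>) - (LINT \<omega>|qc_reference \<beta> \<Lambda>. F \<omega>)\<bar> \<le>
    \<epsilon> + 2 * D * (exp \<tau> * measure (PiM \<Lambda> (\<lambda>_. \<gamma>)) {\<omega> \<in> configs \<beta> \<Lambda>. \<bar>F \<omega> - F (flatten \<Lambda> \<omega>)\<bar> > \<epsilon>}
      + exp (- (p - 1) * \<tau>) * max K 0 ^ card \<Lambda>)"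
proof -
  let ?P = "PiM \<Lambda> (\<lambda>_. \<gamma>)"
  let ?S = "\<lambda>\<omega>. \<Sum>j\<in>\<Lambda>. L2_inner \<beta> (\<omega> j) (\<omega> j)"
  let ?A = "{\<omega> \<in> configs \<beta> \<Lambda>. \<bar>F \<omega> - F (flatten \<Lambda> \<omega>)\<bar> > \<epsilon>}"
  interpret P: prob_space ?P
    by (rule prob_space_PiM_\<gamma>)
  have FM: "F \<in> borel_measurable (config_sigma \<beta> \<Lambda>)"
    by (rule borel_measurable_config[OF fin F])
  have fM: "(\<lambda>\<omega>. F (flatten \<Lambda> \<omega>)) \<in> borel_measurable (config_sigma \<beta> \<Lambda>)"
    by (rule measurable_compose[OF flatten_measurable FM])
  have fb: "\<bar>F (flatten \<Lambda> \<omega>)\<bar> \<le> D * exp (\<alpha> / 2 * ?S \<omega>)" if "\<omega> \<in> configs \<beta> \<Lambda>" for \<omega>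
  proof -
    have "\<bar>F (flatten \<Lambda> \<omega>)\<bar> \<le> D * exp (\<alpha> / 2 * ?S (flatten \<Lambda> \<omega>))"
      by (intro bound flatten_in_configs)
    also have "\<dots> \<le> D * exp (\<alpha> / 2 * ?S \<omega>)"
      using mult_left_mono[OF flatten_sum_le[OF that], of "\<alpha> / 2"] \<alpha> D by (intro mult_left_mono) auto
    finally show ?thesis .
  qed
  have iF: "integrable ?P F" "integrable ?P (\<lambda>\<omega>. F (flatten \<Lambda> \<omega>))"
    by (rule integrable_PiM_\<gamma>[OF fin FM \<alpha> bound] integrable_PiM_\<gamma>[OF fin fM \<alpha> fb]; assumption)+
  have pa: "0 \<le> p * \<alpha>"
    using p \<alpha> by simp
  have iS: "integrable ?P (\<lambda>\<omega>. exp (p * \<alpha> / 2 * ?S \<omega>))"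
    by (rule integrable_PiM_\<gamma>[OF fin _ pa p(2), where D=1]) (use L2_sum_measurable[OF fin] in auto)
  have A: "?A \<in> sets ?P"
  proof -
    have "?A = {\<omega> \<in> space (config_sigma \<beta> \<Lambda>). \<bar>F \<omega> - F (flatten \<Lambda> \<omega>)\<bar> > \<epsilon>}"
      by (simp add: space_config_sigma)
    also have "\<dots> \<in> sets (config_sigma \<beta> \<Lambda>)"
      using FM fM by measurable
    finally show ?thesis
      by (simp add: sets_PiM_\<gamma>)
  qed
  let ?g = "\<lambda>\<omega>. \<epsilon> + 2 * D * (exp \<tau> * indicator ?A \<omega> + exp (- (p - 1) * \<tau>) * exp (p * \<alpha> / 2 * ?S \<omega>))"
  have ig: "integrable ?P ?g"
    using A iS by (intro Bochner_Integration.integrable_add integrable_mult_right) (auto simp: P.emeasure_eq_measure)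
  have "\<bar>(LINT \<omega>|?P. F \<omega>) - (LINT \<omega>|qc_reference \<beta> \<Lambda>. F \<omega>)\<bar> = \<bar>LINT \<omega>|?P. F \<omega> - F (flatten \<Lambda> \<omega>)\<bar>"
    using iF by (simp add: integral_qc_reference[OF fin FM])
  also have "\<dots> \<le> (LINT \<omega>|?P. \<bar>F \<omega> - F (flatten \<Lambda> \<omega>)\<bar>)"
    using integral_norm_bound[of ?P "\<lambda>\<omega>. F \<omega> - F (flatten \<Lambda> \<omega>)"] by simp
  also have "\<dots> \<le> (LINT \<omega>|?P. ?g \<omega>)"
  proof (rule integral_mono[OF _ ig])
    show "integrable ?P (\<lambda>\<omega>. \<bar>F \<omega> - F (flatten \<Lambda> \<omega>)\<bar>)"
      using iF by (intro integrable_abs Bochner_Integration.integrable_diff)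
    fix \<omega> assume "\<omega> \<in> space ?P"
    then have \<omega>: "\<omega> \<in> configs \<beta> \<Lambda>"
      by (simp add: space_PiM_\<gamma>)
    show "\<bar>F \<omega> - F (flatten \<Lambda> \<omega>)\<bar> \<le> ?g \<omega>"
    proof (cases "\<omega> \<in> ?A")
      case True
      have "\<bar>F \<omega> - F (flatten \<Lambda> \<omega>)\<bar> \<le> 2 * D * exp (\<alpha> / 2 * ?S \<omega>)"
        using bound[OF \<omega>] fb[OF \<omega>] by linarith
      also have "\<dots> \<le> 2 * D * (exp \<tau> + exp (p * (\<alpha> / 2 * ?S \<omega>) - (p - 1) * \<tau>))"
        using D p by (intro mult_left_mono exp_truncation) auto
      also have "exp (p * (\<alpha> / 2 * ?S \<omega>) - (p - 1) * \<tau>) = exp (- (p - 1) * \<tau>) * exp (p * \<alpha> / 2 * ?S \<omega>)"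
        by (simp add: algebra_simps flip: exp_add)
      finally show ?thesis
        using True \<epsilon> by simp
    next
      case False
      then have "\<bar>F \<omega> - F (flatten \<Lambda> \<omega>)\<bar> \<le> \<epsilon>"
        using \<omega> by auto
      with False D show ?thesis
        by (simp add: add_increasing2)
    qed
  qed
  also have "\<dots> = \<epsilon> + 2 * D * (exp \<tau> * measure ?P ?A + exp (- (p - 1) * \<tau>) * (LINT \<omega>|?P. exp (p * \<alpha> / 2 * ?S \<omega>)))"
    using A iS by (simp add: P.emeasure_eq_measure P.prob_space)
  also have "\<dots> \<le> \<epsilon> + 2 * D * (exp \<tau> * measure ?P ?A + exp (- (p - 1) * \<tau>) * max K 0 ^ card \<Lambda>)"
    using D nn_integral_exp_sum[OF fin K]
    by (intro add_left_mono mult_left_mono integral_real_bounded) auto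
  finally show ?thesis .
qed

end

text \<open>The order of the choices matters: \<tau> from the uniform p-th moment, then the
  probability \<kappa> allowed for deviations, then the jump level n, then the roughness \<delta>,
  and only then the mass. The three error terms are each at most a quarter of \<eta>.\<close>

lemma (in loop_space) PiM_tendsto_qc_reference:
  assumes fin: "finite \<Lambda>" and F: "continuous_map (config_topology \<beta> \<Lambda>) euclideanreal F"
    and \<alpha>: "0 \<le> \<alpha>" "\<alpha> < 1" and D: "D \<ge> 0"
    and bound: "\<And>\<omega>. \<omega> \<in> configs \<beta> \<Lambda> \<Longrightarrow> \<bar>F \<omega>\<bar> \<le> D * exp (\<alpha> / 2 * (\<Sum>j\<in>\<Lambda>. L2_inner \<beta> (\<omega> j) (\<omega> j)))"
    and \<gamma>: "\<And>m. m > 0 \<Longrightarrow> quantum_reference \<beta> m (\<gamma> m)"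
  shows "((\<lambda>m. LINT \<omega>|PiM \<Lambda> (\<lambda>_. \<gamma> m). F \<omega>) \<longlongrightarrow> (LINT \<omega>|qc_reference \<beta> \<Lambda>. F \<omega>)) at_top"
proof (rule tendstoI)
  fix \<eta> :: real assume \<eta>: "\<eta> > 0"
  define p where "p = 2 / (1 + \<alpha>)"
  have p: "p > 1" "p * \<alpha> < 1" "0 \<le> p * \<alpha>"
    using \<alpha> by (simp_all add: p_def field_simps)
  obtain K where K: "\<And>m. m \<ge> 1 \<Longrightarrow> (\<integral>\<^sup>+\<omega>. ennreal (exp (p * \<alpha> / 2 * L2_inner \<beta> \<omega> \<omega>)) \<partial>\<gamma> m) \<le> ennreal K"
    using exp_moment_bound[OF p(3,2) zero_less_one] \<gamma> by (metis less_le_trans zero_less_one)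
  define B where "B = max K 0 ^ card \<Lambda>"
  \<comment> \<open>The added 1 keeps X positive, so that the logarithm defining \<tau> has a
    positive argument even if D or B vanishes.\<close>
  define X where "X = 2 * D * B + 1"
  have B: "B \<ge> 0" and X: "X > 0"
    using D by (simp_all add: B_def X_def add_nonneg_pos)
  define \<tau> where "\<tau> = ln (4 * X / \<eta>) / (p - 1)"
  have \<tau>: "exp (- (p - 1) * \<tau>) = \<eta> / (4 * X)"
  proof -
    have "(p - 1) * \<tau> = ln (4 * X / \<eta>)"
      using p by (simp add: \<tau>_def)
    then have "- (p - 1) * \<tau> = - ln (4 * X / \<eta>)"
      by linarith
    then show ?thesis
      using X \<eta> by (simp add: exp_minus)
  qed
  have small1: "2 * D * (exp (- (p - 1) * \<tau>) * B) \<le> \<eta> / 4"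
  proof -
    have "2 * D * (exp (- (p - 1) * \<tau>) * B) = (2 * D * B) / X * (\<eta> / 4)"
      unfolding \<tau> using X by simp
    also have "\<dots> \<le> 1 * (\<eta> / 4)"
      using X \<eta> by (intro mult_right_mono) (simp_all add: X_def)
    finally show ?thesis by simp
  qed
  define \<kappa> where "\<kappa> = \<eta> / (8 * (D + 1) * exp \<tau>)"
  have \<kappa>: "\<kappa> > 0" "2 * D * (exp \<tau> * \<kappa>) \<le> \<eta> / 4"
  proof -
    show "\<kappa> > 0"
      using \<eta> D by (simp add: \<kappa>_def)
    have "2 * D * (e * (\<eta> / (8 * d * e))) = D / d * (\<eta> / 4)" if "d > 0" "e > 0" for d e :: real
      using that by simp
    from this[of "D + 1" "exp \<tau>"] have "2 * D * (exp \<tau> * \<kappa>) = D / (D + 1) * (\<eta> / 4)"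
      using D by (simp only: \<kappa>_def exp_gt_zero add_nonneg_pos zero_less_one)
    also have "\<dots> \<le> 1 * (\<eta> / 4)"
      using D \<eta> by (intro mult_right_mono) simp_all
    finally show "2 * D * (exp \<tau> * \<kappa>) \<le> \<eta> / 4" by simp
  qed
  \<comment> \<open>Any mass would do: it only serves to see that \<open>qc_reference\<close> is a
    probability measure.\<close>
  interpret g1: gaussian_loop \<beta> 1 "\<gamma> 1"
    using \<gamma>[of 1] by unfold_locales auto
  have "(\<lambda>n. measure (qc_reference \<beta> \<Lambda>) (jump_set \<Lambda> F (\<eta> / 4) n)) \<longlonglongrightarrow> 0"
    using \<eta> by (intro jump_set_tendsto fin F g1.prob_space_qc_reference) (auto simp: qc_reference_def)
  then have "eventually (\<lambda>n. measure (qc_reference \<beta> \<Lambda>) (jump_set \<Lambda> F (\<eta> / 4) n) < \<kappa> / 2) sequentially"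
    using \<kappa>(1) by (intro order_tendstoD(2)) auto
  then obtain n where n: "measure (qc_reference \<beta> \<Lambda>) (jump_set \<Lambda> F (\<eta> / 4) n) < \<kappa> / 2"
    by (auto simp: eventually_sequentially)
  \<comment> \<open>Since 32/64 = 1/2, configurations without rough loops stay strictly within the
    radius of the jump set of level n.\<close>
  define \<delta> where "\<delta> = inverse (real (Suc n)) / 64"
  have \<delta>: "\<delta> > 0" "32 * \<delta> < inverse (real (Suc n))"
    by (simp_all add: \<delta>_def)
  define T where "T = real (card \<Lambda>) * (8 * (tail_const * \<beta>\<^sup>2 / \<delta> ^ 8))"
  have T: "T \<ge> 0"
    using increment_const_pos \<delta> by (simp add: T_def tail_const_def)
  show "eventually (\<lambda>m. dist (LINT \<omega>|PiM \<Lambda> (\<lambda>_. \<gamma> m). F \<omega>) (LINT \<omega>|qc_reference \<beta> \<Lambda>. F \<omega>) < \<eta>) at_top"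
    using eventually_ge_at_top[of 1] eventually_gt_at_top[of "2 * T / \<kappa>"]
  proof eventually_elim
    case (elim m)
    interpret gaussian_loop \<beta> m "\<gamma> m"
      using \<gamma>[of m] elim by unfold_locales auto
    let ?A = "{\<omega> \<in> configs \<beta> \<Lambda>. \<bar>F \<omega> - F (flatten \<Lambda> \<omega>)\<bar> > \<eta> / 4}"
    \<comment> \<open>The bound on rough configurations is \<open>T / m ^ 4\<close>; for
      \<open>m \<ge> 1\<close> it is replaced by the simpler \<open>T / m\<close>.\<close>
    have "m \<le> m ^ 4"
      using elim by (simp add: self_le_power)
    then have "T / m ^ 4 \<le> T / m"
      using elim T by (intro divide_left_mono) auto
    also have "T / m \<le> \<kappa> / 2"
      using elim \<kappa>(1) by (simp add: field_simps)
    finally have "T / m ^ 4 \<le> \<kappa> / 2" .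
    moreover have "real (card \<Lambda>) * (8 * (tail_const * \<beta>\<^sup>2 / (m ^ 4 * \<delta> ^ 8))) = T / m ^ 4"
      by (simp add: T_def mult_ac)
    ultimately have "measure (PiM \<Lambda> (\<lambda>_. \<gamma> m)) ?A \<le> \<kappa>"
      using deviation_measure[OF fin F \<delta>, of "\<eta> / 4"] n by linarith
    then have "2 * D * (exp \<tau> * measure (PiM \<Lambda> (\<lambda>_. \<gamma> m)) ?A) \<le> 2 * D * (exp \<tau> * \<kappa>)"
      using D by (intro mult_left_mono) auto
    with \<kappa>(2) have small2: "2 * D * (exp \<tau> * measure (PiM \<Lambda> (\<lambda>_. \<gamma> m)) ?A) \<le> \<eta> / 4"
      by linarith
    have "\<bar>(LINT \<omega>|PiM \<Lambda> (\<lambda>_. \<gamma> m). F \<omega>) - (LINT \<omega>|qc_reference \<beta> \<Lambda>. F \<omega>)\<bar> \<le>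
        \<eta> / 4 + 2 * D * (exp \<tau> * measure (PiM \<Lambda> (\<lambda>_. \<gamma> m)) ?A + exp (- (p - 1) * \<tau>) * B)"
      unfolding B_def using p \<eta>
      by (intro integral_difference_bound[OF fin F \<alpha> D bound _ p(2) K[OF elim(1)]]) auto
    also have "\<dots> < \<eta>"
      using small1 small2 \<eta> unfolding distrib_left by linarith
    finally show ?case
      by (simp add: dist_real_def)
  qed
qed

section \<open>From the reference measures to the Gibbs measures\<close>

lemma weighted_density_integral:
  fixes f G :: "'a \<Rightarrow> real"
  assumes "f \<in> borel_measurable M" "G \<in> borel_measurable M" "\<And>x. f x > 0" "z > 0"
  shows "(LINT x|density M (\<lambda>x. ennreal (1 / z * f x)). G x) = (LINT x|M. G x * f x) / z"
  using assms
  by (subst integral_real_density) (auto simp: less_imp_le mult.commute)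

text \<open>A Gibbs expectation of G is the quotient of the integrals of \<open>G * w\<close> and of
  \<open>w\<close>, the Boltzmann factor. Both integrals converge by
  \<open>PiM_tendsto_qc_reference\<close>, and the limiting denominator is positive.\<close>

lemma (in interaction) gibbs_limit:
  assumes c': "c' > c - 1"
    and \<gamma>: "\<And>m. m > 0 \<Longrightarrow> quantum_reference \<beta> m (\<gamma> m)"
    and \<zeta>: "\<zeta> \<in> configs \<beta> UNIV"
  shows "\<And>m. m > 0 \<Longrightarrow> prob_space (quantum_gibbs (\<gamma> m) \<beta> J U \<Lambda> \<zeta>)"
    and "prob_space (qc_gibbs \<beta> J U \<Lambda> \<zeta>)"
    and "converges_weakly (config_topology \<beta> \<Lambda>)
             (\<lambda>m. quantum_gibbs (\<gamma> m) \<beta> J U \<Lambda> \<zeta>) (qc_gibbs \<beta> J U \<Lambda> \<zeta>) at_top"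
proof -
  define w where "w \<omega> = exp (- energy \<beta> J U \<Lambda> \<omega> \<zeta>)" for \<omega>
  have w_pos: "w \<omega> > 0" for \<omega>
    by (simp add: w_def)
  have wc: "continuous_map (config_topology \<beta> \<Lambda>) euclideanreal w"
  proof -
    have "continuous_map euclideanreal euclideanreal (\<lambda>x. exp (- x) :: real)"
      by (auto intro!: continuous_intros)
    from continuous_map_compose[OF energy_continuous[OF \<zeta>] this] show ?thesis
      by (simp add: o_def w_def[abs_def])
  qed
  have wM: "w \<in> borel_measurable (config_sigma \<beta> \<Lambda>)"
    by (rule borel_measurable_config[OF \<Lambda>_fin wc])
  \<comment> \<open>The midpoint between \<open>max (c - c') 0\<close> and 1; it is below 1 because
    \<open>c' > c - 1\<close>, and it exceeds \<open>c - c'\<close>.\<close>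
  define \<alpha> where "\<alpha> = (max (c - c') 0 + 1) / 2"
  have \<alpha>: "0 \<le> \<alpha>" "\<alpha> < 1" "\<alpha> > c - c'"
    using c' by (auto simp: \<alpha>_def max_def field_simps)
  obtain K where K: "\<And>\<omega>. \<omega> \<in> configs \<beta> \<Lambda> \<Longrightarrow>
      - energy \<beta> J U \<Lambda> \<omega> \<zeta> \<le> K + \<alpha> / 2 * (\<Sum>j\<in>\<Lambda>. L2_inner \<beta> (\<omega> j) (\<omega> j))"
    using energy_lower_bound[OF \<zeta> \<alpha>(3)] by blast
  have wb: "\<bar>w \<omega>\<bar> \<le> exp K * exp (\<alpha> / 2 * (\<Sum>j\<in>\<Lambda>. L2_inner \<beta> (\<omega> j) (\<omega> j)))" if "\<omega> \<in> configs \<beta> \<Lambda>" for \<omega>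
    using K[OF that] by (simp add: w_def flip: exp_add)
  have qs: "sets (qc_reference \<beta> \<Lambda>) = sets (config_sigma \<beta> \<Lambda>)"
    by (simp add: qc_reference_def)
  have g: "gibbs \<rho> \<beta> J U \<Lambda> \<zeta> = density \<rho> (\<lambda>\<omega>. ennreal (1 / (LINT \<omega>|\<rho>. w \<omega>) * w \<omega>))" for \<rho>
    by (simp add: gibbs_def w_def Let_def)
  have q: "prob_space (PiM \<Lambda> (\<lambda>_. \<gamma> m))" "sets (PiM \<Lambda> (\<lambda>_. \<gamma> m)) = sets (config_sigma \<beta> \<Lambda>)"
      "integrable (PiM \<Lambda> (\<lambda>_. \<gamma> m)) w" if "m > 0" for m
  proof -
    interpret gaussian_loop \<beta> m "\<gamma> m"
      using \<gamma> that by unfold_locales auto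
    show "prob_space (PiM \<Lambda> (\<lambda>_. \<gamma> m))"
      by (rule prob_space_PiM_\<gamma>)
    show "sets (PiM \<Lambda> (\<lambda>_. \<gamma> m)) = sets (config_sigma \<beta> \<Lambda>)"
      by (rule sets_PiM_\<gamma>)
    show "integrable (PiM \<Lambda> (\<lambda>_. \<gamma> m)) w"
      by (rule integrable_PiM_\<gamma>[OF \<Lambda>_fin wM \<alpha>(1,2) wb])
  qed
  interpret g1: gaussian_loop \<beta> 1 "\<gamma> 1"
    using \<gamma>[of 1] by unfold_locales auto
  have qc: "prob_space (qc_reference \<beta> \<Lambda>)"
    by (rule g1.prob_space_qc_reference[OF \<Lambda>_fin])
  have qci: "integrable (qc_reference \<beta> \<Lambda>) w"
    unfolding g1.integral_qc_reference(2)[OF \<Lambda>_fin wM]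
  proof (rule g1.integrable_PiM_\<gamma>[OF \<Lambda>_fin measurable_compose[OF flatten_measurable wM] \<alpha>(1,2)])
    fix \<omega> :: "'k \<Rightarrow> real \<Rightarrow> real" assume \<omega>: "\<omega> \<in> configs \<beta> \<Lambda>"
    have "\<bar>w (flatten \<Lambda> \<omega>)\<bar> \<le> exp K * exp (\<alpha> / 2 * (\<Sum>j\<in>\<Lambda>. L2_inner \<beta> (flatten \<Lambda> \<omega> j) (flatten \<Lambda> \<omega> j)))"
      by (intro wb flatten_in_configs)
    also have "\<dots> \<le> exp K * exp (\<alpha> / 2 * (\<Sum>j\<in>\<Lambda>. L2_inner \<beta> (\<omega> j) (\<omega> j)))"
      using mult_left_mono[OF flatten_sum_le[OF \<omega>], of "\<alpha> / 2"] \<alpha> by (intro mult_left_mono) auto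
    finally show "\<bar>w (flatten \<Lambda> \<omega>)\<bar> \<le> \<dots>" .
  qed
  note pq = prob_space.prob_space_normalized_density[OF q(1,3) w_pos]
    and pqc = prob_space.prob_space_normalized_density[OF qc qci w_pos]
  show "prob_space (quantum_gibbs (\<gamma> m) \<beta> J U \<Lambda> \<zeta>)" if "m > 0" for m
    unfolding quantum_gibbs_def g using that by (intro pq(2))
  show "prob_space (qc_gibbs \<beta> J U \<Lambda> \<zeta>)"
    unfolding qc_gibbs_def g by (rule pqc(2))
  show "converges_weakly (config_topology \<beta> \<Lambda>)
      (\<lambda>m. quantum_gibbs (\<gamma> m) \<beta> J U \<Lambda> \<zeta>) (qc_gibbs \<beta> J U \<Lambda> \<zeta>) at_top"
    unfolding converges_weakly_def
  proof (intro allI impI, elim conjE)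
    fix G :: "('k \<Rightarrow> real \<Rightarrow> real) \<Rightarrow> real"
    assume G: "continuous_map (config_topology \<beta> \<Lambda>) euclideanreal G"
      and Gb: "bounded (G ` topspace (config_topology \<beta> \<Lambda>))"
    obtain C where C: "C > 0" "\<And>\<omega>. \<omega> \<in> configs \<beta> \<Lambda> \<Longrightarrow> \<bar>G \<omega>\<bar> \<le> C"
      using Gb unfolding bounded_pos topspace_config_topology by auto
    have GM: "G \<in> borel_measurable (config_sigma \<beta> \<Lambda>)"
      by (rule borel_measurable_config[OF \<Lambda>_fin G])
    have "((\<lambda>m. LINT \<omega>|PiM \<Lambda> (\<lambda>_. \<gamma> m). w \<omega>) \<longlongrightarrow> (LINT \<omega>|qc_reference \<beta> \<Lambda>. w \<omega>)) at_top"
      by (rule PiM_tendsto_qc_reference[OF \<Lambda>_fin wc \<alpha>(1,2) _ wb \<gamma>]) auto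
    moreover have "((\<lambda>m. LINT \<omega>|PiM \<Lambda> (\<lambda>_. \<gamma> m). G \<omega> * w \<omega>) \<longlongrightarrow> (LINT \<omega>|qc_reference \<beta> \<Lambda>. G \<omega> * w \<omega>)) at_top"
    proof (rule PiM_tendsto_qc_reference[OF \<Lambda>_fin _ \<alpha>(1,2) _ _ \<gamma>, where D="C * exp K"])
      show "continuous_map (config_topology \<beta> \<Lambda>) euclideanreal (\<lambda>\<omega>. G \<omega> * w \<omega>)"
        by (intro continuous_map_real_mult G wc)
      fix \<omega> :: "'k \<Rightarrow> real \<Rightarrow> real" assume \<omega>: "\<omega> \<in> configs \<beta> \<Lambda>"
      show "\<bar>G \<omega> * w \<omega>\<bar> \<le> C * exp K * exp (\<alpha> / 2 * (\<Sum>j\<in>\<Lambda>. L2_inner \<beta> (\<omega> j) (\<omega> j)))"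
        unfolding abs_mult mult.assoc using C \<omega> by (intro mult_mono wb) auto
    qed (use C in auto)
    ultimately have "((\<lambda>m. (LINT \<omega>|PiM \<Lambda> (\<lambda>_. \<gamma> m). G \<omega> * w \<omega>) / (LINT \<omega>|PiM \<Lambda> (\<lambda>_. \<gamma> m). w \<omega>)) \<longlongrightarrow>
        (LINT \<omega>|qc_reference \<beta> \<Lambda>. G \<omega> * w \<omega>) / (LINT \<omega>|qc_reference \<beta> \<Lambda>. w \<omega>)) at_top"
      using pqc(1) by (intro tendsto_divide) auto
    moreover have "(LINT \<omega>|qc_gibbs \<beta> J U \<Lambda> \<zeta>. G \<omega>) = (LINT \<omega>|qc_reference \<beta> \<Lambda>. G \<omega> * w \<omega>) / (LINT \<omega>|qc_reference \<beta> \<Lambda>. w \<omega>)"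
      unfolding qc_gibbs_def g using wM GM pqc(1) w_pos
      by (intro weighted_density_integral) (simp_all cong: measurable_cong_sets add: qs)
    moreover have "eventually (\<lambda>m. (LINT \<omega>|PiM \<Lambda> (\<lambda>_. \<gamma> m). G \<omega> * w \<omega>) / (LINT \<omega>|PiM \<Lambda> (\<lambda>_. \<gamma> m). w \<omega>) = (LINT \<omega>|quantum_gibbs (\<gamma> m) \<beta> J U \<Lambda> \<zeta>. G \<omega>)) at_top"
      using eventually_gt_at_top[of 0]
    proof eventually_elim
      case (elim m)
      show ?case
        unfolding quantum_gibbs_def g using wM GM pq(1)[OF elim elim] w_pos
        by (intro weighted_density_integral[symmetric]) (simp_all cong: measurable_cong_sets add: q(2)[OF elim])
    qed
    ultimately show "((\<lambda>m. LINT \<omega>|quantum_gibbs (\<gamma> m) \<beta> J U \<Lambda> \<zeta>. G \<omega>) \<longlongrightarrow> (LINT \<omega>|qc_gibbs \<beta> J U \<Lambda> \<zeta>. G \<omega>)) at_top"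
      by (simp add: filterlim_cong[OF refl refl])
  qed
qed

text \<open>The two energies may differ on general loops, but \<open>qc_reference\<close> is carried
  by configurations of constant loops, where they agree. Hence the normalizations are equal and the
  densities agree almost everywhere.\<close>

lemma (in interaction) qc_gibbs_mean:
  assumes \<zeta>: "\<zeta> \<in> mean_configs \<beta> y"
  shows "qc_gibbs \<beta> J U \<Lambda> \<zeta> = qc_gibbs \<beta> J U \<Lambda> (\<lambda>j. const_loop \<beta> (y j))"
proof -
  let ?Q = "qc_reference \<beta> \<Lambda>"
  let ?E = "\<lambda>\<omega>. energy \<beta> J U \<Lambda> \<omega> \<zeta>"
  let ?E' = "\<lambda>\<omega>. energy \<beta> J U \<Lambda> \<omega> (\<lambda>j. const_loop \<beta> (y j))"
  have M: "?E \<in> borel_measurable (config_sigma \<beta> \<Lambda>)" "?E' \<in> borel_measurable (config_sigma \<beta> \<Lambda>)"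
    using \<zeta> by (auto intro!: borel_measurable_config energy_continuous \<Lambda>_fin simp: mean_configs_def configs_def)
  have QM: "borel_measurable ?Q = borel_measurable (config_sigma \<beta> \<Lambda>)"
    by (intro measurable_cong_sets) (simp_all add: qc_reference_def)
  have sq: "sets (qc_density_measure \<beta> \<Lambda>) = sets (PiM \<Lambda> (\<lambda>_. borel))"
    unfolding qc_density_measure_def by (intro sets_PiM_cong) auto
  have "(\<lambda>x. \<lambda>j\<in>\<Lambda>. const_loop \<beta> (x j)) \<in> qc_density_measure \<beta> \<Lambda> \<rightarrow>\<^sub>M config_sigma \<beta> \<Lambda>"
    using flatten_const_measurable[of \<Lambda>] by (simp cong: measurable_cong_sets add: sq)
  then have AE: "AE \<omega> in ?Q. ?E \<omega> = ?E' \<omega>"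
    unfolding qc_reference_def using M energy_const_loops[OF \<zeta>]
    by (subst AE_distr_iff) auto
  have "(LINT \<omega>|?Q. exp (- ?E \<omega>)) = (LINT \<omega>|?Q. exp (- ?E' \<omega>))"
    using AE M by (intro integral_cong_AE) (auto simp: QM)
  then show ?thesis
    unfolding qc_gibbs_def gibbs_def Let_def
    using AE M by (intro density_cong) (auto simp: QM)
qed

text \<open>Every coordinate is bounded by the Euclidean norm, so the ball sits in a finite box.
  This turns finite range into finitely many neighbours.\<close>

lemma finite_lattice_ball:
  fixes j :: "int ^ 'd"
  shows "finite {k. norm ((\<chi> i. real_of_int (j $ i - k $ i)) :: real ^ 'd) \<le> r}"
proof (rule finite_subset)
  show "{k. norm ((\<chi> i. real_of_int (j $ i - k $ i)) :: real ^ 'd) \<le> r} \<subseteq>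
      vec_lambda ` (PiE UNIV (\<lambda>i. {j $ i - \<lceil>r\<rceil>..j $ i + \<lceil>r\<rceil>}))"
  proof
    fix k assume "k \<in> {k. norm ((\<chi> i. real_of_int (j $ i - k $ i)) :: real ^ 'd) \<le> r}"
    then have n: "norm ((\<chi> i. real_of_int (j $ i - k $ i)) :: real ^ 'd) \<le> r"
      by simp
    have "k $ i \<in> {j $ i - \<lceil>r\<rceil>..j $ i + \<lceil>r\<rceil>}" for i
    proof -
      have "\<bar>real_of_int (j $ i - k $ i)\<bar> \<le> r"
        using order_trans[OF component_le_norm_cart n, of i] by simp
      then have "\<bar>j $ i - k $ i\<bar> \<le> \<lceil>r\<rceil>"
        by linarith
      then show ?thesis
        by auto
    qed
    then show "k \<in> vec_lambda ` (PiE UNIV (\<lambda>i. {j $ i - \<lceil>r\<rceil>..j $ i + \<lceil>r\<rceil>}))"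
      by (intro image_eqI[of _ _ "vec_nth k"]) (auto simp: vec_lambda_eta)
  qed
qed (intro finite_imageI finite_PiE, auto)

theorem theorem3p2:
  fixes J :: "int ^ 'd \<Rightarrow> int ^ 'd \<Rightarrow> real"
    and U :: "int ^ 'd \<Rightarrow> real \<Rightarrow> real"
    and r c c' b \<beta> :: real
    and \<Lambda> :: "(int ^ 'd) set"
    and y :: "int ^ 'd \<Rightarrow> real"
    and \<gamma> :: "real \<Rightarrow> (real \<Rightarrow> real) measure"
  assumes J_sym: "\<And>j k. J j k = J k j"
    and r_pos: "r > 0"
    and J_range: "\<And>j k. norm ((\<chi> i. real_of_int (j $ i - k $ i)) :: real ^ 'd) > r \<Longrightarrow> J j k = 0"
    and J_bdd: "bdd_above (range (\<lambda>j. \<Sum>\<^sub>\<infinity>k. \<bar>J j k\<bar>))"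
    and c_def: "c = (SUP j. \<Sum>\<^sub>\<infinity>k. \<bar>J j k\<bar>)"
    and U_cont: "\<And>k. continuous_on UNIV (U k)"
    and c'_gt: "c' > max (c - 1) 0"
    and U_bound: "\<And>k x. U k x \<ge> (1 / 2) * c' * x\<^sup>2 + b"
    and \<beta>_pos: "\<beta> > 0"
    and \<gamma>: "\<And>m. m > 0 \<Longrightarrow> quantum_reference \<beta> m (\<gamma> m)"
    and \<Lambda>_fin: "finite \<Lambda>"
  shows "\<forall>\<zeta>\<in>mean_configs \<beta> y.
           qc_gibbs \<beta> J U \<Lambda> \<zeta> = qc_gibbs \<beta> J U \<Lambda> (\<lambda>j. const_loop \<beta> (y j))
         \<and> (\<forall>m>0. prob_space (quantum_gibbs (\<gamma> m) \<beta> J U \<Lambda> \<zeta>))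
         \<and> prob_space (qc_gibbs \<beta> J U \<Lambda> \<zeta>)
         \<and> converges_weakly (config_topology \<beta> \<Lambda>)
             (\<lambda>m. quantum_gibbs (\<gamma> m) \<beta> J U \<Lambda> \<zeta>) (qc_gibbs \<beta> J U \<Lambda> \<zeta>) at_top"
proof -
  have fin: "finite {k. J j k \<noteq> 0}" for j
    by (rule finite_subset[OF _ finite_lattice_ball[of j r]]) (use J_range in \<open>force simp: not_le[symmetric]\<close>)
  have sum: "(\<Sum>\<^sub>\<infinity>k. \<bar>J j k\<bar>) \<le> c" for j
    unfolding c_def using J_bdd by (intro cSUP_upper) auto
  interpret interaction \<beta> J U c c' b \<Lambda>
    by unfold_locales (fact \<beta>_pos J_sym fin sum U_cont U_bound \<Lambda>_fin)+
  show ?thesis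
  proof (intro ballI conjI allI impI)
    fix \<zeta> assume \<zeta>: "\<zeta> \<in> mean_configs \<beta> y"
    then have \<zeta>c: "\<zeta> \<in> configs \<beta> UNIV"
      by (simp add: mean_configs_def)
    have c': "c' > c - 1"
      using c'_gt by simp
    note L = gibbs_limit[OF c' \<gamma> \<zeta>c]
    show "qc_gibbs \<beta> J U \<Lambda> \<zeta> = qc_gibbs \<beta> J U \<Lambda> (\<lambda>j. const_loop \<beta> (y j))"
      by (rule qc_gibbs_mean[OF \<zeta>])
    show "prob_space (quantum_gibbs (\<gamma> m) \<beta> J U \<Lambda> \<zeta>)" if "m > 0" for m
      using that by (intro L(1))
    show "prob_space (qc_gibbs \<beta> J U \<Lambda> \<zeta>)"
      by (rule L(2))
    show "converges_weakly (config_topology \<beta> \<Lambda>)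
        (\<lambda>m. quantum_gibbs (\<gamma> m) \<beta> J U \<Lambda> \<zeta>) (qc_gibbs \<beta> J U \<Lambda> \<zeta>) at_top"
      by (rule L(3))
  qed
qed

end
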